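(* For all integers $g\ge 0$ and $n\ge 0$, \[ {\sf u}_{g+2}(n+2)={\sf t}_{g}(n)+{\sf d}_{g+2}(n)+4\,{\sf u}_{g+2}(n+1)-3\,{\sf u}_{g+2}(n)+(n+1)(2n+1)\,{\sf u}_{g+1}(n), \] where \[ {\sf d}_{g+2}(n)=3\sum_{g_1=0}^{g+1}\sum_{m=0}^{n}{\sf u}^{*}_{g_1}(m)\,{\sf b}_{g+1-g_1}(n-m) +\sum_{g_1,g_2}\ \sum_{m_1,m_2}{\sf u}^{*}_{g_1}(m_1)\,{\sf u}^{*}_{g_2}(m_2)\,{\sf u}^{*}_{g+2-g_1-g_2}(n-m_1-m_2), \] the second sum running over all integers $g_1,g_2\ge 0$ with $g_1+g_2\le g+2$ and all integers $m_1,m_2\ge 0$ with $m_1+m_2\le n$, and where ${\sf u}^{*}_{g}(n)=0$ if $g=0$ and $n=0$, and ${\sf u}^{*}_{g}(n)={\sf u}_{g}(n)$ otherwise.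
   Context: A $k$-cellular map is a triple $(H,\alpha,(\gamma_i)_{1\le i\le k})$ where $H$ is a finite set (of half-edges) of even cardinality, $\alpha$ is a fixed-point-free involution of $H$ (its 2-cycles are the edges), and $\gamma_1,\dots,\gamma_k$ are cycles with pairwise disjoint supports whose union is $H$ (the faces); put $\gamma=\prod_i\gamma_i$. The vertices are the cycles (including fixed points) of $\sigma=\alpha\circ\gamma$. The combinatorial graph has the vertices as vertices and the edges as edges, an edge joining the vertices containing its two half-edges. For a map with connected combinatorial graph, its genus $g$ is given by $2-2g=V-E+k$, with $V$ the number of vertices and $E$ the number of edges. A planted $k$-cellular map is one in which each face $\gamma_i$ contains a distinguished half-edge $p_i$ with $\sigma(p_i)=p_i$ (the plant of $\gamma_i$); the edges $\{p_i,\alpha(p_i)\}$ are plant edges and all other edges are $(np)$-edges. Maps are considered up to isomorphism (bijections of half-edge sets commuting with $\alpha$ and each $\gamma_i$ and preserving the plants). A planted unicellular map is a planted $1$-cellular map; ${\sf u}_g(n)$ denotes the number of planted unicellular maps of genus $g$ with $n$ $(np)$-edges (taken to be $0$ if $g<0$ or $n<0$). A planted bicellular (resp. tricellular) map is a planted $2$-cellular (resp. $3$-cellular) map whose combinatorial graph is connected; ${\sf b}_g(n)$ (resp. ${\sf t}_g(n)$) denotes the number of planted bicellular (resp. tricellular) maps of genus $g$ with $n$ $(np)$-edges. *)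

theory Defs
  imports Main
begin

text \<open>A k-cellular map with half-edges drawn from nat. The faces gamma_1..gamma_k are
encoded by a single permutation gam (their product) together with a labelling
fc of half-edges by face index (face i is the cycle of gam on the fibre fc = i,
indices 0..k-1). pl i is the plant of face i.\<close>

record pmap =
  hs  :: "nat set"
  al  :: "nat \<Rightarrow> nat"
  gam :: "nat \<Rightarrow> nat"
  fc  :: "nat \<Rightarrow> nat"
  pl  :: "nat \<Rightarrow> nat"

definition sig :: "pmap \<Rightarrow> nat \<Rightarrow> nat" where
  "sig M = al M \<circ> gam M"

definition orb :: "(nat \<Rightarrow> nat) \<Rightarrow> nat \<Rightarrow> nat set" where
  "orb f x = {(f ^^ j) x | j. True}"

definition cellular_map :: "nat \<Rightarrow> pmap \<Rightarrow> bool" where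
  "cellular_map k M \<longleftrightarrow>
     finite (hs M) \<and> even (card (hs M)) \<and>
     (\<forall>x\<in>hs M. al M x \<in> hs M \<and> al M x \<noteq> x \<and> al M (al M x) = x) \<and>
     bij_betw (gam M) (hs M) (hs M) \<and>
     (\<forall>x\<in>hs M. fc M x < k) \<and>
     (\<forall>i<k. \<exists>x\<in>hs M. fc M x = i) \<and>
     (\<forall>x\<in>hs M. \<forall>y\<in>hs M. fc M x = fc M y \<longleftrightarrow> y \<in> orb (gam M) x)"

definition planted_map :: "nat \<Rightarrow> pmap \<Rightarrow> bool" where
  "planted_map k M \<longleftrightarrow> cellular_map k M \<and>
     (\<forall>i<k. pl M i \<in> hs M \<and> fc M (pl M i) = i \<and> sig M (pl M i) = pl M i)"

definition vertices :: "pmap \<Rightarrow> nat set set" where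
  "vertices M = {orb (sig M) x | x. x \<in> hs M}"

definition edges :: "pmap \<Rightarrow> nat set set" where
  "edges M = {{x, al M x} | x. x \<in> hs M}"

definition plant_edges :: "nat \<Rightarrow> pmap \<Rightarrow> nat set set" where
  "plant_edges k M = {{pl M i, al M (pl M i)} | i. i < k}"

definition np_edges :: "nat \<Rightarrow> pmap \<Rightarrow> nat" where
  "np_edges k M = card (edges M - plant_edges k M)"

text \<open>Combinatorial graph: vertices are sigma-cycles, each edge {x, al x} joins the
vertex containing x and the vertex containing al x.\<close>
definition graph_adj :: "pmap \<Rightarrow> (nat set \<times> nat set) set" where
  "graph_adj M = {(orb (sig M) x, orb (sig M) (al M x)) | x. x \<in> hs M}"

definition graph_connected :: "pmap \<Rightarrow> bool" where
  "graph_connected M \<longleftrightarrow>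
     (\<forall>u\<in>vertices M. \<forall>v\<in>vertices M. (u, v) \<in> ((graph_adj M) \<union> (graph_adj M)\<inverse>)\<^sup>*)"

definition has_genus :: "nat \<Rightarrow> pmap \<Rightarrow> nat \<Rightarrow> bool" where
  "has_genus k M g \<longleftrightarrow> graph_connected M \<and>
     2 - 2 * int g = int (card (vertices M)) - int (card (edges M)) + int k"

definition map_iso :: "nat \<Rightarrow> pmap \<Rightarrow> pmap \<Rightarrow> bool" where
  "map_iso k M M' \<longleftrightarrow> (\<exists>\<phi>. bij_betw \<phi> (hs M) (hs M') \<and>
     (\<forall>x\<in>hs M. \<phi> (al M x) = al M' (\<phi> x)) \<and>
     (\<forall>x\<in>hs M. \<phi> (gam M x) = gam M' (\<phi> x)) \<and>
     (\<forall>x\<in>hs M. fc M' (\<phi> x) = fc M x) \<and>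
     (\<forall>i<k. \<phi> (pl M i) = pl M' i))"

text \<open>Number of isomorphism classes of planted k-cellular maps with connected graph,
genus g and n (np)-edges.\<close>
definition count_maps :: "nat \<Rightarrow> nat \<Rightarrow> nat \<Rightarrow> nat" where
  "count_maps k g n = card
     ({M. planted_map k M \<and> has_genus k M g \<and> np_edges k M = n}
        // {(M, M'). map_iso k M M'})"

definition u :: "nat \<Rightarrow> nat \<Rightarrow> nat" where "u g n = count_maps 1 g n"
definition b :: "nat \<Rightarrow> nat \<Rightarrow> nat" where "b g n = count_maps 2 g n"
definition t :: "nat \<Rightarrow> nat \<Rightarrow> nat" where "t g n = count_maps 3 g n"

definition ustar :: "nat \<Rightarrow> nat \<Rightarrow> nat" where
  "ustar g n = (if g = 0 \<and> n = 0 then 0 else u g n)"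

definition d2 :: "nat \<Rightarrow> nat \<Rightarrow> int" where
  "d2 g n =
     3 * (\<Sum>g1\<le>g+1. \<Sum>m\<le>n. int (ustar g1 m) * int (b (g + 1 - g1) (n - m)))
   + (\<Sum>g1\<le>g+2. \<Sum>g2\<le>g+2-g1. \<Sum>m1\<le>n. \<Sum>m2\<le>n-m1.
        int (ustar g1 m1) * int (ustar g2 m2) * int (ustar (g + 2 - g1 - g2) (n - m1 - m2)))"

end

theory Submission
  imports Defs "HOL-Computational_Algebra.Formal_Power_Series" "HOL-Library.FuncSet" "HOL-Library.Countable"
begin

text \<open>Read off from its plant, each face is a linear word in the remaining half-edges, so a map is a
tuple of words on a set closed under a fixed-point-free involution. Such a tuple has no nontrivial
automorphism; hence every map with n np-edges has exactly 2^n n! labellings, and isomorphism classes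
may be counted through labelled words.

Delete the first letter x of the first word together with its partner; the number of vertices does
not change. If the partner lies in the same word, x A x' B becomes the two words A and B, either
connected or split into two independent maps. If it lies in another word, x A and B x' C become the
single word C B A, and conversely a word of length 2n has (n+1)(2n+1) decompositions into three.
Writing U, B, T for the generating functions, with z marking np-edges and y the genus, the first deletion gives
U = 1 + z (U^2 + y B), and one deletion in a bicellular map expresses B through T, U B and U.
The recursion is the coefficient extraction from these two, with U = 1 + V, where V counts u*.

That genera add up when a map falls apart needs the Euler characteristic to be even and at most 2; for a
bicellular map this is reduced to the unicellular case by deleting an edge joining the two faces.\<close>

section \<open>Components of a relation\<close>

text \<open>Deleting an edge changes the number of faces and of roots, so a vertex permutation would
  have to be rebuilt at each step. Vertices are therefore components of a set of arrows: composing
  with a transposition is then an equality of arrow sets, and dropping a root is a contraction.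

  The involution is negation on nonzero integers, so only the words vary and deleting a first letter
  is a bijection between finite sets. Labelled counts convolve with binomial coefficients; division
  by \<open>2 ^ n * fact n\<close> turns this into the ordinary product of power series, and it also
  absorbs the \<open>card S\<close> possible first letters.

  Euler's relation is stated over nat without division. A part that splits off may thus fail, as far
  as its definition goes, to have any genus at all; \<open>genus_exists\<close> removes this
  obstacle, and it is also what rules out connected remainders in genus 0.\<close>

definition eqc :: "('a \<times> 'a) set \<Rightarrow> ('a \<times> 'a) set" where
  "eqc R = (R \<union> R\<inverse>)\<^sup>*"

lemma eqc_refl [simp]: "(x, x) \<in> eqc R"
  by (simp add: eqc_def)

lemma eqc_sym: "(x, y) \<in> eqc R \<Longrightarrow> (y, x) \<in> eqc R"
  unfolding eqc_def by (rule symD[OF sym_rtrancl[OF sym_Un_converse]])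

lemma eqc_trans: "(x, y) \<in> eqc R \<Longrightarrow> (y, z) \<in> eqc R \<Longrightarrow> (x, z) \<in> eqc R"
  unfolding eqc_def by (rule rtrancl_trans)

lemma eqc_base: "(x, y) \<in> R \<Longrightarrow> (x, y) \<in> eqc R"
  unfolding eqc_def by auto

lemma eqc_map:
  assumes "(x, y) \<in> eqc R" "\<And>x y. (x, y) \<in> R \<Longrightarrow> (h x, h y) \<in> eqc R'"
  shows "(h x, h y) \<in> eqc R'"
  using assms(1) unfolding eqc_def[of R]
proof induction
  case (step y z)
  have "(h y, h z) \<in> eqc R'"
    using step(2)
  proof
    assume "(y, z) \<in> R\<inverse>"
    then have "(z, y) \<in> R" by simp
    then show ?thesis by (rule eqc_sym[OF assms(2)])
  qed (rule assms(2))
  with step(3) show ?case by (rule eqc_trans)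
qed simp

definition ncomp :: "'a set \<Rightarrow> ('a \<times> 'a) set \<Rightarrow> nat" where
  "ncomp S R = card ((\<lambda>x. eqc R `` {x}) ` S)"

lemma eqc_class_eq: "eqc R `` {x} = eqc R `` {y} \<longleftrightarrow> (x, y) \<in> eqc R"
  by (auto intro: eqc_trans eqc_sym)

text \<open>The class of a point is sent to the class of its image. Since \<open>h\<close> may
  collapse points, the map is defined through a chosen representative of each class; equality of
  kernels makes the choice harmless and the map injective.\<close>

lemma card_image_cong_kernel:
  assumes "h ` S = S'" "\<And>x y. x \<in> S \<Longrightarrow> y \<in> S \<Longrightarrow> f x = f y \<longleftrightarrow> f' (h x) = f' (h y)"
  shows "card (f ` S) = card (f' ` S')"
proof -
  have "bij_betw (\<lambda>c. f' (h (SOME x. x \<in> S \<and> f x = c))) (f ` S) (f' ` S')"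
  proof -
    have *: "(SOME y. y \<in> S \<and> f y = f x) \<in> S \<and> f (SOME y. y \<in> S \<and> f y = f x) = f x" if "x \<in> S" for x
      using someI[of "\<lambda>y. y \<in> S \<and> f y = f x" x] that by simp
    have **: "f' (h (SOME y. y \<in> S \<and> f y = f x)) = f' (h x)" if "x \<in> S" for x
      using *[OF that] assms(2) that by blast
    show ?thesis
      unfolding bij_betw_def inj_on_def image_image using ** assms(1,2) by auto
  qed
  then show ?thesis by (rule bij_betw_same_card)
qed

text \<open>Only components have to correspond: an arrow may become a path, \<open>h\<close> may
  collapse points, and \<open>k\<close> undoes \<open>h\<close> up to a path. This covers renaming
  letters as well as contracting one letter onto another.\<close>

lemma ncomp_map:
  assumes "h ` S = S'"
    and "\<And>x y. (x, y) \<in> R \<Longrightarrow> (h x, h y) \<in> eqc R'"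
    and "\<And>x y. (x, y) \<in> R' \<Longrightarrow> (k x, k y) \<in> eqc R"
    and "\<And>x. x \<in> S \<Longrightarrow> (k (h x), x) \<in> eqc R"
  shows "ncomp S R = ncomp S' R'"
  unfolding ncomp_def
proof (rule card_image_cong_kernel[OF assms(1)])
  fix x y assume xy: "x \<in> S" "y \<in> S"
  have "(x, y) \<in> eqc R \<longleftrightarrow> (h x, h y) \<in> eqc R'"
  proof
    assume "(x, y) \<in> eqc R" then show "(h x, h y) \<in> eqc R'" by (rule eqc_map) (rule assms(2))
  next
    assume "(h x, h y) \<in> eqc R'"
    then have "(k (h x), k (h y)) \<in> eqc R" by (rule eqc_map) (rule assms(3))
    then show "(x, y) \<in> eqc R" using assms(4) xy by (meson eqc_trans eqc_sym)
  qed
  then show "(eqc R `` {x} = eqc R `` {y}) = (eqc R' `` {h x} = eqc R' `` {h y})"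
    by (simp add: eqc_class_eq)
qed

lemma ncomp_relabel:
  assumes "inj_on h S" "R \<subseteq> S \<times> S"
  shows "ncomp (h ` S) (map_prod h h ` R) = ncomp S R"
proof (rule sym, rule ncomp_map[where h = h and k = "inv_into S h"])
  show "(inv_into S h x, inv_into S h y) \<in> eqc R" if "(x, y) \<in> map_prod h h ` R" for x y
  proof -
    obtain c d where cd: "(c, d) \<in> R" "x = h c" "y = h d" using \<open>(x, y) \<in> map_prod h h ` R\<close> by auto
    then have "c \<in> S" "d \<in> S" using assms(2) by auto
    with cd show ?thesis using assms(1) by (simp add: eqc_base)
  qed
  show "(inv_into S h (h x), x) \<in> eqc R" if "x \<in> S" for x
    using assms(1) that by simp
qed (auto intro!: eqc_base)

lemma eqc_Un_left:
  assumes "R \<subseteq> S \<times> S" "R' \<subseteq> S' \<times> S'" "S \<inter> S' = {}" "x \<in> S"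
  shows "eqc (R \<union> R') `` {x} = eqc R `` {x} \<and> eqc R `` {x} \<subseteq> S"
proof -
  have 1: "y \<in> S \<and> (x, y) \<in> eqc R" if "(x, y) \<in> eqc (R \<union> R')" for y
    using that unfolding eqc_def[of "R \<union> R'"]
  proof induction
    case base then show ?case using assms by simp
  next
    case (step y z)
    have "(y, z) \<in> R \<union> R\<inverse>" using step assms(1-3) by blast
    then have "(y, z) \<in> eqc R" "z \<in> S" using assms(1) by (auto simp: eqc_def)
    then show ?case using step by (blast intro: eqc_trans)
  qed
  have 2: "(x, y) \<in> eqc (R \<union> R')" if "(x, y) \<in> eqc R" for y
    using eqc_map[OF that, of id "R \<union> R'"] by (simp add: eqc_base)
  show ?thesis using 1 2 by auto
qed

lemma ncomp_Un:
  assumes "R \<subseteq> S \<times> S" "R' \<subseteq> S' \<times> S'" "S \<inter> S' = {}" "finite S" "finite S'"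
  shows "ncomp (S \<union> S') (R \<union> R') = ncomp S R + ncomp S' R'"
proof -
  have l: "(\<lambda>x. eqc (R \<union> R') `` {x}) ` S = (\<lambda>x. eqc R `` {x}) ` S"
    by (rule image_cong) (auto dest: eqc_Un_left[OF assms(1-3)])
  have r: "(\<lambda>x. eqc (R \<union> R') `` {x}) ` S' = (\<lambda>x. eqc R' `` {x}) ` S'"
    using eqc_Un_left[OF assms(2,1)] assms(3) by (intro image_cong) (auto simp: Un_commute Int_commute)
  have "(\<lambda>x. eqc R `` {x}) ` S \<inter> (\<lambda>x. eqc R' `` {x}) ` S' = {}"
  proof -
    have "eqc R `` {x} \<noteq> eqc R' `` {y}" if "x \<in> S" "y \<in> S'" for x y
    proof -
      have "x \<in> eqc R `` {x}" by simp
      moreover have "eqc R' `` {y} \<subseteq> S'" using eqc_Un_left[OF assms(2,1) _ that(2)] assms(3) by auto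
      ultimately show ?thesis using assms(3) that by blast
    qed
    then show ?thesis by blast
  qed
  then show ?thesis unfolding ncomp_def image_Un l r
    by (intro card_Un_disjoint) (use assms in auto)
qed

section \<open>Vertices of a family of cyclic words\<close>

text \<open>For a cyclic word with successor map next, face_rel f collects the pairs (y, f (next y)). With f
the edge involution these are the arrows of the vertex permutation, so vertices are
components of vertex_rel. A fixed point of f is a half-edge without partner and marks a root.\<close>

fun walk :: "('a \<Rightarrow> 'a) \<Rightarrow> 'a \<Rightarrow> 'a list \<Rightarrow> 'a \<Rightarrow> ('a \<times> 'a) set" where
  "walk f y [] z = {(y, z)}"
| "walk f y (a # A) z = insert (y, f a) (walk f a A z)"

fun face_rel :: "('a \<Rightarrow> 'a) \<Rightarrow> 'a list \<Rightarrow> ('a \<times> 'a) set" where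
  "face_rel f [] = {}"
| "face_rel f (x # A) = walk f x A (f x)"

definition vertex_rel :: "('a \<Rightarrow> 'a) \<Rightarrow> 'a list list \<Rightarrow> ('a \<times> 'a) set" where
  "vertex_rel f cs = (\<Union>c\<in>set cs. face_rel f c)"

definition nvert :: "('a \<Rightarrow> 'a) \<Rightarrow> 'a list list \<Rightarrow> nat" where
  "nvert f cs = ncomp (set (concat cs)) (vertex_rel f cs)"

text \<open>Cutting at \<open>a\<close> ends the first stretch in \<open>f a\<close>, not in
  \<open>a\<close>. Hence one long cycle can have the same arrows as two short ones when the
  involution is changed at two letters.\<close>

lemma walk_append: "walk f y (A @ a # B) z = walk f y A (f a) \<union> walk f a B z"
  by (induction A arbitrary: y) auto

lemma walk_cong: "(\<And>a. a \<in> set A \<Longrightarrow> f a = k a) \<Longrightarrow> walk f y A z = walk k y A z"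
  by (induction A arbitrary: y) auto

lemma face_rel_cong: "(\<And>a. a \<in> set c \<Longrightarrow> f a = k a) \<Longrightarrow> face_rel f c = face_rel k c"
proof (cases c)
  case (Cons x A)
  assume *: "\<And>a. a \<in> set c \<Longrightarrow> f a = k a"
  have "f x = k x" using * Cons by simp
  moreover have "walk f x A z = walk k x A z" for z by (rule walk_cong, rule *) (simp add: Cons)
  ultimately show ?thesis using Cons by simp
qed simp

lemma vertex_rel_cong: "(\<And>a. a \<in> set (concat cs) \<Longrightarrow> f a = k a) \<Longrightarrow> vertex_rel f cs = vertex_rel k cs"
  unfolding vertex_rel_def by (intro SUP_cong refl face_rel_cong) force

lemma walk_sub: "walk f y A z \<subseteq> insert y (set A) \<times> insert z (f ` set A)"
  by (induction A arbitrary: y) (simp, force)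

lemma face_rel_sub: "face_rel f c \<subseteq> set c \<times> f ` set c"
proof (cases c)
  case (Cons x A)
  then show ?thesis using walk_sub[of f x A "f x"] by simp
qed simp

lemma vertex_rel_sub: "f ` set (concat cs) \<subseteq> set (concat cs) \<Longrightarrow> vertex_rel f cs \<subseteq> set (concat cs) \<times> set (concat cs)"
  using face_rel_sub[of f] unfolding vertex_rel_def by (simp add: subset_iff image_iff) blast

lemma vertex_rel_Cons [simp]: "vertex_rel f (c # cs) = face_rel f c \<union> vertex_rel f cs"
  and vertex_rel_Nil [simp]: "vertex_rel f [] = {}"
  and vertex_rel_append: "vertex_rel f (cs @ cs') = vertex_rel f cs \<union> vertex_rel f cs'"
  by (auto simp: vertex_rel_def)

lemma walk_map:
  "(\<And>a. a \<in> set A \<Longrightarrow> h (f a) = k (h a)) \<Longrightarrow>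
   map_prod h h ` walk f y A z = walk k (h y) (map h A) (h z)"
  by (induction A arbitrary: y) auto

lemma face_rel_map:
  "(\<And>a. a \<in> set c \<Longrightarrow> h (f a) = k (h a)) \<Longrightarrow> map_prod h h ` face_rel f c = face_rel k (map h c)"
proof (cases c)
  case (Cons x A)
  assume *: "\<And>a. a \<in> set c \<Longrightarrow> h (f a) = k (h a)"
  have "h (f x) = k (h x)" using * Cons by simp
  moreover have "map_prod h h ` walk f x A z = walk k (h x) (map h A) (h z)" for z
    by (rule walk_map, rule *) (simp add: Cons)
  ultimately show ?thesis using Cons by simp
qed simp

lemma vertex_rel_map:
  "(\<And>a. a \<in> set (concat cs) \<Longrightarrow> h (f a) = k (h a)) \<Longrightarrow>
   map_prod h h ` vertex_rel f cs = vertex_rel k (map (map h) cs)"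
proof (induction cs)
  case (Cons c cs)
  then show ?case using face_rel_map[of c h f k] by (simp add: image_Un)
qed simp

lemma nvert_relabel:
  assumes "f ` set (concat cs) \<subseteq> set (concat cs)" "inj_on h (set (concat cs))"
    and "\<And>a. a \<in> set (concat cs) \<Longrightarrow> h (f a) = k (h a)"
  shows "nvert k (map (map h) cs) = nvert f cs"
proof -
  have "set (concat (map (map h) cs)) = h ` set (concat cs)" by auto
  then show ?thesis unfolding nvert_def
    using ncomp_relabel[OF assms(2) vertex_rel_sub[OF assms(1)]] vertex_rel_map[of cs h f k, OF assms(3)] by simp
qed

lemma nvert_cong_set:
  assumes "set cs = set cs'"
  shows "nvert f cs = nvert f cs'"
  using assms by (simp add: nvert_def vertex_rel_def)

lemma face_rel_rotate: "face_rel f (A @ B) = face_rel f (B @ A)"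
proof (cases A)
  case (Cons x A')
  then show ?thesis
    by (cases B) (auto simp: walk_append)
qed simp

lemma nvert_rotate: "nvert f ((A @ B) # cs) = nvert f ((B @ A) # cs)"
proof -
  have "set (concat ((A @ B) # cs)) = set (concat ((B @ A) # cs))" by auto
  then show ?thesis unfolding nvert_def vertex_rel_Cons face_rel_rotate[of f A B] by simp
qed

text \<open>Since \<open>f r = r\<close>, the predecessor of \<open>r\<close> points to
  \<open>r\<close>, and \<open>r\<close> points to \<open>f a\<close>. Contracting \<open>r\<close>
  onto \<open>f a\<close> lets the predecessor point to \<open>f a\<close>, as it does in the
  shorter word. The letter \<open>a\<close> must exist: a root alone in its word is a vertex that
  the deletion would lose.\<close>

lemma nvert_drop_head:
  assumes "f r = r" "distinct (concat ((r # a # A) # cs))" 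
    and inv: "\<And>y. y \<in> set (concat ((a # A) # cs)) \<Longrightarrow> f y \<in> set (concat ((a # A) # cs))"
  shows "nvert f ((r # a # A) # cs) = nvert f ((a # A) # cs)"
proof -
  define T where "T = set (concat ((a # A) # cs))"
  define h where "h = id(r := f a)"
  have r: "r \<notin> T" using assms(2) by (auto simp: T_def)
  have hT: "h y = y" if "y \<in> T" for y using r that by (auto simp: h_def)
  have hr: "h r = f a" by (simp add: h_def)
  have fT: "f y \<in> T" if "y \<in> T" for y using inv that by (auto simp: T_def)
  have aT: "a \<in> T" "set A \<subseteq> T" "set (concat cs) \<subseteq> T" by (auto simp: T_def)
  have s: "set (concat ((r # a # A) # cs)) = insert r T" by (auto simp: T_def)
  have R: "vertex_rel f ((r # a # A) # cs) = insert (r, f a) (walk f a A r \<union> vertex_rel f cs)" using assms(1) by simp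
  have R': "vertex_rel f ((a # A) # cs) = walk f a A (f a) \<union> vertex_rel f cs" by simp
  have w: "map_prod h h ` walk f a A r = walk f a A (f a)"
  proof -
    have "map h A = A" using hT aT(2) by (intro map_idI) auto
    then show ?thesis using walk_map[of A h f f a r] hT fT aT hr by (auto simp: subset_iff)
  qed
  have c: "map_prod h h ` vertex_rel f cs = vertex_rel f cs"
  proof -
    have "map (map h) cs = cs" using hT aT(3) by (intro map_idI) auto
    then show ?thesis using vertex_rel_map[of cs h f f] hT fT aT(3) by (auto simp: subset_iff)
  qed
  have "ncomp (insert r T) (vertex_rel f ((r # a # A) # cs)) = ncomp T (vertex_rel f ((a # A) # cs))"
  proof (rule ncomp_map[where h = h and k = id])
    show "h ` insert r T = T" using hT hr fT aT(1) by (auto simp: image_iff)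
    show "(h x, h y) \<in> eqc (vertex_rel f ((a # A) # cs))" if "(x, y) \<in> vertex_rel f ((r # a # A) # cs)" for x y
    proof (cases "(x, y) = (r, f a)")
      case True then show ?thesis using hr hT fT aT(1) by auto
    next
      case False
      then have "(x, y) \<in> walk f a A r \<union> vertex_rel f cs" using that R by auto
      then have "map_prod h h (x, y) \<in> map_prod h h ` walk f a A r \<union> map_prod h h ` vertex_rel f cs"
        by blast
      then have "map_prod h h (x, y) \<in> walk f a A (f a) \<union> vertex_rel f cs"
        unfolding w c .
      then show ?thesis unfolding R' by (auto intro: eqc_base)
    qed
    show "(id x, id y) \<in> eqc (vertex_rel f ((r # a # A) # cs))" if "(x, y) \<in> vertex_rel f ((a # A) # cs)" for x y
    proof -
      have *: "(z, h z) \<in> eqc (vertex_rel f ((r # a # A) # cs))" for z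
        unfolding h_def R by (auto intro: eqc_base)
      obtain x' y' where "(x', y') \<in> walk f a A r \<union> vertex_rel f cs" "x = h x'" "y = h y'"
      proof -
        have "(x, y) \<in> map_prod h h ` (walk f a A r \<union> vertex_rel f cs)"
          using \<open>(x, y) \<in> vertex_rel f ((a # A) # cs)\<close> unfolding R' image_Un w c .
        then show ?thesis using that by auto
      qed
      moreover then have "(x', y') \<in> eqc (vertex_rel f ((r # a # A) # cs))" unfolding R by (auto intro: eqc_base)
      ultimately show ?thesis using * by (metis eqc_sym eqc_trans id_apply)
    qed
    show "(id (h x), x) \<in> eqc (vertex_rel f ((r # a # A) # cs))" for x
      unfolding h_def R using eqc_sym[OF eqc_base[of r "f a"]] by auto
  qed
  then show ?thesis unfolding nvert_def s T_def[symmetric] .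
qed

lemma nvert_drop:
  assumes "f r = r" "distinct (concat ((A @ r # B) # cs))" "A @ B \<noteq> []"
    and inv: "\<And>y. y \<in> set (concat ((A @ B) # cs)) \<Longrightarrow> f y \<in> set (concat ((A @ B) # cs))"
  shows "nvert f ((A @ r # B) # cs) = nvert f ((A @ B) # cs)"
proof -
  obtain a C where C: "B @ A = a # C" using assms(3) by (cases "B @ A") auto
  have st: "set (concat ((a # C) # cs)) = set (concat ((A @ B) # cs))" using arg_cong[OF C, of set] by auto
  have d: "distinct (concat ((r # a # C) # cs))"
    unfolding C[symmetric] using assms(2) by auto
  have "nvert f ((A @ r # B) # cs) = nvert f ((r # a # C) # cs)"
    using nvert_rotate[of f A "r # B" cs] C by simp
  also have "\<dots> = nvert f ((a # C) # cs)"
    by (rule nvert_drop_head[where f=f and r=r, OF assms(1) d]) (use inv st in blast)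
  also have "\<dots> = nvert f ((A @ B) # cs)" using nvert_rotate[of f B A cs] C by simp
  finally show ?thesis .
qed

text \<open>Composing the edge involution and the face permutation with the same transposition leaves the
vertex permutation unchanged; on the faces it splits or merges a cycle.\<close>

lemma nvert_split:
  assumes "f x = x'" "f x' = x" "x \<notin> set (A @ B @ concat cs)" "x' \<notin> set (A @ B @ concat cs)" "x \<noteq> x'"
  shows "nvert f ((x # A @ x' # B) # cs) = nvert (f(x := x, x' := x')) ((x # A) # (x' # B) # cs)"
proof -
  let ?f = "f(x := x, x' := x')"
  have 1: "walk ?f y A z = walk f y A z" "walk ?f y B z = walk f y B z" for y z
    using assms by (auto intro!: walk_cong)
  have 2: "vertex_rel ?f cs = vertex_rel f cs" using assms by (intro vertex_rel_cong) auto
  \<comment> \<open>The arrow sets coincide: with \<open>f\<close> the stretch from \<open>x\<close>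
    through \<open>A\<close> ends in \<open>f x' = x\<close>, and the stretch from \<open>x'\<close>
    through \<open>B\<close> ends in \<open>f x = x'\<close>, just as in two cycles on which
    \<open>x\<close> and \<open>x'\<close> are fixed.\<close>
  show ?thesis
    unfolding nvert_def vertex_rel_Cons face_rel.simps walk_append 1 2 using assms
    by (simp add: Un_assoc insert_commute 1)
qed

lemma nvert_merge:
  assumes "f x = x'" "f x' = x" "x \<notin> set (A @ B @ concat cs)" "x' \<notin> set (A @ B @ concat cs)" "x \<noteq> x'"
  shows "nvert f ((x # A) # (x' # B) # cs) = nvert (f(x := x, x' := x')) ((x # A @ x' # B) # cs)"
proof -
  let ?f = "f(x := x, x' := x')"
  have 1: "walk ?f y A z = walk f y A z" "walk ?f y B z = walk f y B z" for y z
    using assms by (auto intro!: walk_cong)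
  have 2: "vertex_rel ?f cs = vertex_rel f cs" using assms by (intro vertex_rel_cong) auto
  show ?thesis
    unfolding nvert_def vertex_rel_Cons face_rel.simps walk_append 1 2 using assms
    by (simp add: Un_assoc insert_commute 1)
qed

lemma nvert_append:
  assumes "f ` set (concat cs) \<subseteq> set (concat cs)" "f ` set (concat cs') \<subseteq> set (concat cs')"
    "set (concat cs) \<inter> set (concat cs') = {}"
  shows "nvert f (cs @ cs') = nvert f cs + nvert f cs'"
  unfolding nvert_def vertex_rel_append
  using ncomp_Un[OF vertex_rel_sub[OF assms(1)] vertex_rel_sub[OF assms(2)] assms(3)] by simp

text \<open>The root letter Inr i stands for the partner of the plant of face i. The plant itself, which is
a vertex on its own, is left out.\<close>

fun rooted :: "nat \<Rightarrow> 'a list list \<Rightarrow> ('a + nat) list list" where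
  "rooted i [] = []"
| "rooted i (w # ws) = (Inr i # map Inl w) # rooted (Suc i) ws"

text \<open>The roots are fixed by the extended involution because the plants, their former
  partners, are gone. They also preserve the vertex of a face whose word is empty.\<close>

definition nv :: "('a \<Rightarrow> 'a) \<Rightarrow> 'a list list \<Rightarrow> nat" where
  "nv f ws = nvert (map_sum f id) (rooted 0 ws)"

definition closed_under :: "('a \<Rightarrow> 'a) \<Rightarrow> 'a set \<Rightarrow> bool" where
  "closed_under f S \<longleftrightarrow> (\<forall>x\<in>S. f x \<in> S)"

lemma set_concat_rooted:
  "set (concat (rooted i ws)) = Inl ` set (concat ws) \<union> Inr ` {i..<i + length ws}"
proof (induction ws arbitrary: i)
  case (Cons w ws)
  have "{i..<i + length (w # ws)} = insert i {Suc i..<Suc i + length ws}" by auto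
  with Cons[of "Suc i"] show ?case by auto
qed simp

lemma rooted_append: "rooted i (ws @ vs) = rooted i ws @ rooted (i + length ws) vs"
  by (induction ws arbitrary: i) auto

text \<open>The shift is written \<open>i + d - c\<close> so that one statement over nat renumbers
  roots upwards and downwards.\<close>

lemma map_rooted:
  "\<lbrakk>\<And>a. a \<in> set (concat ws) \<Longrightarrow> h (Inl a) = Inl (k a); \<And>j. i \<le> j \<Longrightarrow> j < i + length ws \<Longrightarrow> h (Inr j) = Inr (j + d - c)\<rbrakk> \<Longrightarrow> c \<le> i
   \<Longrightarrow> map (map h) (rooted i ws) = rooted (i + d - c) (map (map k) ws)"
proof (induction ws arbitrary: i)
  case (Cons w ws)
  have "map (map h) (rooted (Suc i) ws) = rooted (Suc i + d - c) (map (map k) ws)"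
    by (rule Cons.IH) (use Cons.prems in auto)
  then show ?case using Cons.prems by (auto simp: Suc_diff_le)
qed simp

lemma map_sum_closed:
  "closed_under f (set (concat ws)) \<Longrightarrow> map_sum f id ` set (concat (rooted i ws)) \<subseteq> set (concat (rooted i ws))"
  unfolding set_concat_rooted by (auto simp: closed_under_def)

lemma nvert_rooted_shift:
  assumes "closed_under f (set (concat ws))"
  shows "nvert (map_sum f id) (rooted i ws) = nv f ws"
proof -
  let ?h = "map_sum id (\<lambda>j. j - i)"
  have "map (map ?h) (rooted i ws) = rooted (i + 0 - i) (map (map id) ws)"
    by (rule map_rooted) auto
  moreover have "nvert (map_sum f id) (map (map ?h) (rooted i ws)) = nvert (map_sum f id) (rooted i ws)"
  proof (rule nvert_relabel[OF map_sum_closed[OF assms]])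
    show "inj_on ?h (set (concat (rooted i ws)))" 
      unfolding set_concat_rooted inj_on_def by auto
    show "?h (map_sum f id a) = map_sum f id (?h a)" for a by (cases a) auto
  qed
  ultimately show ?thesis by (simp add: nv_def)
qed

lemma nv_append:
  assumes "closed_under f (set (concat ws))" "closed_under f (set (concat vs))"
    "set (concat ws) \<inter> set (concat vs) = {}"
  shows "nv f (ws @ vs) = nv f ws + nv f vs"
proof -
  have "p \<notin> set (concat (rooted (length ws) vs))" if "p \<in> set (concat (rooted 0 ws))" for p
  proof (cases p)
    case (Inl y)
    then have "y \<in> set (concat ws)" using that unfolding set_concat_rooted by blast
    then have "y \<notin> set (concat vs)" using assms(3) by blast
    then show ?thesis using Inl unfolding set_concat_rooted by blast
  next
    case (Inr j)
    then have "j < length ws" using that unfolding set_concat_rooted by auto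
    then show ?thesis using Inr unfolding set_concat_rooted by auto
  qed
  then have "set (concat (rooted 0 ws)) \<inter> set (concat (rooted (length ws) vs)) = {}" by blast
  then have "nv f (ws @ vs) = nvert (map_sum f id) (rooted 0 ws) + nvert (map_sum f id) (rooted (length ws) vs)"
    unfolding nv_def rooted_append add_0
    by (rule nvert_append[OF map_sum_closed[OF assms(1)] map_sum_closed[OF assms(2)]])
  then show ?thesis unfolding nvert_rooted_shift[OF assms(1)] nvert_rooted_shift[OF assms(2)] .
qed

lemma nv_swap:
  assumes "closed_under f (set (concat (x # y # ws)))"
  shows "nv f (x # y # ws) = nv f (y # x # ws)"
proof -
  let ?h = "map_sum id (\<lambda>j::nat. if j = 0 then 1 else if j = 1 then 0 else j)"
  have "map (map ?h) (rooted 2 ws) = rooted (2 + 0 - 0) (map (map id) ws)"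
    by (rule map_rooted) auto
  moreover have "nvert (map_sum f id) (map (map ?h) (rooted 0 (x # y # ws))) = nvert (map_sum f id) (rooted 0 (x # y # ws))"
  proof (rule nvert_relabel[OF map_sum_closed[OF assms]])
    show "inj_on ?h (set (concat (rooted 0 (x # y # ws))))" 
    proof (rule inj_onI)
      show "p = q" if "?h p = ?h q" for p q using that by (cases p; cases q) (auto split: if_splits)
    qed
    show "?h (map_sum f id a) = map_sum f id (?h a)" for a by (cases a) auto
  qed
  moreover have "nvert (map_sum f id) (map (map ?h) (rooted 0 (x # y # ws))) = nv f (y # x # ws)"
    unfolding nv_def by (rule nvert_cong_set) (use calculation(1) in \<open>auto simp: numeral_2_eq_2\<close>)
  ultimately show ?thesis by (simp add: nv_def)
qed

text \<open>The lone root is the single vertex of the planar map without np-edges, the base case for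
  genus and for \<open>u\<close>.\<close>

lemma nv_empty: "nv f [[]] = 1"
  by (simp add: nv_def nvert_def ncomp_def)

text \<open>Both ends of the deleted edge become fixed points and so serve as roots of
  \<open>A\<close> and \<open>B\<close>. The old root then shares a word with \<open>x'\<close> and
  can be contracted, which loses no vertex.\<close>

lemma nv_split:
  assumes d: "distinct (concat ((x # A @ x' # B) # ws))" and f: "f x = x'" "f x' = x"
    and inv: "closed_under f (set (concat (A # B # ws)))"
  shows "nv f ((x # A @ x' # B) # ws) = nv f (A # B # ws)"
proof -
  let ?f = "map_sum f (id :: nat \<Rightarrow> nat)"
  let ?g = "?f(Inl x := Inl x, Inl x' := Inl x')"
  let ?A = "map Inl A" and ?B = "map Inl B" and ?cs = "rooted 1 ws"
  let ?T = "set (concat (((Inl x # ?A) # (Inl x' # ?B) # ?cs)))"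
  have ne: "x \<noteq> x'" "x \<notin> set (A @ B @ concat ws)" "x' \<notin> set (A @ B @ concat ws)" using d by auto
  have T: "?T = Inl ` ({x, x'} \<union> set (concat (A # B # ws))) \<union> Inr ` {1..<1 + length ws}"
    using set_concat_rooted[of 1 ws] by auto
  have gcl: "?g y \<in> ?T" if "y \<in> ?T" for y
  proof (cases "\<exists>a\<in>set (concat (A # B # ws)). a \<noteq> x \<and> a \<noteq> x' \<and> y = Inl a")
    case True
    then obtain a where a: "a \<in> set (concat (A # B # ws))" "a \<noteq> x" "a \<noteq> x'" "y = Inl a" by blast
    then have "f a \<in> set (concat (A # B # ws))" using inv unfolding closed_under_def by blast
    then show ?thesis using a unfolding T by simp
  next
    case False
    then have "?g y = y" using that unfolding T by auto
    then show ?thesis using that by simp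
  qed
  have r0: "rooted 0 ((x # A @ x' # B) # ws) = ([Inr 0] @ Inl x # ?A @ Inl x' # ?B) # ?cs" by simp
  have "nv f ((x # A @ x' # B) # ws) = nvert ?f ((Inl x # ?A @ Inl x' # (?B @ [Inr 0])) # ?cs)"
    unfolding nv_def r0 using nvert_rotate[of ?f "[Inr 0]" "Inl x # ?A @ Inl x' # ?B" ?cs] by simp
  also have "\<dots> = nvert ?g ((Inl x # ?A) # (Inl x' # (?B @ [Inr 0])) # ?cs)"
    by (rule nvert_split) (use f ne in \<open>auto simp: set_concat_rooted simp del: set_concat\<close>)
  also have "\<dots> = nvert ?g (((Inl x' # ?B) @ Inr 0 # []) # (Inl x # ?A) # ?cs)"
    by (rule nvert_cong_set) auto
  also have "\<dots> = nvert ?g (((Inl x' # ?B) @ []) # (Inl x # ?A) # ?cs)"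
  proof (rule nvert_drop)
    have "distinct (concat (rooted i vs))" if "distinct (concat vs)" for i and vs :: "'a list list"
      using that
    proof (induction vs arbitrary: i)
      case (Cons v vs)
      have "set (concat (rooted (Suc i) vs)) \<inter> set (Inr i # map Inl v) = {}"
        unfolding set_concat_rooted using Cons.prems by auto
      with Cons show ?case by (auto simp: distinct_map inj_on_def)
    qed simp
    then have "distinct (concat ?cs)" using d by auto
    then show "distinct (concat (((Inl x' # ?B) @ Inr 0 # []) # (Inl x # ?A) # ?cs))"
      using d by (auto simp: set_concat_rooted distinct_map inj_on_def simp del: set_concat)
    show "?g y \<in> set (concat (((Inl x' # ?B) @ []) # (Inl x # ?A) # ?cs))"
      if "y \<in> set (concat (((Inl x' # ?B) @ []) # (Inl x # ?A) # ?cs))" for y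
    proof -
      have eq: "set (concat (((Inl x' # ?B) @ []) # (Inl x # ?A) # ?cs)) = ?T" by auto
      show ?thesis using gcl that unfolding eq .
    qed
  qed (auto)
  also have "\<dots> = nvert ?g ((Inl x # ?A) # (Inl x' # ?B) # ?cs)"
    by (rule nvert_cong_set) auto
  also have "\<dots> = nv f (A # B # ws)"
  proof -
    \<comment> \<open>The ends of the deleted edge are renamed to roots 0 and 1; the roots of
      \<open>ws\<close>, numbered from 1, move up by one to make room.\<close>
    define h where "h = (map_sum id Suc :: 'a + nat \<Rightarrow> 'a + nat)(Inl x := Inr 0, Inl x' := Inr 1)"
    have "map (map h) ?cs = rooted (1 + 1 - 0) (map (map id) ws)"
      unfolding h_def by (rule map_rooted) (use ne in \<open>auto\<close>)
    moreover have "map h ?A = ?A" "map h ?B = ?B" using ne by (auto simp: h_def)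
    ultimately have "map (map h) ((Inl x # ?A) # (Inl x' # ?B) # ?cs) = rooted 0 (A # B # ws)"
      using ne by (simp add: h_def numeral_2_eq_2)
    moreover have "nvert ?f (map (map h) ((Inl x # ?A) # (Inl x' # ?B) # ?cs)) = nvert ?g ((Inl x # ?A) # (Inl x' # ?B) # ?cs)"
    proof (rule nvert_relabel)
      show "?g ` ?T \<subseteq> ?T" using gcl by blast
      show "inj_on h ?T" unfolding T using ne by (auto simp: inj_on_def h_def)
      show "h (?g a) = ?f (h a)" if "a \<in> ?T" for a
        using that inv ne unfolding T by (auto simp: h_def closed_under_def)
    qed
    ultimately show ?thesis unfolding nv_def by (simp only:)
  qed
  finally show ?thesis .
qed

text \<open>After the merge the two letters and the second root are fixed points of the involution and
can be dropped from the cyclic word.\<close>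

lemma nv_merge:
  assumes d: "distinct (concat [A @ x # B, C @ x' # D])" and f: "f x = x'" "f x' = x"
    and inv: "closed_under f (set (concat [A, B, C, D]))"
  shows "nv f [A @ x # B, C @ x' # D] = nv f [A @ D @ C @ B]"
proof -
  let ?f = "map_sum f (id :: nat \<Rightarrow> nat)"
  let ?g = "?f(Inl x := Inl x, Inl x' := Inl x')"
  let ?A = "map Inl A" and ?B = "map Inl B" and ?C = "map Inl C" and ?D = "map Inl D"
  let ?U = "Inl ` set (A @ B @ C @ D) :: ('a + nat) set"
  have ne: "x \<noteq> x'" "x \<notin> set (A @ B @ C @ D)" "x' \<notin> set (A @ B @ C @ D)" using d by auto
  \<comment> \<open>Letters outside \<open>?U\<close> are fixed by \<open>?g\<close>, so every set
    between \<open>?U\<close> and \<open>?U\<close> with the two ends and the two roots is closed.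
    One fact thus serves all three deletions below.\<close>
  have key: "?g y \<in> Z" if "y \<in> Z" "?U \<subseteq> Z" "Z \<subseteq> ?U \<union> {Inl x, Inl x', Inr 0, Inr (Suc 0)}" for y Z
  proof (cases "y \<in> ?U")
    case True
    then have "?g y \<in> ?U" using inv ne by (auto simp: closed_under_def)
    then show ?thesis using that by blast
  next
    case False
    then have "?g y = y" using that by auto
    then show ?thesis using that by simp
  qed
  have "nv f [A @ x # B, C @ x' # D] = nvert ?f [(Inr 0 # ?A) @ Inl x # ?B, (Inr (Suc 0) # ?C) @ Inl x' # ?D]"
    by (simp add: nv_def)
  also have "\<dots> = nvert ?f [(Inl x # ?B) @ (Inr 0 # ?A), (Inr (Suc 0) # ?C) @ Inl x' # ?D]"
    by (rule nvert_rotate)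
  also have "\<dots> = nvert ?f [(Inr (Suc 0) # ?C) @ Inl x' # ?D, (Inl x # ?B) @ (Inr 0 # ?A)]"
    by (rule nvert_cong_set) auto
  also have "\<dots> = nvert ?f [(Inl x' # ?D) @ (Inr (Suc 0) # ?C), (Inl x # ?B) @ (Inr 0 # ?A)]"
    by (rule nvert_rotate)
  also have "\<dots> = nvert ?f [Inl x # (?B @ Inr 0 # ?A), Inl x' # (?D @ Inr (Suc 0) # ?C)]"
    by (rule nvert_cong_set) auto
  also have "\<dots> = nvert ?g [Inl x # (?B @ Inr 0 # ?A) @ Inl x' # (?D @ Inr (Suc 0) # ?C)]"
    by (rule nvert_merge) (use f ne in auto)
  also have "\<dots> = nvert ?g [(Inl x # ?B @ Inr 0 # ?A) @ Inl x' # (?D @ Inr (Suc 0) # ?C)]"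
    by simp
  also have "\<dots> = nvert ?g [(Inl x # ?B @ Inr 0 # ?A) @ (?D @ Inr (Suc 0) # ?C)]"
  proof (rule nvert_drop, goal_cases)
    case 2 show ?case using d by (auto simp: distinct_map inj_on_def)
  next
    case (4 y) then show ?case by (rule key) auto
  qed simp_all
  also have "\<dots> = nvert ?g [(Inl x # ?B @ Inr 0 # ?A @ ?D) @ Inr (Suc 0) # ?C]"
    by simp
  also have "\<dots> = nvert ?g [(Inl x # ?B @ Inr 0 # ?A @ ?D) @ ?C]"
  proof (rule nvert_drop[where A = "Inl x # ?B @ Inr 0 # ?A @ ?D" and r = "Inr (Suc 0)" and B = ?C and cs = "[]"], goal_cases)
    case 2 show ?case using d by (auto simp: distinct_map inj_on_def)
  next
    case (4 y) then show ?case by (rule key) auto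
  qed simp_all
  also have "\<dots> = nvert ?g [[] @ Inl x # (?B @ Inr 0 # ?A @ ?D @ ?C)]"
    by simp
  also have "\<dots> = nvert ?g [[] @ (?B @ Inr 0 # ?A @ ?D @ ?C)]"
  proof (rule nvert_drop, goal_cases)
    case 2 show ?case using d by (auto simp: distinct_map inj_on_def)
  next
    case (4 y) then show ?case by (rule key) auto
  qed simp_all
  also have "\<dots> = nvert ?g [?B @ (Inr 0 # ?A @ ?D @ ?C)]"
    by simp
  \<comment> \<open>Root 0 is the only root left. Reading the cycle from it gives the order A, D, C,
    B of the conclusion.\<close>
  also have "\<dots> = nvert ?g [(Inr 0 # ?A @ ?D @ ?C) @ ?B]"
    by (rule nvert_rotate)
  also have "\<dots> = nvert ?f [(Inr 0 # ?A @ ?D @ ?C) @ ?B]"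
    unfolding nvert_def using ne by (subst vertex_rel_cong[where k = ?f]) auto
  finally show ?thesis by (simp add: nv_def)
qed

section \<open>Deleting an edge from labelled words\<close>

abbreviation "cl \<equiv> closed_under (uminus :: int \<Rightarrow> int)"

abbreviation "nvi \<equiv> nv (uminus :: int \<Rightarrow> int)"

text \<open>The normal form of a set of np half-edges: negation pairs them up, and 0, its only fixed
  point, is excluded.\<close>

definition symm :: "int set \<Rightarrow> bool" where
  "symm S \<longleftrightarrow> finite S \<and> 0 \<notin> S \<and> cl S"

text \<open>With card S = 2 n and k words, the genus condition is Euler's relation V = n + 2 - 2 g - k for
the number V of vertices other than the plants, written without subtraction.\<close>

definition uni :: "int set \<Rightarrow> nat \<Rightarrow> int list set" where
  "uni S g = {w. distinct w \<and> set w = S \<and> 2 * nvi [w] + 4 * g + 2 = card S + 4}"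

text \<open>The union is going to be closed, and then \<open>cl_part\<close> makes one word closed
  exactly when the other is; testing \<open>A\<close> decides connectedness.\<close>

definition bi :: "int set \<Rightarrow> nat \<Rightarrow> (int list \<times> int list) set" where
  "bi S g = {(A, B). distinct (A @ B) \<and> set (A @ B) = S \<and> \<not> cl (set A) \<and>
     2 * nvi [A, B] + 4 * g + 4 = card S + 4}"

text \<open>A proper nonempty set of faces, or its complement, is a single face, so three tests
  decide connectedness.\<close>

definition tri :: "int set \<Rightarrow> nat \<Rightarrow> (int list \<times> int list \<times> int list) set" where
  "tri S g = {(A, B, C). distinct (A @ B @ C) \<and> set (A @ B @ C) = S \<and>
     \<not> cl (set A) \<and> \<not> cl (set B) \<and> \<not> cl (set C) \<and> 2 * nvi [A, B, C] + 4 * g + 6 = card S + 4}"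

definition symsubs :: "int set \<Rightarrow> int set set" where
  "symsubs S = {R. R \<subseteq> S \<and> cl R}"

lemma symm_remove:
  assumes "symm S" "x \<in> S"
  shows "symm (S - {x, - x})" "card (S - {x, - x}) + 2 = card S" "x \<noteq> - x" "- x \<in> S"
    "insert x (insert (- x) (S - {x, - x})) = S"
proof -
  show 1: "- x \<in> S" using assms by (auto simp: symm_def closed_under_def)
  show 2: "x \<noteq> - x" using assms by (auto simp: symm_def)
  show "symm (S - {x, - x})" using assms unfolding symm_def closed_under_def
    by auto
  show 3: "insert x (insert (- x) (S - {x, - x})) = S" using 1 assms by auto
  have f: "finite (S - {x, -x})" using assms by (simp add: symm_def)
  have "card S = card (insert x (insert (- x) (S - {x, - x})))" using 3 by simp
  also have "\<dots> = card (S - {x, - x}) + 2" using f 2 by simp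
  finally show "card (S - {x, - x}) + 2 = card S" by simp
qed

lemma symm_sub: "symm S \<Longrightarrow> R \<subseteq> S \<Longrightarrow> cl R \<Longrightarrow> symm R"
  by (auto simp: symm_def finite_subset)

lemma cl_diff: "cl S \<Longrightarrow> cl R \<Longrightarrow> cl (S - R)"
  unfolding closed_under_def by (metis Diff_iff minus_minus)

lemma symm_diff: "symm S \<Longrightarrow> cl R \<Longrightarrow> symm (S - R)"
  by (auto simp: symm_def cl_diff)

lemma cl_Un: "cl S \<Longrightarrow> cl R \<Longrightarrow> cl (S \<union> R)"
  by (auto simp: closed_under_def)

lemma cl_part: "cl (S \<union> R) \<Longrightarrow> S \<inter> R = {} \<Longrightarrow> cl S \<longleftrightarrow> cl R"
  using cl_diff[of "S \<union> R" S] cl_diff[of "S \<union> R" R]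
  by (metis Diff_cancel Diff_triv Int_commute Un_Diff Un_empty_left Un_empty_right)

lemma nvi_append2:
  assumes "distinct (A @ B)" "cl (set A)" "cl (set B)"
  shows "nvi [A, B] = nvi [A] + nvi [B]"
  using nv_append[of uminus "[A]" "[B]"] assms by simp

lemma nvi_append3:
  assumes "distinct (A @ B @ C)" "cl (set A)" "cl (set B \<union> set C)"
  shows "nvi [A, B, C] = nvi [A] + nvi [B, C]"
  using nv_append[of uminus "[A]" "[B, C]"] assms by (simp add: Int_Un_distrib)

lemma nvi_split:
  assumes "distinct (x # A @ - x # B)" "cl (set A \<union> set B)"
  shows "nvi [x # A @ - x # B] = nvi [A, B]"
  by (rule nv_split) (use assms in auto)

lemma nvi_split2:
  assumes "distinct (x # A @ - x # B @ w)" "cl (set A \<union> set B \<union> set w)"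
  shows "nvi [x # A @ - x # B, w] = nvi [A, B, w]"
  by (rule nv_split) (use assms in \<open>auto simp: Un_assoc\<close>)

lemma nvi_merge:
  assumes "distinct (A @ x # B @ C @ - x # D)" "cl (set A \<union> set B \<union> set C \<union> set D)"
  shows "nvi [A @ x # B, C @ - x # D] = nvi [A @ D @ C @ B]"
  by (rule nv_merge) (use assms in \<open>auto simp: Un_assoc\<close>)

text \<open>A natural number \<open>g\<close> expresses evenness and the bound 2 at once. Deleting
  the first edge of a single word leaves two words, while for two connected words the deleted edge
  is chosen to join them. They merge again, so the induction never meets three words.\<close>

lemma genus_exists:
  assumes "symm S"
  shows "distinct w \<Longrightarrow> set w = S \<Longrightarrow> \<exists>g. w \<in> uni S g"
    and "distinct (w1 @ w2) \<Longrightarrow> set (w1 @ w2) = S \<Longrightarrow> \<not> cl (set w1) \<Longrightarrow> \<exists>g. (w1, w2) \<in> bi S g"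
  using assms
proof (induction "card S" arbitrary: S w w1 w2 rule: less_induct)
  case less
  {
    case 1
    show ?case
    proof (cases w)
      case Nil
      then have "w \<in> uni S 0" using 1 by (auto simp: uni_def nv_empty)
      then show ?thesis ..
    next
      case (Cons x w')
      define T where "T = S - {x, - x}"
      have xS: "x \<in> S" using Cons 1 by auto
      note T = symm_remove[OF 1(3) xS, folded T_def]
      have lt: "card T < card S" using T(2) by simp
      have "- x \<in> set w'" using T(3,4) Cons 1 by auto
      then obtain A B where w': "w' = A @ - x # B" by (meson split_list)
      have sAB: "set A \<union> set B = T" and dAB: "distinct (A @ B)"
        using 1 Cons w' by (auto simp: T_def)
      have clT: "cl T" using T(1) by (simp add: symm_def)
      have nv: "nvi [w] = nvi [A, B]" using nvi_split[of x A B] 1(1) Cons w' sAB clT by simp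
      show ?thesis
      proof (cases "cl (set A)")
        case False
        then obtain g where "(A, B) \<in> bi T g" using less(2)[OF lt dAB] sAB T(1) by auto
        \<comment> \<open>Restoring the edge joins two faces of a connected map into one, which
          raises the genus by one.\<close>
        then have "w \<in> uni S (g + 1)" using nv 1 T(2) by (auto simp: bi_def uni_def)
        then show ?thesis ..
      next
        case True
        have AB: "set A \<inter> set B = {}" "distinct A" "distinct B" using dAB by auto
        have clB: "cl (set B)" using cl_part[of "set A" "set B"] AB True clT sAB by simp
        have c: "card (set A) + card (set B) = card T" using card_Un_disjoint[of "set A" "set B"] AB sAB by simp
        have sA: "symm (set A)" "symm (set B)" using symm_sub[OF T(1)] sAB True clB by auto
        obtain g1 where g1: "A \<in> uni (set A) g1" using less(1)[OF _ AB(2) refl sA(1)] c lt by auto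
        obtain g2 where g2: "B \<in> uni (set B) g2" using less(1)[OF _ AB(3) refl sA(2)] c lt by auto
        have "w \<in> uni S (g1 + g2)" using g1 g2 nv nvi_append2[OF dAB True clB] 1 T(2) c by (simp add: uni_def)
        then show ?thesis ..
      qed
    qed
  next
    case (2 w1 w2)
    \<comment> \<open>A half-edge of the first word whose partner is in the second: it exists
      because the first word is not closed.\<close>
    obtain x where x: "x \<in> set w1" "- x \<notin> set w1" using 2(3) unfolding closed_under_def by blast
    define T where "T = S - {x, - x}"
    have xS: "x \<in> S" using x 2 by auto
    note T = symm_remove[OF 2(4) xS, folded T_def]
    have lt: "card T < card S" using T(2) by simp
    have "- x \<in> set w2" using T(4) x 2 by auto
    then obtain C D where w2: "w2 = C @ - x # D" by (meson split_list)
    obtain A B where w1: "w1 = A @ x # B" using x(1) by (meson split_list)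
    have s: "set A \<union> set B \<union> set C \<union> set D = T" and d: "distinct (A @ D @ C @ B)"
      using 2 w1 w2 by (auto simp: T_def)
    have clT: "cl T" using T(1) by (simp add: symm_def)
    have "nvi [w1, w2] = nvi [A @ D @ C @ B]"
      unfolding w1 w2 by (rule nvi_merge) (use 2 w1 w2 s clT in auto)
    moreover obtain g where "A @ D @ C @ B \<in> uni T g"
      using less(1)[OF lt d _ T(1)] s by auto
    ultimately have "(w1, w2) \<in> bi S g" using 2 T(2) by (auto simp: uni_def bi_def)
    then show ?case ..
  }
qed

lemma finite_words: "finite S \<Longrightarrow> finite {w. distinct w \<and> set w = S}"
  by (rule finite_subset[OF _ finite_subset_distinct[of S]]) auto

lemma finite_uni: "symm S \<Longrightarrow> finite (uni S g)"
  by (rule finite_subset[OF _ finite_words[of S]]) (auto simp: uni_def symm_def)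

lemma finite_pairs: "finite S \<Longrightarrow> finite {(A, B). distinct (A @ B) \<and> set (A @ B) = S}"
  by (rule finite_subset[OF _ finite_cartesian_product[OF finite_subset_distinct[of S] finite_subset_distinct[of S]]]) auto

lemma finite_triples: "finite S \<Longrightarrow> finite {(A, B, C). distinct (A @ B @ C) \<and> set (A @ B @ C) = S}"
  by (rule finite_subset[OF _ finite_cartesian_product[OF finite_subset_distinct[of S] finite_cartesian_product[OF finite_subset_distinct[of S] finite_subset_distinct[of S]]]]) auto

lemma finite_bi: "symm S \<Longrightarrow> finite (bi S g)"
  by (rule finite_subset[OF _ finite_pairs[of S]]) (auto simp: bi_def symm_def)

lemma finite_tri: "symm S \<Longrightarrow> finite (tri S g)"
  by (rule finite_subset[OF _ finite_triples[of S]]) (auto simp: tri_def symm_def)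

lemma finite_symsubs: "symm S \<Longrightarrow> finite (symsubs S)"
  by (auto simp: symsubs_def symm_def)

lemma uni_genus_unique: "w \<in> uni S g \<Longrightarrow> w \<in> uni S g' \<Longrightarrow> g = g'"
  by (simp add: uni_def)

section \<open>Deleting an edge of a unicellular map\<close>

lemma card_UN_uni_prod:
  assumes T: "symm T" and fin: "\<And>R g. R \<in> symsubs T \<Longrightarrow> finite (Y R g)"
  shows "card (\<Union>R\<in>symsubs T. \<Union>h\<le>G. uni R h \<times> Y R h) = (\<Sum>R\<in>symsubs T. \<Sum>h\<le>G. card (uni R h) * card (Y R h))"
proof -
  have f: "finite (uni R h)" if "R \<in> symsubs T" for R h
    using that finite_uni symm_sub[OF T] by (auto simp: symsubs_def)
  have "card (\<Union>R\<in>symsubs T. \<Union>h\<le>G. uni R h \<times> Y R h) = (\<Sum>R\<in>symsubs T. card (\<Union>h\<le>G. uni R h \<times> Y R h))"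
    by (rule card_UN_disjoint) (use f fin finite_symsubs[OF T] in \<open>auto simp: uni_def\<close>)
  also have "\<dots> = (\<Sum>R\<in>symsubs T. \<Sum>h\<le>G. card (uni R h \<times> Y R h))"
    by (intro sum.cong refl card_UN_disjoint) (use f fin in \<open>auto dest: uni_genus_unique\<close>)
  finally show ?thesis by (simp add: card_cartesian_product)
qed

text \<open>Ordered pairs of independent unicellular maps of total genus \<open>G\<close>;
  \<open>R\<close> is the share of letters of the first one.\<close>

definition pairs_uni where
  "pairs_uni T G = (\<Sum>R\<in>symsubs T. \<Sum>h\<le>G. card (uni R h) * card (uni (T - R) (G - h)))"

definition pairs_bi where
  "pairs_bi T G = (\<Sum>R\<in>symsubs T. \<Sum>h\<le>G. card (uni R h) * card (bi (T - R) (G - h)))"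

text \<open>The 6 is the usual 4 plus the two letters removed to obtain \<open>T\<close>, so the
  equation is Euler's relation of the undeleted word of genus \<open>G\<close>. Vertices add over
  independent words, and \<open>genus_exists\<close> gives each of them a genus; the sum is then
  forced to be \<open>G\<close>.\<close>

lemma card_disc_uni:
  assumes T: "symm T"
  shows "card {(A, B). distinct (A @ B) \<and> set (A @ B) = T \<and> cl (set A) \<and> 2 * nvi [A, B] + 4 * G + 2 = card T + 6}
    = pairs_uni T G"
proof -
  have "{(A, B). distinct (A @ B) \<and> set (A @ B) = T \<and> cl (set A) \<and> 2 * nvi [A, B] + 4 * G + 2 = card T + 6}
     = (\<Union>R\<in>symsubs T. \<Union>h\<le>G. uni R h \<times> uni (T - R) (G - h))" (is "?L = ?R")
  proof (intro set_eqI iffI)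
    fix p assume "p \<in> ?L"
    then obtain A B where p: "p = (A, B)" and d: "distinct (A @ B)" and s: "set (A @ B) = T" and clA: "cl (set A)"
      and nv: "2 * nvi [A, B] + 4 * G + 2 = card T + 6" by auto
    have B: "set B = T - set A" using d s by auto
    have clB: "cl (set B)" unfolding B using T clA by (auto simp: symm_def cl_diff)
    have c: "card (set A) + card (set B) = card T" using card_Un_disjoint[of "set A" "set B"] d s by simp
    obtain g1 where g1: "A \<in> uni (set A) g1" using genus_exists(1)[of "set A" A] symm_sub[OF T] clA s d by auto
    obtain g2 where g2: "B \<in> uni (set B) g2" using genus_exists(1)[of "set B" B] symm_sub[OF T] clB s d by auto
    have "g1 + g2 = G" using nv nvi_append2[OF d clA clB] g1 g2 c by (simp add: uni_def)
    then have "set A \<in> symsubs T" "g1 \<le> G" "p \<in> uni (set A) g1 \<times> uni (T - set A) (G - g1)"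
      using g1 g2 B p s clA by (auto simp: symsubs_def)
    then show "p \<in> ?R" by blast
  next
    fix p assume "p \<in> ?R"
    then obtain R h A B where R: "R \<subseteq> T" "cl R" "h \<le> G" and p: "p = (A, B)" and A: "A \<in> uni R h" and B: "B \<in> uni (T - R) (G - h)"
      by (auto simp: symsubs_def)
    have c: "card R + card (T - R) = card T" using card_Un_disjoint[of R "T - R"] R T
      by (simp add: symm_def Un_absorb1 finite_subset)
    have AB: "distinct A" "set A = R" "distinct B" "set B = T - R" using A B by (auto simp: uni_def)
    have "nvi [A, B] = nvi [A] + nvi [B]"
      by (rule nvi_append2) (use AB R T in \<open>auto simp: cl_diff symm_def\<close>)
    moreover have "2 * nvi [A] + 4 * h + 2 = card R + 4" "2 * nvi [B] + 4 * (G - h) + 2 = card (T - R) + 4"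
      using A B by (auto simp: uni_def)
    ultimately have "2 * nvi [A, B] + 4 * G + 2 = card T + 6" using R(3) c by linarith
    then show "p \<in> ?L" using AB R p by auto
  qed
  then show ?thesis using card_UN_uni_prod[OF T, of "\<lambda>R h. uni (T - R) (G - h)"] finite_uni symm_diff[OF T]
    unfolding pairs_uni_def by (simp add: symsubs_def)
qed

text \<open>Here \<open>A\<close> is a component by itself. By \<open>cl_part\<close>,
  \<open>B\<close> inherits from \<open>C\<close> that it is not closed, so the pair of
  \<open>B\<close> and \<open>C\<close> is a connected bicellular map.\<close>

lemma card_disc_bi:
  assumes T: "symm T"
  shows "card {(A, B, C). distinct (A @ B @ C) \<and> set (A @ B @ C) = T \<and> cl (set A) \<and> \<not> cl (set C) \<and> 2 * nvi [A, B, C] + 4 * G + 4 = card T + 6}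
    = pairs_bi T G"
proof -
  have "{(A, B, C). distinct (A @ B @ C) \<and> set (A @ B @ C) = T \<and> cl (set A) \<and> \<not> cl (set C) \<and> 2 * nvi [A, B, C] + 4 * G + 4 = card T + 6}
     = (\<Union>R\<in>symsubs T. \<Union>h\<le>G. uni R h \<times> bi (T - R) (G - h))" (is "?L = ?R")
  proof (intro set_eqI iffI)
    fix p assume "p \<in> ?L"
    then obtain A B C where p: "p = (A, B, C)" and d: "distinct (A @ B @ C)" and s: "set (A @ B @ C) = T" and clA: "cl (set A)"
      and C: "\<not> cl (set C)" and nv: "2 * nvi [A, B, C] + 4 * G + 4 = card T + 6" by auto
    have B: "set (B @ C) = T - set A" using d s by auto
    have clB: "cl (set B \<union> set C)" using B T clA by (auto simp: symm_def cl_diff)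
    have nB: "\<not> cl (set B)" using cl_part[OF clB] d C by auto
    have c: "card (set A) + card (set (B @ C)) = card T" using card_Un_disjoint[of "set A" "set (B @ C)"] d s by simp
    obtain g1 where g1: "A \<in> uni (set A) g1" using genus_exists(1)[of "set A" A] symm_sub[OF T] clA s d by auto
    obtain g2 where g2: "(B, C) \<in> bi (set (B @ C)) g2" 
      using genus_exists(2)[of "set (B @ C)" B C] symm_sub[OF T, of "set (B @ C)"] clB s d nB by auto
    have "g1 + g2 = G" using nv nvi_append3[OF d clA clB] g1 g2 c by (simp add: uni_def bi_def)
    then have "set A \<in> symsubs T" "g1 \<le> G" "p \<in> uni (set A) g1 \<times> bi (T - set A) (G - g1)"
      using g1 g2 B p s clA by (auto simp: symsubs_def)
    then show "p \<in> ?R" by blast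
  next
    fix p assume "p \<in> ?R"
    then obtain R h A B C where R: "R \<subseteq> T" "cl R" "h \<le> G" and p: "p = (A, B, C)" and A: "A \<in> uni R h" and B: "(B, C) \<in> bi (T - R) (G - h)"
      by (auto simp: symsubs_def)
    have c: "card R + card (T - R) = card T" using card_Un_disjoint[of R "T - R"] R T
      by (simp add: symm_def Un_absorb1 finite_subset)
    have AB: "distinct A" "set A = R" "distinct (B @ C)" "set (B @ C) = T - R" "\<not> cl (set B)" using A B by (auto simp: uni_def bi_def)
    have clB: "cl (set B \<union> set C)" using AB(4) R T by (simp add: cl_diff symm_def)
    have nC: "\<not> cl (set C)" using cl_part[OF clB] AB by auto
    have d: "distinct (A @ B @ C)" using AB by auto
    have "nvi [A, B, C] = nvi [A] + nvi [B, C]"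
      by (rule nvi_append3[OF d _ clB]) (use AB R in auto)
    moreover have "2 * nvi [A] + 4 * h + 2 = card R + 4" "2 * nvi [B, C] + 4 * (G - h) + 4 = card (T - R) + 4"
      using A B by (auto simp: uni_def bi_def)
    ultimately have "2 * nvi [A, B, C] + 4 * G + 4 = card T + 6" using R(3) c by linarith
    then show "p \<in> ?L" using AB R p d nC by auto
  qed
  then show ?thesis using card_UN_uni_prod[OF T, of "\<lambda>R h. bi (T - R) (G - h)"] finite_bi symm_diff[OF T]
    unfolding pairs_bi_def by (simp add: symsubs_def)
qed

text \<open>If the remainder stays connected, the genus drops by one. For \<open>G = 0\<close> the
  remainder would have Euler characteristic 4, contrary to \<open>genus_exists\<close>.\<close>

lemma card_conn_uni:
  assumes T: "symm T"
  shows "card {(A, B). distinct (A @ B) \<and> set (A @ B) = T \<and> \<not> cl (set A) \<and> 2 * nvi [A, B] + 4 * G + 2 = card T + 6}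
    = (if G = 0 then 0 else card (bi T (G - 1)))"
proof (cases "G = 0")
  case True
  have "{(A, B). distinct (A @ B) \<and> set (A @ B) = T \<and> \<not> cl (set A) \<and> 2 * nvi [A, B] + 4 * G + 2 = card T + 6} = {}"
  proof (rule ccontr)
    assume "\<not> ?thesis"
    then obtain A B where AB: "distinct (A @ B)" "set (A @ B) = T" "\<not> cl (set A)" and nv: "2 * nvi [A, B] + 4 * G + 2 = card T + 6"
      by blast
    from genus_exists(2)[OF T AB] obtain g where "(A, B) \<in> bi T g" ..
    then show False using nv True by (simp add: bi_def)
  qed
  then show ?thesis using True by (simp only: card.empty if_True refl)
next
  case False
  then have "2 * v + 4 * G + 2 = card T + 6 \<longleftrightarrow> 2 * v + 4 * (G - 1) + 4 = card T + 4" for v by linarith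
  then show ?thesis using False by (simp only: bi_def if_False)
qed

text \<open>A nonempty word on \<open>S\<close> has the form \<open>x # A @ - x # B\<close> in
  exactly one way, because \<open>- x\<close> occurs once. Deletion is therefore a bijection onto
  triples, which are sorted by whether \<open>A\<close> is closed.\<close>

lemma card_uni_rec:
  assumes S: "symm S" "S \<noteq> {}"
  shows "card (uni S G) = (\<Sum>x\<in>S. pairs_uni (S - {x, - x}) G +
    (if G = 0 then 0 else card (bi (S - {x, - x}) (G - 1))))"
proof -
  define PQ where "PQ T = {(A, B). distinct (A @ B) \<and> set (A @ B) = T \<and> 2 * nvi [A, B] + 4 * G + 2 = card T + 6}" for T
  have fPQ: "finite (PQ T)" if "finite T" for T
    by (rule finite_subset[OF _ finite_pairs[OF that]]) (auto simp: PQ_def)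
  have cPQ: "card (PQ T) = pairs_uni T G + (if G = 0 then 0 else card (bi T (G - 1)))" if T: "symm T" for T
  proof -
    have "PQ T = {(A, B). distinct (A @ B) \<and> set (A @ B) = T \<and> cl (set A) \<and> 2 * nvi [A, B] + 4 * G + 2 = card T + 6}
       \<union> {(A, B). distinct (A @ B) \<and> set (A @ B) = T \<and> \<not> cl (set A) \<and> 2 * nvi [A, B] + 4 * G + 2 = card T + 6}" (is "_ = ?X \<union> ?Y")
      unfolding PQ_def by blast
    moreover have "card (?X \<union> ?Y) = card ?X + card ?Y"
    proof (rule card_Un_disjoint)
      have f: "finite (PQ T)" using fPQ T by (simp add: symm_def)
      show "finite ?X" "finite ?Y" by (rule finite_subset[OF _ f], unfold PQ_def, blast)+
    qed blast
    ultimately show ?thesis unfolding card_disc_uni[OF T, of G] card_conn_uni[OF T, of G] by (simp only:)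
  qed
  define f where "f = (\<lambda>(x::int, A, B). x # A @ - x # B)"
  have "bij_betw f (SIGMA x:S. PQ (S - {x, - x})) (uni S G)"
    unfolding bij_betw_def
  proof
    show "inj_on f (SIGMA x:S. PQ (S - {x, - x}))"
    proof (rule inj_onI)
      fix p q assume pq: "p \<in> (SIGMA x:S. PQ (S - {x, - x}))" "q \<in> (SIGMA x:S. PQ (S - {x, - x}))" "f p = f q"
      obtain x A B y C D where p: "p = (x, A, B)" and q: "q = (y, C, D)" by (cases p; cases q)
      have eq: "y = x" "A @ - x # B = C @ - x # D" using pq(3) by (auto simp: p q f_def)
      have "- x \<notin> set A" "- x \<notin> set B" using pq(1,2) by (auto simp: p q PQ_def eq(1))
      then show "p = q" using eq append_Cons_eq_iff[of "- x" A B C D] by (simp add: p q)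
    qed
    show "f ` (SIGMA x:S. PQ (S - {x, - x})) = uni S G"
    proof (intro set_eqI iffI)
      fix w assume "w \<in> f ` (SIGMA x:S. PQ (S - {x, - x}))"
      then obtain x A B where x: "x \<in> S" and AB: "(A, B) \<in> PQ (S - {x, - x})" and w: "w = x # A @ - x # B"
        by (auto simp: f_def)
      note T = symm_remove[OF S(1) x]
      have d: "distinct w" "set w = S" using AB T(3,5) by (auto simp: w PQ_def)
      have "nvi [w] = nvi [A, B]" unfolding w
        by (rule nvi_split) (use d AB T(1) in \<open>auto simp: w PQ_def symm_def\<close>)
      then show "w \<in> uni S G" using d AB T(2) by (simp add: uni_def PQ_def)
    next
      fix w assume w: "w \<in> uni S G"
      then obtain x w' where x: "w = x # w'" using S(2) by (cases w) (auto simp: uni_def)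
      have xS: "x \<in> S" using w x by (auto simp: uni_def)
      note T = symm_remove[OF S(1) xS]
      have "- x \<in> set w'" using T(3,4) w x by (auto simp: uni_def)
      then obtain A B where w': "w' = A @ - x # B" by (meson split_list)
      have s: "set (A @ B) = S - {x, - x}" and d: "distinct (A @ B)" using w x w' by (auto simp: uni_def)
      have "nvi [w] = nvi [A, B]" unfolding x w'
        by (rule nvi_split) (use w x w' s T(1) in \<open>auto simp: uni_def symm_def\<close>)
      then have "(A, B) \<in> PQ (S - {x, - x})" using s d T(2) w unfolding PQ_def uni_def by simp
      then have "(x, A, B) \<in> (SIGMA x:S. PQ (S - {x, - x}))" using xS by simp
      then show "w \<in> f ` (SIGMA x:S. PQ (S - {x, - x}))"
        by (rule rev_image_eqI) (simp add: f_def x w')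
    qed
  qed
  then have "card (uni S G) = card (SIGMA x:S. PQ (S - {x, - x}))"
    by (rule bij_betw_same_card[symmetric])
  also have "\<dots> = (\<Sum>x\<in>S. card (PQ (S - {x, - x})))"
    using S fPQ by (intro card_SigmaI) (auto simp: symm_def)
  also have "\<dots> = (\<Sum>x\<in>S. pairs_uni (S - {x, - x}) G + (if G = 0 then 0 else card (bi (S - {x, - x}) (G - 1))))"
    by (intro sum.cong refl cPQ symm_remove(1)[OF S(1)])
  finally show ?thesis .
qed

section \<open>Deleting an edge of a bicellular map\<close>

lemma card_sum_le: "2 * card {(i, j). i + j \<le> (L::nat)} = (L + 1) * (L + 2)"
proof -
  have "{(i, j). i + j \<le> L} = (SIGMA i:{..L}. {..L - i})" by auto
  then have "card {(i, j). i + j \<le> L} = (\<Sum>i\<le>L. L - i + 1)" by (simp add: card_SigmaI)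
  also have "\<dots> = (\<Sum>i\<le>L. i + 1)" by (rule sum.reindex_bij_witness[where i = "\<lambda>i. L - i" and j = "\<lambda>i. L - i"]) auto
  also have "2 * \<dots> = (L + 1) * (L + 2)" by (induction L) auto
  finally show ?thesis .
qed

text \<open>A splitting is fixed by the lengths of its first two parts, whose sum is at most 2n.
  This gives binom(2n+2, 2) possibilities, the polynomial coefficient in the final
  recursion.\<close>

lemma card_three_splits:
  fixes X :: "'a list set"
  assumes "finite X" "\<And>w. w \<in> X \<Longrightarrow> length w = 2 * n"
  shows "card {(A, B, C). A @ B @ C \<in> X} = (n + 1) * (2 * n + 1) * card X"
proof -
  let ?I = "{(i, j). i + j \<le> 2 * n}"
  have td: "take i w @ take j (drop i w) @ drop (i + j) w = w" for i j and w :: "'a list"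
    by (metis add.commute append_take_drop_id drop_drop)
  have "bij_betw (\<lambda>(w, i, j). (take i w, take j (drop i w), drop (i + j) w)) (X \<times> ?I) {(A, B, C). A @ B @ C \<in> X}"
  proof (rule bij_betw_byWitness[where f' = "\<lambda>(A, B, C). (A @ B @ C, length A, length B)"])
    show "\<forall>a\<in>X \<times> ?I. (\<lambda>(A, B, C). (A @ B @ C, length A, length B)) ((\<lambda>(w, i, j). (take i w, take j (drop i w), drop (i + j) w)) a) = a"
      using assms(2) td by auto
    show "(\<lambda>(w, i, j). (take i w, take j (drop i w), drop (i + j) w)) ` (X \<times> ?I) \<subseteq> {(A, B, C). A @ B @ C \<in> X}"
      using td by auto
    show "(\<lambda>(A, B, C). (A @ B @ C, length A, length B)) ` {(A, B, C). A @ B @ C \<in> X} \<subseteq> X \<times> ?I"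
    proof
      fix p assume "p \<in> (\<lambda>(A, B, C). (A @ B @ C, length A, length B)) ` {(A, B, C). A @ B @ C \<in> X}"
      then obtain A B C where "A @ B @ C \<in> X" "p = (A @ B @ C, length A, length B)" by auto
      then show "p \<in> X \<times> ?I" using assms(2)[of "A @ B @ C"] by simp
    qed
  qed auto
  from bij_betw_same_card[OF this] have "card {(A, B, C). A @ B @ C \<in> X} = card X * card ?I"
    unfolding card_cartesian_product by (rule sym)
  moreover have "card ?I = (n + 1) * (2 * n + 1)" using card_sum_le[of "2 * n"] by simp
  ultimately show ?thesis by simp
qed

text \<open>Closed \<open>A\<close> and closed \<open>B\<close> exclude each other, since together
  they would make \<open>C\<close> closed. So either no word is closed, which is a tricellular map
  of genus one less, or exactly one of \<open>A\<close> and \<open>B\<close> splits off; exchanging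
  these two words explains the factor 2.\<close>

lemma card_bi_split:
  assumes T: "symm T"
  shows "card {(A, B, C). distinct (A @ B @ C) \<and> set (A @ B @ C) = T \<and> \<not> cl (set C) \<and> 2 * nvi [A, B, C] + 4 * (g + 1) + 4 = card T + 6}
    = card (tri T g) + 2 * pairs_bi T (g + 1)" (is "card ?Z = _")
proof -
  let ?P = "\<lambda>A B C. distinct (A @ B @ C) \<and> set (A @ B @ C) = T \<and> \<not> cl (set C) \<and> 2 * nvi [A, B, C] + 4 * (g + 1) + 4 = card T + 6"
  let ?X = "{(A, B, C). ?P A B C \<and> cl (set A)}" and ?Y = "{(A, B, C). ?P A B C \<and> cl (set B)}"
  have clT: "cl T" using T by (simp add: symm_def)
  have fZ: "finite ?Z"
    by (rule finite_subset[OF _ finite_triples[of T]]) (use T in \<open>auto simp: symm_def\<close>)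
  have "2 * v + 4 * (g + 1) + 4 = card T + 6 \<longleftrightarrow> 2 * v + 4 * g + 6 = card T + 4" for v by auto
  then have tri: "tri T g = {(A, B, C). ?P A B C \<and> \<not> cl (set A) \<and> \<not> cl (set B)}"
    unfolding tri_def by blast
  have "\<not> (cl (set A) \<and> cl (set B))" if "?P A B C" for A B C
  proof
    assume "cl (set A) \<and> cl (set B)"
    then have "cl (set A \<union> set B)" by (simp add: cl_Un)
    moreover have "cl ((set A \<union> set B) \<union> set C)" using that clT by (simp add: Un_assoc)
    ultimately show False using that cl_part[of "set A \<union> set B" "set C"] by auto
  qed
  then have XY: "?X \<inter> ?Y = {}" by blast
  have Z: "?Z = tri T g \<union> (?X \<union> ?Y)" unfolding tri by blast
  have fX: "finite ?X" by (rule finite_subset[OF _ fZ]) blast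
  have fY: "finite ?Y" by (rule finite_subset[OF _ fZ]) blast
  have "card ?Z = card (tri T g) + (card ?X + card ?Y)"
    unfolding Z
  proof (subst card_Un_disjoint)
    show "tri T g \<inter> (?X \<union> ?Y) = {}" unfolding tri by blast
    show "card (tri T g) + card (?X \<union> ?Y) = card (tri T g) + (card ?X + card ?Y)"
      using card_Un_disjoint[OF fX fY XY] by (simp only:)
    show "finite (tri T g)" by (rule finite_tri[OF T])
    show "finite (?X \<union> ?Y)" by (rule finite_UnI[OF fX fY])
  qed
  moreover have X: "card ?X = pairs_bi T (g + 1)"
    unfolding card_disc_bi[OF T, symmetric] by (rule arg_cong[where f = card]) blast
  moreover have "card ?Y = card ?X"
  proof (rule bij_betw_same_card[of "\<lambda>(A, B, C). (B, A, C)"], rule bij_betw_byWitness[where f' = "\<lambda>(A, B, C). (B, A, C)"])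
    have *: "?P B A C" if "?P A B C" for A B C
    proof -
      have "nvi [A, B, C] = nvi [B, A, C]"
        by (rule nv_swap) (use that clT in simp)
      then show ?thesis using that by auto
    qed
    show "(\<lambda>(A, B, C). (B, A, C)) ` ?Y \<subseteq> ?X"
    proof
      fix p assume "p \<in> (\<lambda>(A, B, C). (B, A, C)) ` ?Y"
      then obtain q where q: "q \<in> ?Y" "p = (\<lambda>(A, B, C). (B, A, C)) q" by (rule imageE)
      obtain A B C where q': "q = (A, B, C)" by (cases q)
      have "?P A B C" "cl (set B)" "p = (B, A, C)"
        using q unfolding q' mem_Collect_eq prod.case by blast+
      then show "p \<in> ?X" using *[of A B C] unfolding mem_Collect_eq by blast
    qed
    show "(\<lambda>(A, B, C). (B, A, C)) ` ?X \<subseteq> ?Y"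
    proof
      fix p assume "p \<in> (\<lambda>(A, B, C). (B, A, C)) ` ?X"
      then obtain q where q: "q \<in> ?X" "p = (\<lambda>(A, B, C). (B, A, C)) q" by (rule imageE)
      obtain A B C where q': "q = (A, B, C)" by (cases q)
      have "?P A B C" "cl (set A)" "p = (B, A, C)"
        using q unfolding q' mem_Collect_eq prod.case by blast+
      then show "p \<in> ?Y" using *[of A B C] unfolding mem_Collect_eq by blast
    qed
  qed auto
  ultimately show ?thesis by (simp only:)
qed

text \<open>The cases are separated by the position of the partner of the first letter. The total
  genus remains \<open>g + 1\<close> when the faces merge or a component splits off; it falls to
  \<open>g\<close> only when three connected faces remain.\<close>

lemma card_bi_rec:
  assumes S: "symm S" and n: "card S = 2 * n + 2"
  shows "card (bi S (g + 1)) = (\<Sum>x\<in>S. card (tri (S - {x, - x}) g) + 2 * pairs_bi (S - {x, - x}) (g + 1)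
    + (n + 1) * (2 * n + 1) * card (uni (S - {x, - x}) (g + 1)))"
proof -
  define Z where "Z T = {(A, B, C). distinct (A @ B @ C) \<and> set (A @ B @ C) = T \<and> \<not> cl (set C) \<and> 2 * nvi [A, B, C] + 4 * (g + 1) + 4 = card T + 6}" for T
  define Y where "Y T = {(A, B, C). A @ B @ C \<in> uni T (g + 1)}" for T
  define f1 where "f1 = (\<lambda>(x::int, A, B, C::int list). (x # A @ - x # B, C))"
  \<comment> \<open>The triple is stored in the order C, B, A because the two words merge to
    \<open>C @ B @ A\<close>, so that \<open>Y\<close> is the set of three-part splittings of
    unicellular words.\<close>
  define f2 where "f2 = (\<lambda>(x::int, C, B, A). (x # A, B @ - x # C))"
  let ?S1 = "SIGMA x:S. Z (S - {x, - x})" and ?S2 = "SIGMA x:S. Y (S - {x, - x})"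
  note rm = symm_remove[OF S]
  have fS: "finite S" using S by (simp add: symm_def)
  have cT: "card (S - {x, - x}) = 2 * n" if "x \<in> S" for x using rm(2)[OF that] n by simp
  have fZ: "finite (Z T)" if "finite T" for T
    by (rule finite_subset[OF _ finite_triples[OF that]]) (auto simp: Z_def)
  have fY: "finite (Y T)" if "finite T" for T
    by (rule finite_subset[OF _ finite_triples[OF that]]) (auto simp: Y_def uni_def)
  have i1: "inj_on f1 ?S1"
  proof (rule inj_onI)
    fix p q assume pq: "p \<in> ?S1" "q \<in> ?S1" "f1 p = f1 q"
    obtain x A B C y A' B' C' where p: "p = (x, A, B, C)" and q: "q = (y, A', B', C')" by (cases p; cases q)
    have eq: "y = x" "A @ - x # B = A' @ - x # B'" "C = C'" using pq(3) by (auto simp: p q f1_def)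
    have "- x \<notin> set A" "- x \<notin> set B" using pq(1,2) by (auto simp: p q Z_def eq(1))
    then show "p = q" using eq append_Cons_eq_iff[of "- x" A B A' B'] by (simp add: p q)
  qed
  have i2: "inj_on f2 ?S2"
  proof (rule inj_onI)
    fix p q assume pq: "p \<in> ?S2" "q \<in> ?S2" "f2 p = f2 q"
    obtain x A B C y A' B' C' where p: "p = (x, C, B, A)" and q: "q = (y, C', B', A')" by (cases p; cases q)
    have eq: "y = x" "B @ - x # C = B' @ - x # C'" "A = A'" using pq(3) by (auto simp: p q f2_def)
    have "- x \<notin> set B" "- x \<notin> set C" using pq(1,2) by (auto simp: p q Y_def uni_def eq(1))
    then show "p = q" using eq append_Cons_eq_iff[of "- x" B C B' C'] by (simp add: p q)
  qed
  have img1: "f1 ` ?S1 = {(A, B). (A, B) \<in> bi S (g + 1) \<and> - hd A \<in> set A}" (is "_ = ?B1")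
  proof (intro set_eqI iffI)
    fix p assume "p \<in> f1 ` ?S1"
    then obtain x A B C where x: "x \<in> S" and Z: "(A, B, C) \<in> Z (S - {x, - x})" and p: "p = (x # A @ - x # B, C)"
      by (auto simp: f1_def)
    have clS: "cl (S - {x, - x})" "cl S" using rm(1)[OF x] S by (simp_all add: symm_def)
    have s: "set (x # A @ - x # B) \<union> set C = S" using Z rm(5)[OF x] by (auto simp: Z_def)
    have d: "distinct (x # A @ - x # B @ C)" using Z rm(3)[OF x] by (auto simp: Z_def)
    have nv: "nvi [x # A @ - x # B, C] = nvi [A, B, C]"
      by (rule nvi_split2[OF d]) (use Z clS in \<open>simp add: Z_def Un_assoc\<close>)
    have "\<not> cl (set (x # A @ - x # B))"
      using cl_part[of "set (x # A @ - x # B)" "set C"] s clS d Z by (auto simp: Z_def)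
    then show "p \<in> ?B1" using s d nv Z rm(2)[OF x] by (auto simp: p bi_def Z_def)
  next
    fix p assume p: "p \<in> ?B1"
    then obtain w C where w: "p = (w, C)" "(w, C) \<in> bi S (g + 1)" "- hd w \<in> set w" by auto
    \<comment> \<open>The empty word is closed, so the first word of a connected pair does have a
      first letter.\<close>
    have "w \<noteq> []" using w(2) by (auto simp: bi_def closed_under_def)
    then obtain x w' where xw: "w = x # w'" by (cases w) auto
    have x: "x \<in> S" using w(2) by (auto simp: xw bi_def)
    have "- x \<in> set w'" using w(3) rm(3)[OF x] by (auto simp: xw)
    then obtain A B where w': "w' = A @ - x # B" by (meson split_list)
    have clS: "cl (S - {x, - x})" "cl S" using rm(1)[OF x] S by (simp_all add: symm_def)
    have s: "set (A @ B @ C) = S - {x, - x}" and d: "distinct (x # A @ - x # B @ C)"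
      using w(2) by (auto simp: xw w' bi_def)
    have nv: "nvi [x # A @ - x # B, C] = nvi [A, B, C]"
      by (rule nvi_split2[OF d]) (use s clS in \<open>simp add: Un_assoc\<close>)
    have "\<not> cl (set C)"
      using cl_part[of "set w" "set C"] w(2) clS by (auto simp: bi_def)
    then have "(A, B, C) \<in> Z (S - {x, - x})"
      using s d nv w(2) rm(2)[OF x] unfolding Z_def by (auto simp: xw w' bi_def)
    then have "(x, A, B, C) \<in> ?S1" using x by simp
    then show "p \<in> f1 ` ?S1" by (rule rev_image_eqI) (simp add: f1_def w(1) xw w')
  qed
  have img2: "f2 ` ?S2 = {(A, B). (A, B) \<in> bi S (g + 1) \<and> - hd A \<notin> set A}" (is "_ = ?B2")
  proof (intro set_eqI iffI)
    fix p assume "p \<in> f2 ` ?S2"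
    then obtain x A B C where x: "x \<in> S" and Y: "(C, B, A) \<in> Y (S - {x, - x})" and p: "p = (x # A, B @ - x # C)"
      by (auto simp: f2_def)
    have clS: "cl (S - {x, - x})" "cl S" using rm(1)[OF x] S by (simp_all add: symm_def)
    have s: "set (x # A) \<union> set (B @ - x # C) = S" using Y rm(5)[OF x] by (auto simp: Y_def uni_def)
    have d: "distinct (x # A @ B @ - x # C)" using Y rm(3)[OF x] by (auto simp: Y_def uni_def)
    have nv: "nvi [[] @ x # A, B @ - x # C] = nvi [[] @ C @ B @ A]"
      by (rule nvi_merge) (use d Y clS in \<open>auto simp: Y_def uni_def Un_ac\<close>)
    have "- x \<notin> set (x # A)" using d rm(3)[OF x] by auto
    moreover then have "\<not> cl (set (x # A))" by (auto simp: closed_under_def)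
    ultimately show "p \<in> ?B2" using s d nv Y rm(2)[OF x] by (auto simp: p bi_def Y_def uni_def)
  next
    fix p assume p: "p \<in> ?B2"
    then obtain w v where w: "p = (w, v)" "(w, v) \<in> bi S (g + 1)" "- hd w \<notin> set w" by auto
    have "w \<noteq> []" using w(2) by (auto simp: bi_def closed_under_def)
    then obtain x A where xw: "w = x # A" by (cases w) auto
    have x: "x \<in> S" using w(2) by (auto simp: xw bi_def)
    have "- x \<in> set v" using w(2,3) rm(4)[OF x] by (auto simp: xw bi_def)
    then obtain B C where v: "v = B @ - x # C" by (meson split_list)
    have clS: "cl (S - {x, - x})" "cl S" using rm(1)[OF x] S by (simp_all add: symm_def)
    have s: "set (C @ B @ A) = S - {x, - x}" and d: "distinct (x # A @ B @ - x # C)"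
      using w(2) by (auto simp: xw v bi_def)
    have nv: "nvi [[] @ x # A, B @ - x # C] = nvi [[] @ C @ B @ A]"
      by (rule nvi_merge) (use d s clS in \<open>auto simp: Un_ac\<close>)
    have "(C, B, A) \<in> Y (S - {x, - x})"
      using s d nv w(2) rm(2)[OF x] unfolding Y_def uni_def by (auto simp: xw v bi_def)
    then have "(x, C, B, A) \<in> ?S2" using x by simp
    then show "p \<in> f2 ` ?S2" by (rule rev_image_eqI) (simp add: f2_def w(1) xw v)
  qed
  have B: "bi S (g + 1) = ?B1 \<union> ?B2" "?B1 \<inter> ?B2 = {}" by auto
  have "finite ?B1" "finite ?B2" by (rule finite_subset[OF _ finite_bi[OF S, of "g + 1"]], blast)+
  then have "card (?B1 \<union> ?B2) = card ?B1 + card ?B2" using B(2) by (rule card_Un_disjoint)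
  then have "card (bi S (g + 1)) = card ?B1 + card ?B2" using arg_cong[OF B(1), of card] by (rule trans[rotated])
  also have "card ?B1 = card ?S1" using card_image[OF i1] unfolding img1 .
  also have "card ?S1 = (\<Sum>x\<in>S. card (Z (S - {x, - x})))" using fS fZ by (intro card_SigmaI) auto
  also have "\<dots> = (\<Sum>x\<in>S. card (tri (S - {x, - x}) g) + 2 * pairs_bi (S - {x, - x}) (g + 1))"
    unfolding Z_def by (intro sum.cong refl card_bi_split rm(1))
  also have "card ?B2 = card ?S2" using card_image[OF i2] unfolding img2 .
  also have "card ?S2 = (\<Sum>x\<in>S. card (Y (S - {x, - x})))" using fS fY by (intro card_SigmaI) auto
  also have "\<dots> = (\<Sum>x\<in>S. (n + 1) * (2 * n + 1) * card (uni (S - {x, - x}) (g + 1)))"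
    unfolding Y_def
  proof (intro sum.cong refl card_three_splits finite_uni rm(1))
    show "length w = 2 * n" if "x \<in> S" "w \<in> uni (S - {x, - x}) (g + 1)" for x w
      using that cT[of x] distinct_card[of w] by (simp add: uni_def)
  qed
  finally show ?thesis by (simp add: sum.distrib)
qed

section \<open>Planted maps and their words\<close>

text \<open>A set of faces whose half-edges are closed under the involution is a union of
  components. Connectedness is thus expressed through faces, which the words show directly, instead
  of vertices.\<close>

definition conn :: "('a \<Rightarrow> 'a) \<Rightarrow> 'a list list \<Rightarrow> bool" where
  "conn f ws \<longleftrightarrow> (\<forall>I\<subseteq>{..<length ws}. closed_under f (\<Union>i\<in>I. set (ws ! i)) \<longrightarrow> I = {} \<or> I = {..<length ws})"

text \<open>The form of \<open>uni\<close>, \<open>bi\<close> and \<open>tri\<close> for any number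
  of faces, which allows isomorphism classes to be counted once for all \<open>k\<close>.\<close>

definition gmaps :: "nat \<Rightarrow> int set \<Rightarrow> nat \<Rightarrow> int list list set" where
  "gmaps k S g = {ws. length ws = k \<and> distinct (concat ws) \<and> set (concat ws) = S \<and> conn uminus ws \<and>
     2 * nvi ws + 4 * g + 2 * k = card S + 4}"

section \<open>Cycles of a permutation as words\<close>

lemma orb_I: "(f ^^ j) x \<in> orb f x"
  by (auto simp: orb_def)

lemma funpow_closed: "f ` H \<subseteq> H \<Longrightarrow> x \<in> H \<Longrightarrow> (f ^^ j) x \<in> H"
  by (induction j) auto

lemma funpow_inj:
  assumes "inj_on f H" "f ` H \<subseteq> H" "x \<in> H" "(f ^^ (i + d)) x = (f ^^ i) x"
  shows "(f ^^ d) x = x"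
  using assms(4)
proof (induction i)
  case (Suc i)
  have "f ((f ^^ (i + d)) x) = f ((f ^^ i) x)" using Suc.prems by simp
  then show ?case using Suc.IH inj_onD[OF assms(1)] funpow_closed[OF assms(2,3)] by blast
qed simp

lemma orbit_list:
  assumes "finite H" "inj_on f H" "f ` H \<subseteq> H" "x \<in> H"
  shows "(f ^^ card (orb f x)) x = x" "card (orb f x) > 0"
    "distinct (map (\<lambda>j. (f ^^ j) x) [0..<card (orb f x)])"
    "set (map (\<lambda>j. (f ^^ j) x) [0..<card (orb f x)]) = orb f x" "orb f x \<subseteq> H"
proof -
  show sub: "orb f x \<subseteq> H" using funpow_closed[OF assms(3,4)] by (auto simp: orb_def)
  have "\<not> inj (\<lambda>j. (f ^^ j) x)"
  proof
    assume "inj (\<lambda>j. (f ^^ j) x)"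
    moreover have "finite (range (\<lambda>j. (f ^^ j) x))"
      by (rule finite_subset[OF _ assms(1)]) (auto intro: funpow_closed[OF assms(3,4)])
    ultimately show False using finite_imageD by fastforce
  qed
  then obtain i j where "i < j" "(f ^^ j) x = (f ^^ i) x"
    unfolding inj_on_def by (metis linorder_neqE_nat)
  then have ex: "\<exists>d. d > 0 \<and> (f ^^ d) x = x"
    using funpow_inj[OF assms(2-4), of i "j - i"] by (intro exI[of _ "j - i"]) simp
  define L where "L = (LEAST d. d > 0 \<and> (f ^^ d) x = x)"
  have L: "L > 0" "(f ^^ L) x = x" using LeastI_ex[OF ex] by (simp_all add: L_def)
  have inj: "inj_on (\<lambda>j. (f ^^ j) x) {0..<L}"
  proof (rule linorder_inj_onI')
    fix i j assume ij: "i \<in> {0..<L}" "j \<in> {0..<L}" "i < j"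
    show "(f ^^ i) x \<noteq> (f ^^ j) x"
    proof
      assume "(f ^^ i) x = (f ^^ j) x"
      then have "(f ^^ (j - i)) x = x" using funpow_inj[OF assms(2-4), of i "j - i"] ij by simp
      then have "L \<le> j - i" unfolding L_def using ij by (intro Least_le) simp
      then show False using ij by simp
    qed
  qed
  have o: "orb f x = (\<lambda>j. (f ^^ j) x) ` {0..<L}"
  proof
    show "orb f x \<subseteq> (\<lambda>j. (f ^^ j) x) ` {0..<L}"
    proof
      fix y assume "y \<in> orb f x"
      then obtain j where "y = (f ^^ j) x" by (auto simp: orb_def)
      then have "y = (f ^^ (j mod L)) x" using funpow_mod_eq[OF L(2)] by simp
      then show "y \<in> (\<lambda>j. (f ^^ j) x) ` {0..<L}" using L(1) by (intro image_eqI[of _ _ "j mod L"]) auto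
    qed
  qed (auto simp: orb_def)
  have c: "card (orb f x) = L" unfolding o card_image[OF inj] by simp
  show "(f ^^ card (orb f x)) x = x" "card (orb f x) > 0" using L c by auto
  show "distinct (map (\<lambda>j. (f ^^ j) x) [0..<card (orb f x)])"
    unfolding c distinct_map using inj by simp
  show "set (map (\<lambda>j. (f ^^ j) x) [0..<card (orb f x)]) = orb f x" by (simp add: c del: set_map) (simp add: o)
qed

lemma walk_orbit:
  "walk h ((f ^^ i) x) (map (\<lambda>j. (f ^^ j) x) [Suc i..<Suc i + d]) (h ((f ^^ (Suc i + d)) x))
   = (\<lambda>j. ((f ^^ j) x, h ((f ^^ Suc j) x))) ` {i..<Suc i + d}"
proof (induction d arbitrary: i)
  case (Suc d)
  have 1: "[Suc i..<Suc i + Suc d] = Suc i # [Suc (Suc i)..<Suc (Suc i) + d]"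
    by (simp add: upt_rec)
  have 2: "{i..<Suc i + Suc d} = insert i {Suc i..<Suc (Suc i) + d}" by auto
  show ?case unfolding 1 2 using Suc[of "Suc i"] by simp
qed simp

text \<open>Link between words and permutations: on a cycle of \<open>f\<close> the arrows form the
  graph of \<open>h\<close> after \<open>f\<close>, which is the vertex permutation when
  \<open>h\<close> is the edge involution and \<open>f\<close> the face permutation.\<close>

lemma face_rel_orbit:
  assumes "L > 0" "(f ^^ L) x = x"
  shows "face_rel h (map (\<lambda>j. (f ^^ j) x) [0..<L]) = (\<lambda>y. (y, h (f y))) ` set (map (\<lambda>j. (f ^^ j) x) [0..<L])"
proof -
  obtain d where L: "L = Suc d" using assms(1) by (cases L) auto
  have "[0..<L] = 0 # [Suc 0..<Suc 0 + d]" using L by (simp add: upt_rec)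
  then have "face_rel h (map (\<lambda>j. (f ^^ j) x) [0..<L]) = walk h ((f ^^ 0) x) (map (\<lambda>j. (f ^^ j) x) [Suc 0..<Suc 0 + d]) (h ((f ^^ (Suc 0 + d)) x))"
    using assms(2) L by simp
  also have "\<dots> = (\<lambda>j. ((f ^^ j) x, h ((f ^^ Suc j) x))) ` {0..<Suc 0 + d}" by (rule walk_orbit)
  finally show ?thesis using L by (simp add: image_image del: upt_Suc)
qed

lemma rooted_eq_map: "rooted i ws = map (\<lambda>j. Inr (i + j) # map Inl (ws ! j)) [0..<length ws]"
proof (induction ws arbitrary: i)
  case (Cons w ws)
  have "[0..<length (w # ws)] = 0 # map Suc [0..<length ws]"
    unfolding map_Suc_upt by (subst upt_conv_Cons) simp_all
  then show ?case using Cons[of "Suc i"] by (simp add: comp_def)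
qed simp

text \<open>On a finite cycle a step backwards is a number of steps forwards, one less than the
  length of the cycle. So the symmetric closure adds nothing to the orbits.\<close>

lemma orb_eq_eqc:
  assumes "finite H" "inj_on f H" "f ` H \<subseteq> H" "x \<in> H"
  shows "orb f x = eqc ((\<lambda>y. (y, f y)) ` H) `` {x}"
proof
  let ?R = "(\<lambda>y. (y, f y)) ` H"
  show "orb f x \<subseteq> eqc ?R `` {x}"
  proof
    fix y assume "y \<in> orb f x"
    then obtain j where "y = (f ^^ j) x" by (auto simp: orb_def)
    moreover have "(x, (f ^^ j) x) \<in> eqc ?R"
    proof (induction j)
      case (Suc j)
      have "((f ^^ j) x, f ((f ^^ j) x)) \<in> eqc ?R"
        using funpow_closed[OF assms(3,4)] by (intro eqc_base) auto
      with Suc show ?case by (auto intro: eqc_trans)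
    qed simp
    ultimately show "y \<in> eqc ?R `` {x}" by simp
  qed
  show "eqc ?R `` {x} \<subseteq> orb f x"
  proof
    fix y assume "y \<in> eqc ?R `` {x}"
    then have "(x, y) \<in> (?R \<union> ?R\<inverse>)\<^sup>*" by (simp add: eqc_def)
    then show "y \<in> orb f x"
    proof induction
      case base
      show ?case using orb_I[of 0 f x] by simp
    next
      case (step y z)
      obtain j where j: "y = (f ^^ j) x" using step(3) by (auto simp: orb_def)
      from step(2) consider "z = f y" | "z \<in> H" "y = f z" by auto
      then show ?case
      proof cases
        case 1
        then have "z = (f ^^ Suc j) x" using j by simp
        then show ?thesis by (metis orb_I)
      next
        case 2
        obtain d where d: "card (orb f z) = Suc d" using orbit_list(2)[OF assms(1-3) 2(1)] by (cases "card (orb f z)") auto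
        have "z = (f ^^ d) y" using orbit_list(1)[OF assms(1-3) 2(1)] 2(2) d by (simp add: funpow_swap1)
        then have "z = (f ^^ (d + j)) x" using j by (simp add: funpow_add)
        then show ?thesis by (metis orb_I)
      qed
    qed
  qed
qed

lemma card_involution_pairs:
  assumes "finite N" "\<And>x. x \<in> N \<Longrightarrow> f x \<in> N \<and> f x \<noteq> x \<and> f (f x) = x"
  shows "2 * card {{x, f x} | x. x \<in> N} = card N"
proof -
  have U: "\<Union> {{x, f x} | x. x \<in> N} = N" using assms(2) by auto
  have e: "{{x, f x} | x. x \<in> N} = (\<lambda>x. {x, f x}) ` N" by auto
  have "2 * card {{x, f x} | x. x \<in> N} = card (\<Union> {{x, f x} | x. x \<in> N})"
  proof (rule card_partition)
    show "finite {{x, f x} | x. x \<in> N}" unfolding e using assms(1) by simp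
    show "finite (\<Union> {{x, f x} | x. x \<in> N})" unfolding U by (rule assms(1))
    show "card c = 2" if c: "c \<in> {{x, f x} | x. x \<in> N}" for c
    proof -
      obtain x where "x \<in> N" "c = {x, f x}" using c by blast
      then show ?thesis using assms(2)[of x] by (auto simp: card_insert_if)
    qed
    show "c \<inter> c' = {}" if c: "c \<in> {{x, f x} | x. x \<in> N}" "c' \<in> {{x, f x} | x. x \<in> N}" "c \<noteq> c'" for c c'
    proof (rule ccontr)
      assume "c \<inter> c' \<noteq> {}"
      then obtain z where z: "z \<in> c" "z \<in> c'" by blast
      have "d = {z, f z}" if d: "d \<in> {{x, f x} | x. x \<in> N}" "z \<in> d" for d
      proof -
        obtain x where "x \<in> N" "d = {x, f x}" using d(1) by blast
        then show ?thesis using d(2) assms(2)[of x] by auto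
      qed
      then have "c = c'" using c(1,2) z by blast
      then show False using c(3) by simp
    qed
  qed
  then show ?thesis unfolding U .
qed

text \<open>Positions 0 and 1 are the plant and its partner: a plant fixed by \<open>sig\<close> is
  sent by \<open>gam\<close> to its own partner. The linear word starts at position 2.\<close>

definition rest :: "pmap \<Rightarrow> nat \<Rightarrow> nat list" where
  "rest M i = map (\<lambda>j. (gam M ^^ j) (pl M i)) [2..<card (orb (gam M) (pl M i))]"

definition nphs :: "nat \<Rightarrow> pmap \<Rightarrow> nat set" where
  "nphs k M = hs M - pl M ` {..<k} - (al M \<circ> pl M) ` {..<k}"

text \<open>Labellings that turn the edge involution into negation. Extensionality fixes the values
  outside \<open>N\<close>, so that each labelling is counted once.\<close>

definition isos :: "('a \<Rightarrow> 'a) \<Rightarrow> 'a set \<Rightarrow> int set \<Rightarrow> ('a \<Rightarrow> int) set" where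
  "isos f N S = {h \<in> extensional N. bij_betw h N S \<and> (\<forall>x\<in>N. h (f x) = - h x)}"

section \<open>The words of a planted map\<close>

locale planted =
  fixes k :: nat and M :: pmap
  assumes pm: "planted_map k M"
begin

abbreviation "H \<equiv> hs M"
abbreviation "P \<equiv> pl M"
abbreviation "Q i \<equiv> al M (pl M i)"
abbreviation "N \<equiv> nphs k M"
definition "F i = {x \<in> H. fc M x = i}"

lemma finH: "finite H"
  and al: "x \<in> H \<Longrightarrow> al M x \<in> H" "x \<in> H \<Longrightarrow> al M x \<noteq> x" "x \<in> H \<Longrightarrow> al M (al M x) = x"
  and gbij: "bij_betw (gam M) H H"
  and fck: "x \<in> H \<Longrightarrow> fc M x < k"
  and fco: "x \<in> H \<Longrightarrow> y \<in> H \<Longrightarrow> fc M x = fc M y \<longleftrightarrow> y \<in> orb (gam M) x"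
  and PH: "i < k \<Longrightarrow> P i \<in> H"
  and fcP: "i < k \<Longrightarrow> fc M (P i) = i"
  and sigP: "i < k \<Longrightarrow> al M (gam M (P i)) = P i"
  using pm unfolding planted_map_def cellular_map_def sig_def by auto

lemma ginj: "inj_on (gam M) H" and gH: "gam M ` H \<subseteq> H"
  using gbij by (auto simp: bij_betw_def)

lemma QH: "i < k \<Longrightarrow> Q i \<in> H" by (simp add: PH al)

lemma gP: "i < k \<Longrightarrow> gam M (P i) = Q i"
  using sigP[of i] al(3)[of "gam M (P i)"] gH PH by force

lemmas orbit = orbit_list[OF finH ginj gH]

lemma fibre: "i < k \<Longrightarrow> orb (gam M) (P i) = F i"
proof -
  assume i: "i < k"
  have "y \<in> orb (gam M) (P i) \<longleftrightarrow> y \<in> F i" for y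
    using fco[OF PH[OF i], of y] fcP[OF i] orbit(5)[OF PH[OF i]] by (auto simp: F_def)
  then show ?thesis by blast
qed

lemma fcQ: "i < k \<Longrightarrow> fc M (Q i) = i"
proof -
  assume i: "i < k"
  have "Q i \<in> orb (gam M) (P i)" unfolding orb_def using gP[OF i] by (auto intro!: exI[of _ 1])
  then show ?thesis using fibre[OF i] by (simp add: F_def)
qed

lemma PQ: "i < k \<Longrightarrow> j < k \<Longrightarrow> P i \<noteq> Q j"
  using fcP fcQ al(2)[OF PH] by metis

lemma card_orb_ge: "i < k \<Longrightarrow> 2 \<le> card (orb (gam M) (P i))"
proof (rule ccontr)
  assume i: "i < k" and "\<not> ?thesis"
  then have "card (orb (gam M) (P i)) = 1" using orbit(2)[OF PH[OF i]] by simp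
  then have "gam M (P i) = P i" using orbit(1)[OF PH[OF i]] by simp
  then show False using gP[OF i] PQ[OF i i] by simp
qed

lemma face_word: "i < k \<Longrightarrow> map (\<lambda>j. (gam M ^^ j) (P i)) [0..<card (orb (gam M) (P i))] = P i # Q i # rest M i"
proof -
  assume i: "i < k"
  have "[0..<card (orb (gam M) (P i))] = 0 # 1 # [2..<card (orb (gam M) (P i))]"
    using card_orb_ge[OF i] by (simp add: upt_rec numeral_2_eq_2)
  then show ?thesis using gP[OF i] by (simp add: rest_def)
qed

lemma face_word_props:
  assumes "i < k"
  shows "distinct (P i # Q i # rest M i)" "set (P i # Q i # rest M i) = F i"
    "face_rel h (P i # Q i # rest M i) = (\<lambda>y. (y, h (gam M y))) ` F i"
proof -
  note * = orbit(3,4)[OF PH[OF assms]] face_rel_orbit[OF orbit(2,1)[OF PH[OF assms]], of h]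
  show "distinct (P i # Q i # rest M i)" "set (P i # Q i # rest M i) = F i"
    "face_rel h (P i # Q i # rest M i) = (\<lambda>y. (y, h (gam M y))) ` F i"
    using *[unfolded face_word[OF assms], unfolded fibre[OF assms]] by (simp_all only:)
qed

lemma F_disj: "i \<noteq> j \<Longrightarrow> F i \<inter> F j = {}" by (auto simp: F_def)

lemma H_F: "H = (\<Union>i<k. F i)" using fck by (auto simp: F_def)

lemma set_rest: "i < k \<Longrightarrow> set (rest M i) = F i \<inter> N"
proof -
  assume i: "i < k"
  have "set (rest M i) = F i - {P i, Q i}" using face_word_props(1,2)[OF i] by auto
  also have "\<dots> = F i \<inter> N" using i by (auto simp: nphs_def F_def fcP fcQ)
  finally show ?thesis .
qed

lemma N_H: "N \<subseteq> H" by (auto simp: nphs_def)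

lemma N_closed:
  assumes "x \<in> N"
  shows "al M x \<in> N"
proof -
  have x: "x \<in> H" using assms by (simp add: nphs_def)
  have "al M x \<noteq> P i \<and> al M x \<noteq> Q i" if "i < k" for i
  proof -
    have "x \<noteq> P i \<and> x \<noteq> Q i" using assms that by (auto simp: nphs_def)
    then show ?thesis using al(3)[OF x] al(3)[OF PH[OF that]] by metis
  qed
  then show ?thesis using al(1)[OF x] by (auto simp: nphs_def)
qed

definition "rests = map (rest M) [0..<k]"

lemma distinct_concat_map:
  assumes "\<And>i. i < n \<Longrightarrow> distinct (w i)" "\<And>i j. i < n \<Longrightarrow> j < n \<Longrightarrow> i \<noteq> j \<Longrightarrow> set (w i) \<inter> set (w j) = {}"
  shows "distinct (concat (map w [0..<n]))"
  using assms
proof (induction n)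
  case (Suc n)
  then have "distinct (concat (map w [0..<n]))" by simp
  moreover have "set (w i) \<inter> set (w n) = {}" if "i < n" for i using Suc.prems(2)[of i n] that by simp
  ultimately show ?case using Suc.prems(1)[of n] by (fastforce)
qed simp

lemma rests_props: "length rests = k" "distinct (concat rests)" "set (concat rests) = N"
proof -
  show "length rests = k" by (simp add: rests_def)
  show "distinct (concat rests)" unfolding rests_def
  proof (rule distinct_concat_map)
    show "distinct (rest M i)" if "i < k" for i using face_word_props(1)[OF that] by simp
    show "set (rest M i) \<inter> set (rest M j) = {}" if "i < k" "j < k" "i \<noteq> j" for i j
      using set_rest that F_disj[of i j] by auto
  qed
  show "set (concat rests) = N" unfolding rests_def using set_rest N_H H_F by (auto simp: atLeast0LessThan)
qed

lemma card_N: "2 * np_edges k M = card N" "2 * card (edges M) = card N + 2 * k" "card H = card N + 2 * k"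
proof -
  have inv: "al M x \<in> N \<and> al M x \<noteq> x \<and> al M (al M x) = x" if "x \<in> N" for x
    using that N_H N_closed al by blast
  have fN: "finite N" using N_H finH finite_subset by blast
  have "edges M - plant_edges k M = {{x, al M x} | x. x \<in> N}"
  proof (intro set_eqI iffI)
    fix e assume e: "e \<in> edges M - plant_edges k M"
    then obtain x where x: "x \<in> H" "e = {x, al M x}" by (auto simp: edges_def)
    have "x \<noteq> P i \<and> x \<noteq> Q i" if "i < k" for i
      using e x that al(3)[OF PH] by (auto simp: plant_edges_def insert_commute)
    then have "x \<in> N" using x by (auto simp: nphs_def)
    then show "e \<in> {{x, al M x} | x. x \<in> N}" using x by blast
  next
    fix e assume "e \<in> {{x, al M x} | x. x \<in> N}"
    then obtain x where x: "x \<in> N" "e = {x, al M x}" by blast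
    then have "e \<in> edges M" using N_H by (auto simp: edges_def)
    moreover have "e \<notin> plant_edges k M"
    proof
      assume "e \<in> plant_edges k M"
      then obtain i where "i < k" "e = {P i, Q i}" by (auto simp: plant_edges_def)
      then show False using x by (auto simp: nphs_def)
    qed
    ultimately show "e \<in> edges M - plant_edges k M" by simp
  qed
  then show "2 * np_edges k M = card N" unfolding np_edges_def
    using card_involution_pairs[OF fN, of "al M"] inv by simp
  have PQ2: "inj_on P {..<k}" "inj_on (al M \<circ> P) {..<k}" 
    using fcP fcQ by (auto intro!: inj_on_inverseI[of _ "fc M"])
  have HN: "H = N \<union> (P ` {..<k} \<union> (al M \<circ> P) ` {..<k})"
    using PH QH by (auto simp: nphs_def)
  have "card H = card N + card (P ` {..<k} \<union> (al M \<circ> P) ` {..<k})"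
    by (subst HN, rule card_Un_disjoint) (use fN in \<open>auto simp: nphs_def\<close>)
  also have "card (P ` {..<k} \<union> (al M \<circ> P) ` {..<k}) = card (P ` {..<k}) + card ((al M \<circ> P) ` {..<k})"
    by (rule card_Un_disjoint) (use PQ in auto)
  finally show cH: "card H = card N + 2 * k" using card_image[OF PQ2(1)] card_image[OF PQ2(2)] by simp
  show "2 * card (edges M) = card N + 2 * k"
    using card_involution_pairs[OF finH, of "al M"] al cH by (simp add: edges_def)
qed

end

context planted
begin

lemma rests_nth: "i < k \<Longrightarrow> rests ! i = rest M i"
  by (simp add: rests_def)

lemma sig_props: "inj_on (sig M) H" "sig M ` H \<subseteq> H"
proof -
  have "inj_on (al M) H" using al(3) by (auto intro: inj_on_inverseI)
  then show "inj_on (sig M) H" unfolding sig_def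
    using ginj gH by (intro comp_inj_on) (auto intro: inj_on_subset)
  show "sig M ` H \<subseteq> H" using gH al(1) by (auto simp: sig_def)
qed

text \<open>The plants are \<open>k\<close> one-point vertices. Once they are removed, the
  predecessor of each plant points to the plant's partner, as it does in a word rooted at that
  partner.\<close>

lemma card_vertices:
  assumes h: "h \<in> isos (al M) N S"
  shows "card (vertices M) = k + nvi (map (map h) rests)"
proof -
  have hb: "bij_betw h N S" and ha: "\<And>x. x \<in> N \<Longrightarrow> h (al M x) = - h x" using h by (auto simp: isos_def)
  define R where "R = (\<lambda>y. (y, sig M y)) ` H"
  define qs where "qs = (al M \<circ> P) ` {..<k}"
  \<comment> \<open>The edge involution after removal of the plants: their partners, collected in
    \<open>qs\<close>, become fixed points and later the roots.\<close>
  define be where "be y = (if y \<in> qs then y else al M y)" for y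
  define cs where "cs = map (\<lambda>i. Q i # rest M i) [0..<k]"
  have "vertices M = (\<lambda>x. eqc R `` {x}) ` H"
    unfolding vertices_def R_def using orb_eq_eqc[OF finH sig_props] by auto
  then have 1: "card (vertices M) = ncomp H R" by (simp add: ncomp_def)
  have be_rest: "be y = al M y" if "i < k" "y \<in> set (rest M i)" for i y
    using that set_rest by (auto simp: be_def qs_def nphs_def)
  have fr: "(\<lambda>y. (y, sig M y)) ` F i = insert (P i, P i) (face_rel be (Q i # rest M i))" if i: "i < k" for i
  proof -
    have "(\<lambda>y. (y, sig M y)) ` F i = face_rel (al M) (P i # Q i # rest M i)"
      using face_word_props(3)[OF i, of "al M"] by (simp add: sig_def)
    also have "\<dots> = insert (P i, P i) (walk (al M) (Q i) (rest M i) (Q i))"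
      using al(3)[OF PH[OF i]] by simp
    also have "walk (al M) (Q i) (rest M i) (Q i) = walk be (Q i) (rest M i) (Q i)"
      by (rule walk_cong) (use be_rest[OF i] in simp)
    also have "\<dots> = face_rel be (Q i # rest M i)" using i by (simp add: be_def qs_def)
    finally show ?thesis .
  qed
  have "R = (\<Union>i<k. (\<lambda>y. (y, sig M y)) ` F i)" unfolding R_def H_F by blast
  also have "\<dots> = (\<Union>i<k. insert (P i, P i) (face_rel be (Q i # rest M i)))" using fr by auto
  also have "\<dots> = (\<lambda>x. (x, x)) ` P ` {..<k} \<union> vertex_rel be cs"
    unfolding vertex_rel_def cs_def by (auto simp: atLeast0LessThan)
  finally have R: "R = (\<lambda>x. (x, x)) ` P ` {..<k} \<union> vertex_rel be cs" .
  have scs: "set (concat cs) = qs \<union> N"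
    using rests_props(3) unfolding cs_def rests_def qs_def by auto
  have Hs: "H = P ` {..<k} \<union> set (concat cs)" unfolding scs using PH QH N_H
    by (auto simp: qs_def nphs_def)
  have becl: "be ` set (concat cs) \<subseteq> set (concat cs)" unfolding scs be_def using N_closed by auto
  have pdisj: "P ` {..<k} \<inter> set (concat cs) = {}" unfolding scs qs_def using PQ by (auto simp: nphs_def)
  have "ncomp H R = ncomp (P ` {..<k}) ((\<lambda>x. (x, x)) ` P ` {..<k}) + nvert be cs"
    unfolding R Hs nvert_def
    by (rule ncomp_Un) (use vertex_rel_sub[OF becl] pdisj in auto)
  also have "ncomp (P ` {..<k}) ((\<lambda>x. (x, x)) ` P ` {..<k}) = k"
  proof -
    have e: "eqc ((\<lambda>x. (x, x)) ` P ` {..<k}) `` {x} = {x}" for x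
    proof -
      have "y = x" if "(x, y) \<in> eqc ((\<lambda>x. (x, x)) ` P ` {..<k})" for y
        using that unfolding eqc_def by induction auto
      then show ?thesis by auto
    qed
    have "inj_on P {..<k}" using fcP by (auto intro!: inj_on_inverseI[of _ "fc M"])
    then show ?thesis unfolding ncomp_def e by (simp add: card_image inj_on_def)
  qed
  also have "nvert be cs = nvi (map (map h) rests)"
  proof -
    define h' where "h' y = (if y \<in> qs then Inr (fc M y) else Inl (h y))" for y
    have hq: "h' (Q i) = Inr i" if "i < k" for i using that fcQ by (auto simp: h'_def qs_def)
    have hN: "h' y = Inl (h y)" if "y \<in> N" for y using that by (auto simp: h'_def qs_def nphs_def)
    have "map (map h') cs = rooted 0 (map (map h) rests)"
      unfolding rooted_eq_map cs_def rests_def using hq hN set_rest by auto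
    moreover have "nvert (map_sum uminus id) (map (map h') cs) = nvert be cs"
    proof (rule nvert_relabel[OF becl])
      have "inj_on h N" using hb by (simp add: bij_betw_def)
      moreover have "inj_on (fc M) qs" using fcQ by (auto simp: inj_on_def qs_def)
      ultimately show "inj_on h' (set (concat cs))" unfolding scs h'_def inj_on_def by auto
      show "h' (be a) = map_sum uminus id (h' a)" if "a \<in> set (concat cs)" for a
      proof (cases "a \<in> qs")
        case True then show ?thesis by (simp add: be_def h'_def)
      next
        case False
        then have a: "a \<in> N" using that scs by auto
        then show ?thesis using hN[OF a] hN[OF N_closed[OF a]] ha[OF a] False by (simp add: be_def)
      qed
    qed
    ultimately show ?thesis by (simp add: nv_def)
  qed
  finally show ?thesis using 1 by simp
qed

definition faces_conn :: bool where
  "faces_conn \<longleftrightarrow> (\<forall>I\<subseteq>{..<k}. closed_under (al M) (\<Union>i\<in>I. F i) \<longrightarrow> I = {} \<or> I = {..<k})"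

lemma gam_F: "x \<in> F i \<Longrightarrow> gam M x \<in> F i"
proof -
  assume x: "x \<in> F i"
  then have xH: "x \<in> H" by (simp add: F_def)
  have "gam M x \<in> orb (gam M) x" using orb_I[of 1 "gam M" x] by simp
  then show ?thesis using fco[OF xH, of "gam M x"] gH xH x by (auto simp: F_def)
qed

text \<open>A union of faces closed under \<open>al M\<close> is closed under \<open>sig M\<close>,
  hence no edge leaves the vertices it contains. Conversely, the half-edges at vertices reachable
  from a given one are closed under \<open>al M\<close> and \<open>sig M\<close>, so also under
  \<open>gam M\<close>, and therefore form a union of faces.\<close>

lemma graph_connected_iff: "graph_connected M \<longleftrightarrow> faces_conn"
proof
  assume gc: "graph_connected M"
  show faces_conn unfolding faces_conn_def
  proof (intro allI impI)
    fix I assume I: "I \<subseteq> {..<k}" and c: "closed_under (al M) (\<Union>i\<in>I. F i)"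
    let ?T = "\<Union>i\<in>I. F i"
    have TH: "?T \<subseteq> H" by (auto simp: F_def)
    have sT: "sig M x \<in> ?T" if "x \<in> ?T" for x
      using that gam_F c unfolding closed_under_def sig_def by auto
    have oT: "orb (sig M) x \<subseteq> ?T" if "x \<in> ?T" for x
    proof
      fix y assume "y \<in> orb (sig M) x"
      then obtain j where "y = (sig M ^^ j) x" by (auto simp: orb_def)
      then show "y \<in> ?T" using funpow_closed[of "sig M" ?T x j] sT that by auto
    qed
    have orbx: "x \<in> orb (sig M) x" for x using orb_I[of 0 "sig M" x] by simp
    have adj: "v \<subseteq> ?T" if wv: "w \<subseteq> ?T" "(w, v) \<in> graph_adj M \<union> (graph_adj M)\<inverse>" for w v
    proof -
      obtain x where x: "x \<in> H" "(w = orb (sig M) x \<and> v = orb (sig M) (al M x)) \<or> (v = orb (sig M) x \<and> w = orb (sig M) (al M x))"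
        using wv(2) by (auto simp: graph_adj_def)
      then have "x \<in> ?T \<or> al M x \<in> ?T" using orbx wv(1) by blast
      then have "x \<in> ?T \<and> al M x \<in> ?T" using c al(3)[OF x(1)] unfolding closed_under_def by metis
      then show ?thesis using x(2) oT by blast
    qed
    show "I = {} \<or> I = {..<k}"
    proof (rule ccontr)
      assume "\<not> ?thesis"
      then obtain i j where ij: "i \<in> I" "j < k" "j \<notin> I" "i < k" using I by blast
      have "(orb (sig M) (P i), orb (sig M) (P j)) \<in> (graph_adj M \<union> (graph_adj M)\<inverse>)\<^sup>*"
        using gc PH ij unfolding graph_connected_def vertices_def by blast
      then have "orb (sig M) (P j) \<subseteq> ?T"
      proof induction
        case base
        show ?case using ij PH fcP by (intro oT) (auto simp: F_def)
      next
        case (step y z)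
        show ?case by (rule adj[OF step(3,2)])
      qed
      then have "P j \<in> ?T" using orbx by blast
      then show False using ij fcP by (auto simp: F_def)
    qed
  qed
next
  assume fcn: faces_conn
  show "graph_connected M" unfolding graph_connected_def
  proof (intro ballI)
    fix w v assume "w \<in> vertices M" "v \<in> vertices M"
    then obtain x y where x: "x \<in> H" "w = orb (sig M) x" and y: "y \<in> H" "v = orb (sig M) y"
      by (auto simp: vertices_def)
    let ?A = "(graph_adj M \<union> (graph_adj M)\<inverse>)\<^sup>*"
    define T where "T = {z \<in> H. (w, orb (sig M) z) \<in> ?A}"
    have aT: "al M z \<in> T" if "z \<in> T" for z
    proof -
      have "z \<in> H" using that by (simp add: T_def)
      then have "(orb (sig M) z, orb (sig M) (al M z)) \<in> graph_adj M" by (auto simp: graph_adj_def)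
      then show ?thesis using that al(1) unfolding T_def by (auto intro: rtrancl_into_rtrancl)
    qed
    have os: "orb (sig M) (sig M z) = orb (sig M) z" if "z \<in> H" for z
    proof -
      have "(z, sig M z) \<in> eqc ((\<lambda>y. (y, sig M y)) ` H)" using that by (intro eqc_base) auto
      moreover have "sig M z \<in> H" using that sig_props by blast
      ultimately show ?thesis
        using orb_eq_eqc[OF finH sig_props] that eqc_class_eq by metis
    qed
    have gT: "gam M z \<in> T" if z: "z \<in> T" for z
    proof -
      have zH: "z \<in> H" using z by (simp add: T_def)
      then have "sig M z \<in> T" using z os sig_props(2) by (auto simp: T_def)
      then have "al M (sig M z) \<in> T" by (rule aT)
      moreover have "gam M z \<in> H" using gH zH by blast
      ultimately show ?thesis by (simp add: sig_def al(3))
    qed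
    have FT: "F (fc M z) \<subseteq> T" if z: "z \<in> T" for z
    proof
      fix z' assume z': "z' \<in> F (fc M z)"
      then have "z' \<in> orb (gam M) z" using fco[of z z'] z by (auto simp: F_def T_def)
      then obtain j where "z' = (gam M ^^ j) z" by (auto simp: orb_def)
      then show "z' \<in> T" using funpow_closed[of "gam M" T z j] gT z by auto
    qed
    have T: "T = (\<Union>i\<in>fc M ` T. F i)" using FT by (auto simp: F_def T_def)
    have "closed_under (al M) (\<Union>i\<in>fc M ` T. F i)" unfolding T[symmetric] closed_under_def using aT by blast
    moreover have "fc M ` T \<subseteq> {..<k}" using fck by (auto simp: T_def)
    moreover have "x \<in> T" using x by (simp add: T_def)
    ultimately have "fc M ` T = {..<k}" using fcn unfolding faces_conn_def by blast
    then have "T = H" using T H_F by auto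
    then show "(w, v) \<in> ?A" using y by (auto simp: T_def)
  qed
qed

text \<open>A plant edge has both ends in one face, so closedness of a set of faces is decided by
  the np half-edges, which are the letters of the words.\<close>

lemma conn_rests:
  assumes h: "h \<in> isos (al M) N S"
  shows "conn uminus (map (map h) rests) \<longleftrightarrow> faces_conn"
proof -
  have hb: "inj_on h N" and ha: "\<And>x. x \<in> N \<Longrightarrow> h (al M x) = - h x" using h by (auto simp: isos_def bij_betw_def)
  have "cl (\<Union>i\<in>I. set (map (map h) rests ! i)) \<longleftrightarrow> closed_under (al M) (\<Union>i\<in>I. F i)" if I: "I \<subseteq> {..<k}" for I
  proof -
    have e: "(\<Union>i\<in>I. set (map (map h) rests ! i)) = h ` (\<Union>i\<in>I. F i \<inter> N)"
      using I set_rest rests_props(1) rests_nth by (auto simp: image_UN subset_iff)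
    show ?thesis unfolding e closed_under_def
    proof (intro iffI ballI)
      fix x assume c: "\<forall>x\<in>h ` (\<Union>i\<in>I. F i \<inter> N). - x \<in> h ` (\<Union>i\<in>I. F i \<inter> N)" and x: "x \<in> (\<Union>i\<in>I. F i)"
      then obtain i where i: "i \<in> I" "x \<in> F i" by blast
      show "al M x \<in> (\<Union>i\<in>I. F i)"
      proof (cases "x \<in> N")
        case True
        then have "h (al M x) \<in> h ` (\<Union>i\<in>I. F i \<inter> N)" using c i ha by force
        then obtain y where "y \<in> (\<Union>i\<in>I. F i \<inter> N)" "h (al M x) = h y" by blast
        moreover have "al M x \<in> N" by (rule N_closed[OF True])
        ultimately have "al M x = y" using inj_onD[OF hb, of "al M x" y] by blast
        then show ?thesis using \<open>y \<in> _\<close> by blast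
      next
        case False
        then obtain j where j: "j < k" "x = P j \<or> x = Q j" using i by (auto simp: nphs_def F_def)
        then have "j = i" using i fcP fcQ by (auto simp: F_def)
        then have "al M x \<in> F i" using j fcP fcQ PH QH al(3) by (auto simp: F_def)
        then show ?thesis using i by blast
      qed
    next
      fix x assume c: "\<forall>x\<in>\<Union>i\<in>I. F i. al M x \<in> (\<Union>i\<in>I. F i)" and x: "x \<in> h ` (\<Union>i\<in>I. F i \<inter> N)"
      then obtain y i where y: "x = h y" "i \<in> I" "y \<in> F i" "y \<in> N" by blast
      then have "al M y \<in> (\<Union>i\<in>I. F i \<inter> N)" using c N_closed by blast
      then show "- x \<in> h ` (\<Union>i\<in>I. F i \<inter> N)" using ha[OF y(4)] y(1) by (metis imageI)
    qed
  qed
  then show ?thesis unfolding conn_def faces_conn_def by (simp add: rests_props(1))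
qed

text \<open>All labelled tuples of one map over the alphabet \<open>S\<close>. This set serves as a
  fingerprint of the isomorphism class.\<close>

definition "words S = (\<lambda>h. map (map h) rests) ` isos (al M) N S"

lemma words_sub:
  assumes h: "h \<in> isos (al M) N S" and c: "card S = 2 * n"
  shows "map (map h) rests \<in> gmaps k S g \<longleftrightarrow> has_genus k M g \<and> np_edges k M = n"
proof -
  have hb: "inj_on h N" "h ` N = S" using h by (auto simp: isos_def bij_betw_def)
  have cN: "card N = 2 * n" using card_image[OF hb(1)] hb(2) c by simp
  have n: "np_edges k M = n" "card (edges M) = n + k" using card_N cN by auto
  have cm: "concat (map (map h) rests) = map h (concat rests)" by (simp add: map_concat)
  have 1: "distinct (concat (map (map h) rests))" "set (concat (map (map h) rests)) = S" "length (map (map h) rests) = k"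
    unfolding cm using rests_props hb by (auto simp: distinct_map)
  show ?thesis unfolding gmaps_def has_genus_def graph_connected_iff conn_rests[OF h, symmetric] card_vertices[OF h] n
    using 1 c by auto
qed

text \<open>The words list every np half-edge, so a labelling can be read back from its tuple. This
  is where the absence of automorphisms enters.\<close>

lemma words_inj: "inj_on (\<lambda>h. map (map h) rests) (isos (al M) N S)"
proof (rule inj_onI)
  fix h h' assume h: "h \<in> isos (al M) N S" "h' \<in> isos (al M) N S" "map (map h) rests = map (map h') rests"
  have "map h (concat rests) = map h' (concat rests)" using arg_cong[OF h(3), of concat] by (simp add: map_concat)
  then have "\<forall>x\<in>N. h x = h' x" using rests_props(3) map_eq_conv by metis
  then show "h = h'" using h(1,2) by (auto simp: isos_def intro: extensionalityI)
qed

end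

section \<open>Counting isomorphism classes by labelled words\<close>

text \<open>A fixed half-edge \<open>x\<close> may receive any of the 2n+2 labels; the label of its
  partner is then forced, and a labelling of the remaining n edges is left.\<close>

lemma card_isos:
  assumes "finite N" "\<And>x. x \<in> N \<Longrightarrow> f x \<in> N \<and> f x \<noteq> x \<and> f (f x) = x" "symm S" "card N = 2 * n" "card S = 2 * n"
  shows "finite (isos f N S) \<and> card (isos f N S) = 2 ^ n * fact n"
  using assms
proof (induction n arbitrary: N S)
  case 0
  then have "N = {}" "S = {}" by (simp_all add: symm_def)
  then have "isos f N S = {\<lambda>_. undefined}" by (auto simp: isos_def bij_betw_def)
  then show ?case by simp
next
  case (Suc n)
  obtain x where x: "x \<in> N" using Suc.prems(4) by fastforce
  define N' where "N' = N - {x, f x}"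
  note fx = Suc.prems(2)[OF x]
  have N: "N = insert x (insert (f x) N')" "x \<notin> N'" "f x \<notin> N'" using x fx by (auto simp: N'_def)
  have cN': "finite N'" "card N' = 2 * n"
  proof -
    show f: "finite N'" using Suc.prems(1) by (simp add: N'_def)
    have "card (insert x (insert (f x) N')) = card N' + 2" using N(2,3) fx f by (auto simp: card_insert_if)
    then show "card N' = 2 * n" using Suc.prems(4) unfolding N(1)[symmetric] by simp
  qed
  have inv': "f z \<in> N' \<and> f z \<noteq> z \<and> f (f z) = z" if "z \<in> N'" for z
  proof -
    have z: "z \<in> N" "z \<noteq> x" "z \<noteq> f x" using that by (auto simp: N'_def)
    have "f z \<noteq> x" "f z \<noteq> f x" using Suc.prems(2)[OF z(1)] fx z by metis+
    then show ?thesis using Suc.prems(2)[OF z(1)] by (simp add: N'_def)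
  qed
  note rm = symm_remove[OF Suc.prems(3)]
  have IH: "finite (isos f N' (S - {y, - y})) \<and> card (isos f N' (S - {y, - y})) = 2 ^ n * fact n" if "y \<in> S" for y
    by (rule Suc.IH[OF cN'(1) inv' rm(1)[OF that] cN'(2)]) (use rm(2)[OF that] Suc.prems(5) in auto)
  have ex: "(h(x := y, f x := - y)) \<in> isos f N S" if "y \<in> S" "h \<in> isos f N' (S - {y, - y})" for y h
  proof -
    let ?h = "h(x := y, f x := - y)"
    have hb: "bij_betw h N' (S - {y, - y})" and hf: "\<And>z. z \<in> N' \<Longrightarrow> h (f z) = - h z" and he: "h \<in> extensional N'"
      using that(2) by (auto simp: isos_def)
    have h': "?h z = h z" if "z \<in> N'" for z using that N(2,3) by auto
    have "bij_betw ?h N' (S - {y, - y})" using hb h' by (simp cong: bij_betw_cong)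
    moreover have "bij_betw ?h {x, f x} {y, - y}" using fx rm(3)[OF that(1)] by (auto simp: bij_betw_def)
    ultimately have "bij_betw ?h (N' \<union> {x, f x}) ((S - {y, - y}) \<union> {y, - y})"
      by (rule bij_betw_combine) auto
    moreover have "N' \<union> {x, f x} = N" "(S - {y, - y}) \<union> {y, - y} = S" using N(1) rm(4)[OF that(1)] that(1) by auto
    moreover have "?h (f z) = - ?h z" if z: "z \<in> N" for z
    proof (cases "z \<in> N'")
      case True
      then show ?thesis using hf inv' h' by simp
    next
      case False
      then have "z = x \<or> z = f x" using z N(1) by auto
      then show ?thesis using fx by auto
    qed
    moreover have "?h \<in> extensional N" using he N(1) by (auto simp: extensional_def)
    ultimately show ?thesis by (simp add: isos_def)
  qed
  have bb: "bij_betw (\<lambda>(y, h). h(x := y, f x := - y)) (SIGMA y:S. isos f N' (S - {y, - y})) (isos f N S)"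
  proof (rule bij_betw_byWitness[where f' = "\<lambda>h. (h x, restrict h N')"])
    show "\<forall>p\<in>SIGMA y:S. isos f N' (S - {y, - y}). (\<lambda>h. (h x, restrict h N')) ((\<lambda>(y, h). h(x := y, f x := - y)) p) = p"
    proof
      fix p assume p: "p \<in> (SIGMA y:S. isos f N' (S - {y, - y}))"
      obtain y h where yh: "p = (y, h)" by (cases p)
      have he: "h \<in> extensional N'" using p by (auto simp: yh isos_def)
      have "restrict (h(x := y, f x := - y)) N' = h"
        using he N(2,3) by (auto simp: fun_eq_iff restrict_def extensional_def)
      then show "(\<lambda>h. (h x, restrict h N')) ((\<lambda>(y, h). h(x := y, f x := - y)) p) = p"
        using fx by (auto simp: yh)
    qed
    show "\<forall>h\<in>isos f N S. (\<lambda>(y, h). h(x := y, f x := - y)) (h x, restrict h N') = h"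
    proof
      fix h assume h: "h \<in> isos f N S"
      then have "h (f x) = - h x" "h \<in> extensional N" using x by (auto simp: isos_def)
      then show "(\<lambda>(y, h). h(x := y, f x := - y)) (h x, restrict h N') = h"
        using N(1) by (auto simp: fun_eq_iff restrict_def extensional_def)
    qed
    show "(\<lambda>(y, h). h(x := y, f x := - y)) ` (SIGMA y:S. isos f N' (S - {y, - y})) \<subseteq> isos f N S"
      using ex by auto
    show "(\<lambda>h. (h x, restrict h N')) ` isos f N S \<subseteq> (SIGMA y:S. isos f N' (S - {y, - y}))"
    proof
      fix p assume "p \<in> (\<lambda>h. (h x, restrict h N')) ` isos f N S"
      then obtain h where p: "p = (h x, restrict h N')" and h: "h \<in> isos f N S" by blast
      have hb: "bij_betw h N S" and hf: "\<And>z. z \<in> N \<Longrightarrow> h (f z) = - h z" using h by (auto simp: isos_def)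
      have "bij_betw h (N - {x, f x}) (S - h ` {x, f x})"
        using hb x fx unfolding bij_betw_def by (auto simp: inj_on_def)
      then have "bij_betw h N' (S - {h x, - h x})" using hf[OF x] by (simp add: N'_def)
      moreover have "bij_betw (restrict h N') N' (S - {h x, - h x}) = bij_betw h N' (S - {h x, - h x})"
        by (rule bij_betw_cong) simp
      ultimately have "bij_betw (restrict h N') N' (S - {h x, - h x})" by simp
      moreover have "restrict h N' (f z) = - restrict h N' z" if "z \<in> N'" for z
        using that inv'[OF that] hf[of z] N(1) by auto
      ultimately have "restrict h N' \<in> isos f N' (S - {h x, - h x})" by (simp add: isos_def)
      then show "p \<in> (SIGMA y:S. isos f N' (S - {y, - y}))" using p hb x by (auto simp: bij_betw_def)
    qed
  qed
  have fS: "finite S" using Suc.prems(3) by (simp add: symm_def)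
  have cc: "card (SIGMA y:S. isos f N' (S - {y, - y})) = 2 ^ Suc n * fact (Suc n)"
    using IH fS Suc.prems(5) by (simp add: card_SigmaI algebra_simps)
  have ff: "finite (SIGMA y:S. isos f N' (S - {y, - y}))" using IH fS by auto
  show ?case
    using cc ff unfolding bij_betw_same_card[OF bb] bij_betw_finite[OF bb] by (rule conjI[rotated])
qed

lemma (in planted) card_words:
  assumes "symm S" "card S = 2 * n" "np_edges k M = n"
  shows "card (words S) = 2 ^ n * fact n" "words S \<noteq> {}"
proof -
  have "card (isos (al M) N S) = 2 ^ n * fact n"
    using card_isos[OF _ _ assms(1) _ assms(2), of N "al M"] N_H N_closed al finH card_N(1) assms(3)
    by (metis finite_subset subset_iff)
  then show *: "card (words S) = 2 ^ n * fact n" unfolding words_def using card_image[OF words_inj] by metis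
  show "words S \<noteq> {}"
  proof
    assume "words S = {}"
    then show False using * by simp
  qed
qed

section \<open>Isomorphic maps and common labelled words\<close>

lemma funpow_eq_iff_mod:
  assumes "finite H" "inj_on f H" "f ` H \<subseteq> H" "x \<in> H"
  shows "(f ^^ i) x = (f ^^ j) x \<longleftrightarrow> i mod card (orb f x) = j mod card (orb f x)"
proof -
  let ?L = "card (orb f x)"
  note o = orbit_list[OF assms]
  have i: "(f ^^ m) x = (f ^^ (m mod ?L)) x" for m using funpow_mod_eq[OF o(1)] by simp
  have "inj_on (\<lambda>j. (f ^^ j) x) {0..<?L}" using o(3) by (simp add: distinct_map)
  then have "(f ^^ (i mod ?L)) x = (f ^^ (j mod ?L)) x \<longleftrightarrow> i mod ?L = j mod ?L"
    using o(2) by (auto dest: inj_onD)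
  then show ?thesis using i by metis
qed

lemma map_iso_sym:
  assumes "planted k M" "map_iso k M M'"
  shows "map_iso k M' M"
proof -
  interpret planted k M by fact
  obtain p where p: "bij_betw p (hs M) (hs M')" "\<And>x. x \<in> hs M \<Longrightarrow> p (al M x) = al M' (p x)"
    "\<And>x. x \<in> hs M \<Longrightarrow> p (gam M x) = gam M' (p x)" "\<And>x. x \<in> hs M \<Longrightarrow> fc M' (p x) = fc M x" "\<And>i. i < k \<Longrightarrow> p (pl M i) = pl M' i"
    using assms(2) unfolding map_iso_def by blast
  define q where "q = inv_into (hs M) p"
  have q: "q y \<in> hs M" "p (q y) = y" if "y \<in> hs M'" for y
    using p(1) that unfolding q_def bij_betw_def by (auto simp: inv_into_into f_inv_into_f)
  have qp: "q (p x) = x" if "x \<in> hs M" for x using p(1) that unfolding q_def bij_betw_def by simp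
  show ?thesis unfolding map_iso_def
  proof (intro exI[of _ q] conjI ballI allI impI)
    show "bij_betw q (hs M') (hs M)" unfolding q_def by (rule bij_betw_inv_into[OF p(1)])
    fix y assume y: "y \<in> hs M'"
    show "q (al M' y) = al M (q y)" using p(2)[OF q(1)[OF y]] qp[OF al(1)[OF q(1)[OF y]]] q(2)[OF y] by simp
    show "q (gam M' y) = gam M (q y)"
      using p(3)[OF q(1)[OF y]] qp[of "gam M (q y)"] gH q[OF y] by auto
    show "fc M (q y) = fc M' y" using p(4)[OF q(1)[OF y]] q(2)[OF y] by simp
  next
    fix i assume "i < k"
    then show "q (pl M' i) = pl M i" using p(5) qp PH by metis
  qed
qed

lemma map_iso_trans:
  assumes "map_iso k M M'" "map_iso k M' M''"
  shows "map_iso k M M''"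
proof -
  obtain p where p: "bij_betw p (hs M) (hs M')" "\<And>x. x \<in> hs M \<Longrightarrow> p (al M x) = al M' (p x)"
    "\<And>x. x \<in> hs M \<Longrightarrow> p (gam M x) = gam M' (p x)" "\<And>x. x \<in> hs M \<Longrightarrow> fc M' (p x) = fc M x" "\<And>i. i < k \<Longrightarrow> p (pl M i) = pl M' i"
    using assms(1) unfolding map_iso_def by blast
  obtain q where q: "bij_betw q (hs M') (hs M'')" "\<And>x. x \<in> hs M' \<Longrightarrow> q (al M' x) = al M'' (q x)"
    "\<And>x. x \<in> hs M' \<Longrightarrow> q (gam M' x) = gam M'' (q x)" "\<And>x. x \<in> hs M' \<Longrightarrow> fc M'' (q x) = fc M' x" "\<And>i. i < k \<Longrightarrow> q (pl M' i) = pl M'' i"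
    using assms(2) unfolding map_iso_def by blast
  have "p x \<in> hs M'" if "x \<in> hs M" for x using p(1) that by (auto simp: bij_betw_def)
  then show ?thesis unfolding map_iso_def
    by (intro exI[of _ "q \<circ> p"]) (auto simp: p q intro: bij_betw_trans[OF p(1) q(1)])
qed

text \<open>Labellings of \<open>M'\<close> are pulled back along the isomorphism, which respects
  positions in the faces because it preserves the plants. Symmetry of \<open>map_iso\<close> later
  gives the other inclusion.\<close>

lemma words_iso_sub:
  assumes "planted k M" "planted k M'" "map_iso k M M'"
  shows "planted.words k M' S \<subseteq> planted.words k M S"
proof -
  interpret A: planted k M by fact
  interpret B: planted k M' by fact
  obtain p where p: "bij_betw p (hs M) (hs M')" "\<And>x. x \<in> hs M \<Longrightarrow> p (al M x) = al M' (p x)"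
    "\<And>x. x \<in> hs M \<Longrightarrow> p (gam M x) = gam M' (p x)" "\<And>i. i < k \<Longrightarrow> p (pl M i) = pl M' i"
    using assms(3) unfolding map_iso_def by blast
  have pi: "inj_on p (hs M)" using p(1) by (simp add: bij_betw_def)
  have pw: "(gam M' ^^ j) (pl M' i) = p ((gam M ^^ j) (pl M i))" if "i < k" for i j
    by (induction j) (use p(3,4) that funpow_closed[OF A.gH A.PH[OF that]] in auto)
  have "orb (gam M') (pl M' i) = p ` orb (gam M) (pl M i)" if "i < k" for i
    using pw[OF that] unfolding orb_def by (auto simp: image_iff)
  then have "card (orb (gam M') (pl M' i)) = card (orb (gam M) (pl M i))" if "i < k" for i
    using that card_image[OF inj_on_subset[OF pi A.orbit(5)[OF A.PH[OF that]]]] by simp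
  then have rest: "rest M' i = map p (rest M i)" if "i < k" for i
    unfolding rest_def using that pw by simp
  have rests: "B.rests = map (map p) A.rests" unfolding A.rests_def B.rests_def using rest by simp
  have N': "B.N = p ` A.N" unfolding B.rests_props(3)[symmetric] A.rests_props(3)[symmetric] rests by auto
  show ?thesis
  proof
    fix ws assume "ws \<in> B.words S"
    then obtain h where h: "h \<in> isos (al M') B.N S" and ws: "ws = map (map h) B.rests" by (auto simp: B.words_def)
    let ?h = "restrict (h \<circ> p) A.N"
    have "bij_betw p A.N B.N" unfolding N' using inj_on_subset[OF pi A.N_H] by (simp add: bij_betw_def)
    then have "bij_betw (h \<circ> p) A.N S" using h by (auto simp: isos_def intro: bij_betw_trans)
    then have "bij_betw ?h A.N S" by (simp cong: bij_betw_cong)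
    moreover have "?h (al M x) = - ?h x" if "x \<in> A.N" for x
    proof -
      have "p x \<in> B.N" using that N' by simp
      then show ?thesis using that A.N_closed[OF that] p(2)[of x] A.N_H h by (auto simp: isos_def)
    qed
    ultimately have "?h \<in> isos (al M) A.N S" by (simp add: isos_def)
    moreover have "map (map ?h) A.rests = ws"
    proof -
      have "set w \<subseteq> A.N" if "w \<in> set A.rests" for w using that A.rests_props(3) by auto
      then show ?thesis unfolding ws rests by (auto simp: subset_iff)
    qed
    ultimately show "ws \<in> A.words S" unfolding A.words_def by blast
  qed
qed

text \<open>Two maps with a common tuple are matched by position within each face. This respects
  faces and plants by construction; equal labels at equal positions make it respect the
  edges.\<close>

lemma words_iso_conv:
  assumes "planted k M" "planted k M'" "ws \<in> planted.words k M S" "ws \<in> planted.words k M' S"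
  shows "map_iso k M M'"
proof -
  interpret A: planted k M by fact
  interpret B: planted k M' by fact
  obtain h where h: "h \<in> isos (al M) A.N S" "ws = map (map h) A.rests" using assms(3) by (auto simp: A.words_def)
  obtain h' where h': "h' \<in> isos (al M') B.N S" "ws = map (map h') B.rests" using assms(4) by (auto simp: B.words_def)
  have hr: "map h (rest M i) = map h' (rest M' i)" if "i < k" for i
    using arg_cong[OF h(2)[unfolded h'(2)], of "\<lambda>w. w ! i"] that
    by (simp add: A.rests_nth B.rests_nth A.rests_props(1) B.rests_props(1))
  define L where "L i = card (orb (gam M) (pl M i))" for i
  \<comment> \<open>Equal lengths of the words give equal lengths of the faces only because
    \<open>card_orb_ge\<close> makes the subtraction of 2 exact.\<close>
  have L': "card (orb (gam M') (pl M' i)) = L i" if "i < k" for i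
    using arg_cong[OF hr[OF that], of length] A.card_orb_ge[OF that] B.card_orb_ge[OF that] by (simp add: rest_def L_def)
  have L2: "2 \<le> L i" if "i < k" for i using A.card_orb_ge[OF that] by (simp add: L_def)
  have eqA: "(gam M ^^ a) (pl M i) = (gam M ^^ c) (pl M i) \<longleftrightarrow> a mod L i = c mod L i" if "i < k" for i a c
    unfolding L_def by (rule funpow_eq_iff_mod[OF A.finH A.ginj A.gH A.PH[OF that]])
  have eqB: "(gam M' ^^ a) (pl M' i) = (gam M' ^^ c) (pl M' i) \<longleftrightarrow> a mod L i = c mod L i" if "i < k" for i a c
    using funpow_eq_iff_mod[OF B.finH B.ginj B.gH B.PH[OF that]] L'[OF that] by simp
  \<comment> \<open>The half-edge at position j goes to position j of the same face. The least
    position serves as a representative; any other agrees modulo the common length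
    \<open>L\<close>.\<close>
  define p where "p y = (gam M' ^^ (LEAST j. (gam M ^^ j) (pl M (fc M y)) = y)) (pl M' (fc M y))" for y
  have fcA: "fc M ((gam M ^^ j) (pl M i)) = i" "(gam M ^^ j) (pl M i) \<in> hs M" if "i < k" for i j
    using A.fibre[OF that] orb_I[of j "gam M" "pl M i"] by (auto simp: A.F_def)
  have fcB: "fc M' ((gam M' ^^ j) (pl M' i)) = i" "(gam M' ^^ j) (pl M' i) \<in> hs M'" if "i < k" for i j
    using B.fibre[OF that] orb_I[of j "gam M'" "pl M' i"] by (auto simp: B.F_def)
  have p: "p ((gam M ^^ j) (pl M i)) = (gam M' ^^ j) (pl M' i)" if "i < k" for i j
  proof -
    let ?y = "(gam M ^^ j) (pl M i)"
    have "(gam M ^^ (LEAST m. (gam M ^^ m) (pl M i) = ?y)) (pl M i) = ?y" by (rule LeastI[of _ j]) simp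
    then show ?thesis unfolding p_def fcA(1)[OF that] using eqA[OF that] eqB[OF that] by simp
  qed
  have exA: "\<exists>i j. i < k \<and> y = (gam M ^^ j) (pl M i)" if "y \<in> hs M" for y
  proof -
    have "y \<in> orb (gam M) (pl M (fc M y))" using A.fibre[OF A.fck[OF that]] that by (simp add: A.F_def)
    then show ?thesis using A.fck[OF that] unfolding orb_def by blast
  qed
  have exB: "\<exists>i j. i < k \<and> y = (gam M' ^^ j) (pl M' i)" if "y \<in> hs M'" for y
  proof -
    have "y \<in> orb (gam M') (pl M' (fc M' y))" using B.fibre[OF B.fck[OF that]] that by (simp add: B.F_def)
    then show ?thesis using B.fck[OF that] unfolding orb_def by blast
  qed
  have pN: "p y \<in> B.N \<and> h' (p y) = h y" if "y \<in> A.N" for y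
  proof -
    have y: "y \<in> hs M" using that A.N_H by blast
    define i where "i = fc M y"
    have i: "i < k" using A.fck[OF y] by (simp add: i_def)
    have "y \<in> set (rest M i)" using A.set_rest[OF i] that y by (simp add: A.F_def i_def)
    then obtain m where m: "m < length (rest M i)" "y = rest M i ! m" by (auto simp: in_set_conv_nth)
    have len: "length (rest M i) = L i - 2" "length (rest M' i) = L i - 2" using L'[OF i] by (simp_all add: rest_def L_def)
    have "y = (gam M ^^ (2 + m)) (pl M i)" using m unfolding rest_def by simp
    then have "p y = (gam M' ^^ (2 + m)) (pl M' i)" by (simp only: p[OF i])
    also have "\<dots> = rest M' i ! m" using m(1) len unfolding rest_def by simp
    finally have py: "p y = rest M' i ! m" .
    have m': "m < length (rest M' i)" using m(1) len by simp
    have "h (rest M i ! m) = h' (rest M' i ! m)" using hr[OF i] m(1) m' by (metis nth_map)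
    then have "h' (p y) = h y" using py m(2) by simp
    moreover have "p y \<in> B.N" using py m' B.set_rest[OF i] nth_mem by fastforce
    ultimately show ?thesis by simp
  qed
  show ?thesis unfolding map_iso_def
  proof (intro exI[of _ p] conjI ballI allI impI)
    show "bij_betw p (hs M) (hs M')" unfolding bij_betw_def
    proof
      show "inj_on p (hs M)"
      proof (rule inj_onI)
        fix x y assume xy: "x \<in> hs M" "y \<in> hs M" "p x = p y"
        obtain i j where x: "i < k" "x = (gam M ^^ j) (pl M i)" using exA[OF xy(1)] by blast
        obtain i' j' where y: "i' < k" "y = (gam M ^^ j') (pl M i')" using exA[OF xy(2)] by blast
        have e: "(gam M' ^^ j) (pl M' i) = (gam M' ^^ j') (pl M' i')" using xy(3) p x y by simp
        then have "i = i'" using fcB(1)[OF x(1), of j] fcB(1)[OF y(1), of j'] by simp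
        then show "x = y" using e eqA[OF x(1)] eqB[OF x(1)] x y by simp
      qed
      show "p ` hs M = hs M'"
      proof (intro set_eqI iffI)
        fix z assume "z \<in> p ` hs M"
        then obtain y where y: "y \<in> hs M" "z = p y" by blast
        then show "z \<in> hs M'" using exA[OF y(1)] p fcB(2) by auto
      next
        fix z assume "z \<in> hs M'"
        then obtain i j where z: "i < k" "z = (gam M' ^^ j) (pl M' i)" using exB by blast
        then show "z \<in> p ` hs M" using p[OF z(1), of j] fcA(2)[OF z(1), of j] by (metis imageI)
      qed
    qed
    fix x assume x: "x \<in> hs M"
    obtain i j where ij: "i < k" "x = (gam M ^^ j) (pl M i)" using exA[OF x] by blast
    show "p (gam M x) = gam M' (p x)" using p[OF ij(1), of "Suc j"] p[OF ij(1), of j] ij(2) by simp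
    show "fc M' (p x) = fc M x" using ij p fcA(1) fcB(1) by simp
    have pP: "p (pl M m) = pl M' m" if "m < k" for m using p[OF that, of 0] by simp
    have pQ: "p (al M (pl M m)) = al M' (pl M' m)" if "m < k" for m
      using p[OF that, of 1] A.gP[OF that] B.gP[OF that] by simp
    show "p (al M x) = al M' (p x)"
    proof (cases "x \<in> A.N")
      case True
      have 1: "al M x \<in> A.N" by (rule A.N_closed[OF True])
      have 2: "al M' (p x) \<in> B.N" using B.N_closed pN[OF True] by blast
      \<comment> \<open>Both sides of the goal are compared through their labels, which suffices
        because \<open>h'\<close> is injective on \<open>B.N\<close>.\<close>
      have "h' (p (al M x)) = h (al M x)" using pN[OF 1] by simp
      also have "\<dots> = - h x" using h(1) True by (simp add: isos_def)
      also have "\<dots> = h' (al M' (p x))" using h'(1) pN[OF True] by (simp add: isos_def)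
      finally show ?thesis using h'(1) pN[OF 1] 2 unfolding isos_def bij_betw_def
        by (auto dest: inj_onD)
    next
      case False
      then obtain m where m: "m < k" "x = pl M m \<or> x = al M (pl M m)" using x by (auto simp: nphs_def)
      then show ?thesis using pP pQ A.al(3)[OF A.PH] B.al(3)[OF B.PH] by auto
    qed
  next
    fix i assume "i < k" then show "p (pl M i) = pl M' i" using p[of i 0] by simp
  qed
qed


text \<open>Half-edges of a \<open>pmap\<close> are natural numbers, so letters, plants (tag
  \<open>True\<close>) and partners of plants (tag \<open>False\<close>) are encoded into nat. Face
  i is the list \<open>W i\<close> read cyclically.\<close>

lemma exists_planted:
  assumes S: "symm S" and ws: "length ws = k" "distinct (concat ws)" "set (concat ws) = S"
  shows "\<exists>M. planted k M \<and> ws \<in> planted.words k M S"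
proof -
  define enc where "enc = (to_nat :: int + nat \<times> bool \<Rightarrow> nat)"
  define dec where "dec = (from_nat :: nat \<Rightarrow> int + nat \<times> bool)"
  have dec [simp]: "dec (enc z) = z" for z by (simp add: enc_def dec_def)
  have enc_eq [simp]: "enc y = enc z \<longleftrightarrow> y = z" for y z by (metis dec)
  define W where "W i = enc (Inr (i, True)) # enc (Inr (i, False)) # map (enc \<circ> Inl) (ws ! i)" for i
  define I where "I = (SIGMA i:{..<k}. {..<length (W i)})"
  have WI: "(i, j) \<in> I \<longleftrightarrow> i < k \<and> j < length (W i)" for i j by (simp add: I_def)
  have wsi: "distinct (ws ! i)" "set (ws ! i) \<subseteq> S" if "i < k" for i
    using ws that by (auto simp: distinct_concat_iff)
  have disj: "set (ws ! i) \<inter> set (ws ! j) = {}" if "i < k" "j < k" "i \<noteq> j" for i j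
    using that ws
  proof (induction ws arbitrary: i j k S)
    case (Cons w ws)
    show ?case
    proof (cases i)
      case 0
      then show ?thesis using Cons.prems by (cases j) (auto, metis UN_I disjoint_iff nth_mem)
    next
      case i: (Suc i')
      show ?thesis
      proof (cases j)
        case 0
        then show ?thesis using Cons.prems i by (auto, metis UN_I disjoint_iff nth_mem)
      next
        case (Suc j')
        then show ?thesis using Cons.IH[of i' "length ws" j'] Cons.prems i by auto
      qed
    qed
  qed simp
  have dW: "distinct (W i)" if "i < k" for i
    using wsi[OF that] unfolding W_def by (auto simp: distinct_map inj_on_def)
  have dWW: "set (W i) \<inter> set (W j) = {}" if "i < k" "j < k" "i \<noteq> j" for i j
    using disj[OF that] that unfolding W_def by auto
  have injW: "inj_on (\<lambda>(i, j). W i ! j) I"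
  proof (rule inj_onI)
    fix a c assume ac: "a \<in> I" "c \<in> I" "(\<lambda>(i, j). W i ! j) a = (\<lambda>(i, j). W i ! j) c"
    obtain i j i' j' where e: "a = (i, j)" "c = (i', j')" by (cases a; cases c)
    have l: "i < k" "j < length (W i)" "i' < k" "j' < length (W i')" "W i ! j = W i' ! j'" using ac e WI by auto
    have "i = i'" using dWW[OF l(1,3)] l nth_mem by (metis disjoint_iff)
    then show "a = c" using l dW nth_eq_iff_index_eq e by blast
  qed
  define pos where "pos = inv_into I (\<lambda>(i, j). W i ! j)"
  have pos: "pos (W i ! j) = (i, j)" if "i < k" "j < length (W i)" for i j
    using inv_into_f_f[OF injW, of "(i, j)"] that WI by (simp add: pos_def)
  define ga where "ga y = (case pos y of (i, j) \<Rightarrow> W i ! (Suc j mod length (W i)))" for y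
  define la where "la y = (case dec y of Inl z \<Rightarrow> enc (Inl (- z)) | Inr (i, c) \<Rightarrow> enc (Inr (i, \<not> c)))" for y
  define M where "M = \<lparr>hs = (\<Union>i<k. set (W i)), al = la, gam = ga, fc = fst \<circ> pos, pl = (\<lambda>i. enc (Inr (i, True)))\<rparr>"
  have sel: "hs M = (\<Union>i<k. set (W i))" "al M = la" "gam M = ga" "fc M = fst \<circ> pos" "pl M i = enc (Inr (i, True))" for i
    by (simp_all add: M_def)
  have len: "2 \<le> length (W i)" for i by (simp add: W_def)
  have Wne: "W i \<noteq> []" for i by (simp add: W_def)
  have modl: "m mod length (W i) < length (W i)" for m i by (rule mod_less_divisor) (simp add: W_def)
  have ga: "ga (W i ! j) = W i ! (Suc j mod length (W i))" if "i < k" "j < length (W i)" for i j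
    using pos[OF that] by (simp add: ga_def)
  have gap: "(ga ^^ m) (W i ! j) = W i ! ((j + m) mod length (W i))" if "i < k" "j < length (W i)" for i j m
  proof (induction m)
    case (Suc m)
    have "(j + m) mod length (W i) < length (W i)" by (rule modl)
    then show ?case using Suc ga[OF that(1)] by (simp add: mod_Suc_eq)
  qed (use that in simp)
  have orbW: "orb ga (W i ! j) = set (W i)" if ij: "i < k" "j < length (W i)" for i j
  proof (intro set_eqI iffI)
    fix y assume "y \<in> orb ga (W i ! j)"
    then obtain m where "y = (ga ^^ m) (W i ! j)" by (auto simp: orb_def)
    moreover have "(j + m) mod length (W i) < length (W i)" by (rule modl)
    ultimately show "y \<in> set (W i)" using gap[OF ij] nth_mem by metis
  next
    fix y assume "y \<in> set (W i)"
    then obtain l where l: "l < length (W i)" "y = W i ! l" by (auto simp: in_set_conv_nth)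
    have "(ga ^^ (length (W i) - j + l)) (W i ! j) = W i ! ((length (W i) + l) mod length (W i))"
      using gap[OF ij] ij by simp
    then have "y = (ga ^^ (length (W i) - j + l)) (W i ! j)" using l by simp
    then show "y \<in> orb ga (W i ! j)" using orb_I by metis
  qed
  have inH: "y \<in> hs M \<longleftrightarrow> (\<exists>i j. i < k \<and> j < length (W i) \<and> y = W i ! j)" for y
    unfolding sel by (auto simp: in_set_conv_nth)
  have H2: "hs M = enc ` (Inl ` S \<union> Inr ` ({..<k} \<times> UNIV))"
  proof -
    have "set ws = (!) ws ` {..<k}" using ws(1) by (auto simp: set_conv_nth)
    then have "S = (\<Union>i<k. set (ws ! i))" using ws(3) by (simp add: image_image)
    then show ?thesis unfolding sel W_def by (auto simp: UNIV_bool)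
  qed
  have fH: "finite (hs M)" by (simp add: sel)
  have la: "la y \<in> hs M \<and> la y \<noteq> y \<and> la (la y) = y" if y: "y \<in> hs M" for y
  proof -
    from y consider z where "z \<in> S" "y = enc (Inl z)" | i c where "i < k" "y = enc (Inr (i, c))" unfolding H2 by auto
    then show ?thesis
    proof cases
      case 1
      then have "- z \<in> S" "z \<noteq> 0" using S by (auto simp: symm_def closed_under_def)
      then show ?thesis unfolding H2 using 1 by (auto simp: la_def)
    next
      case 2
      then show ?thesis unfolding H2 by (auto simp: la_def)
    qed
  qed
  have "even (card (hs M))" using arg_cong[OF card_involution_pairs[OF fH la], of even] by simp
  moreover have "bij_betw ga (hs M) (hs M)"
  proof -
    have img: "ga ` hs M = hs M"
    proof (intro set_eqI iffI)
      fix y assume "y \<in> ga ` hs M"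
      then obtain i j where ij: "i < k" "j < length (W i)" "y = ga (W i ! j)" by (auto simp: inH)
      have "Suc j mod length (W i) < length (W i)" by (rule modl)
      then show "y \<in> hs M" using ga[OF ij(1,2)] ij(1,3) unfolding inH by metis
    next
      fix y assume "y \<in> hs M"
      then obtain i j where ij: "i < k" "j < length (W i)" "y = W i ! j" using inH by blast
      \<comment> \<open>The cyclic predecessor position: adding the length minus 1 avoids
        subtracting from 0.\<close>
      let ?j = "(j + (length (W i) - 1)) mod length (W i)"
      have j: "?j < length (W i)" by (rule modl)
      have "Suc ?j mod length (W i) = (j + length (W i)) mod length (W i)"
      proof -
        have "Suc (j + (length (W i) - 1)) = j + length (W i)" using len[of i] by linarith
        then show ?thesis by (simp only: mod_Suc_eq)
      qed
      then have "ga (W i ! ?j) = y" using ga[OF ij(1) j] ij by simp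
      then show "y \<in> ga ` hs M" using inH ij(1) j by (metis imageI)
    qed
    then show ?thesis unfolding bij_betw_def using eq_card_imp_inj_on[OF fH, of ga] by simp
  qed
  moreover have fcW: "fst (pos (W i ! j)) = i" if "i < k" "j < length (W i)" for i j using pos[OF that] by simp
  moreover have "fst (pos x) = fst (pos y) \<longleftrightarrow> y \<in> orb ga x" if xy: "x \<in> hs M" "y \<in> hs M" for x y
  proof -
    obtain i j where i: "i < k" "j < length (W i)" "x = W i ! j" using inH xy by blast
    obtain i' j' where i': "i' < k" "j' < length (W i')" "y = W i' ! j'" using inH xy by blast
    have "y \<in> set (W i) \<longleftrightarrow> i = i'" using dWW[of i i'] i i' by (auto dest: nth_mem)
    then show ?thesis using orbW[OF i(1,2)] fcW i i' by simp
  qed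
  moreover have "fst (pos x) < k" if "x \<in> hs M" for x using that inH fcW by auto
  moreover have W0: "W i ! 0 = enc (Inr (i, True))" "W i ! 1 = enc (Inr (i, False))" for i by (simp_all add: W_def)
  moreover have P: "enc (Inr (i, True)) \<in> hs M \<and> fst (pos (enc (Inr (i, True)))) = i" if "i < k" for i
    using W0(1)[of i] fcW[OF that, of 0] len[of i] inH that by (metis less_le_trans pos2)
  moreover have "la (ga (enc (Inr (i, True)))) = enc (Inr (i, True))" if "i < k" for i
    using ga[OF that, of 0] len[of i] W0[of i] Wne[of i] by (simp add: la_def)
  ultimately have "planted_map k M"
    unfolding planted_map_def cellular_map_def sig_def sel using la fH unfolding sel
    by (simp add: o_def) blast
  then interpret planted k M by unfold_locales
  have rest: "rest M i = map (enc \<circ> Inl) (ws ! i)" if i: "i < k" for i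
  proof -
    have o: "card (orb ga (enc (Inr (i, True)))) = length (W i)"
      using orbW[OF i, of 0] Wne[of i] W0(1)[of i] distinct_card[OF dW[OF i]] by simp
    have "(ga ^^ j) (enc (Inr (i, True))) = W i ! j" if "j < length (W i)" for j
      using gap[OF i, of 0 j] that Wne[of i] W0(1)[of i] by simp
    then have "rest M i = map (\<lambda>j. W i ! j) [2..<length (W i)]"
      unfolding rest_def sel o by simp
    also have "\<dots> = drop 2 (W i)" by (rule nth_equalityI) simp_all
    finally show ?thesis by (simp add: W_def)
  qed
  have rests: "rests = map (map (enc \<circ> Inl)) ws"
    unfolding rests_def using rest ws(1) by (intro nth_equalityI) auto
  have N: "N = (enc \<circ> Inl) ` S" unfolding rests_props(3)[symmetric] rests ws(3)[symmetric] by auto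
  define h where "h = restrict (\<lambda>y. projl (dec y)) N"
  have hz: "h (enc (Inl z)) = z" if "z \<in> S" for z using that by (simp add: h_def N)
  have "h \<in> isos (al M) N S" unfolding isos_def
  proof (intro CollectI conjI ballI)
    show "h \<in> extensional N" by (simp add: h_def)
    show "bij_betw h N S"
      by (rule bij_betw_byWitness[where f' = "enc \<circ> Inl"]) (auto simp: N hz)
    fix x assume "x \<in> N"
    then obtain z where z: "z \<in> S" "x = enc (Inl z)" by (auto simp: N)
    moreover have "- z \<in> S" using z S by (auto simp: symm_def closed_under_def)
    ultimately show "h (al M x) = - h x" by (simp add: hz sel la_def)
  qed
  moreover have "map (map h) rests = ws"
  proof -
    have "map (h \<circ> (enc \<circ> Inl)) w = w" if "w \<in> set ws" for w
      using that ws(3) hz by (intro map_idI) auto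
    then show ?thesis unfolding rests by (simp add: map_idI)
  qed
  ultimately have "ws \<in> words S" unfolding words_def by blast
  then show ?thesis using planted_axioms by blast
qed

lemma finite_gmaps: "finite S \<Longrightarrow> finite (gmaps k S g)"
proof -
  assume S: "finite S"
  have "gmaps k S g \<subseteq> {ws. set ws \<subseteq> {w. set w \<subseteq> S \<and> distinct w} \<and> length ws = k}"
    by (auto simp: gmaps_def distinct_concat_iff)
  then show ?thesis using finite_lists_length_eq[OF finite_subset_distinct[OF S]] finite_subset by blast
qed

text \<open>The fingerprints of two maps are equal if the maps are isomorphic and disjoint
  otherwise. They partition \<open>gmaps k S g\<close> into blocks of size
  \<open>2 ^ n * fact n\<close>, one for each isomorphism class.\<close>

lemma count_maps_eq:
  assumes S: "symm S" "card S = 2 * n"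
  shows "count_maps k g n * (2 ^ n * fact n) = card (gmaps k S g)"
proof -
  define MM where "MM = {M. planted_map k M \<and> has_genus k M g \<and> np_edges k M = n}"
  define R where "R = {(M, M'). map_iso k M M'}"
  define Wd where "Wd M = planted.words k M S" for M
  have pl: "planted k M" "has_genus k M g" "np_edges k M = n" if "M \<in> MM" for M
    using that by (simp_all add: MM_def planted_def)
  have card_Wd: "card (Wd M) = 2 ^ n * fact n" "Wd M \<noteq> {}" if "M \<in> MM" for M
    unfolding Wd_def using planted.card_words[OF pl(1)[OF that] S pl(3)[OF that]] by auto
  have eq: "Wd M = Wd M'" if "M \<in> MM" "M' \<in> MM" "map_iso k M M'" for M M'
    unfolding Wd_def using words_iso_sub pl(1) that map_iso_sym by (metis subset_antisym)
  have conv: "map_iso k M M'" if "M \<in> MM" "M' \<in> MM" "Wd M \<inter> Wd M' \<noteq> {}" for M M'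
    using words_iso_conv[OF pl(1)[OF that(1)] pl(1)[OF that(2)]] that(3) unfolding Wd_def by blast
  have refl: "map_iso k M M" for M unfolding map_iso_def by (intro exI[of _ id]) auto
  \<comment> \<open>\<open>R\<close> relates arbitrary records, so its classes are compared directly
    as images: reflexivity and transitivity hold in general, symmetry is supplied by
    plantedness.\<close>
  have "card (MM // R) = card ((\<lambda>M. R `` {M}) ` MM)" by (rule arg_cong[where f = card]) (auto simp: quotient_def)
  also have "\<dots> = card (Wd ` MM)"
  proof (rule card_image_cong_kernel[where h = id])
    fix M M' assume MM: "M \<in> MM" "M' \<in> MM"
    show "R `` {M} = R `` {M'} \<longleftrightarrow> Wd (id M) = Wd (id M')"
    proof
      assume "R `` {M} = R `` {M'}"
      then have "map_iso k M M'" using refl unfolding R_def by blast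
      then show "Wd (id M) = Wd (id M')" using eq MM by simp
    next
      assume "Wd (id M) = Wd (id M')"
      then have "map_iso k M M'" using conv MM card_Wd by auto
      moreover from this have "map_iso k M' M" by (rule map_iso_sym[OF pl(1)[OF MM(1)]])
      ultimately show "R `` {M} = R `` {M'}" unfolding R_def using map_iso_trans by blast
    qed
  qed simp
  finally have 1: "count_maps k g n = card (Wd ` MM)" by (simp add: count_maps_def MM_def R_def)
  have U: "\<Union> (Wd ` MM) = gmaps k S g"
  proof (intro set_eqI iffI)
    fix ws assume "ws \<in> \<Union> (Wd ` MM)"
    then obtain M where M: "M \<in> MM" "ws \<in> Wd M" by blast
    then obtain h where "h \<in> isos (al M) (nphs k M) S" "ws = map (map h) (planted.rests k M)"
      unfolding Wd_def planted.words_def[OF pl(1)[OF M(1)]] by blast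
    then show "ws \<in> gmaps k S g" using planted.words_sub[OF pl(1)[OF M(1)] _ S(2)] pl[OF M(1)] by blast
  next
    fix ws assume ws: "ws \<in> gmaps k S g"
    then obtain M where M: "planted k M" "ws \<in> planted.words k M S"
      using exists_planted[OF S(1), of ws k] by (auto simp: gmaps_def)
    then obtain h where "h \<in> isos (al M) (nphs k M) S" "ws = map (map h) (planted.rests k M)"
      unfolding planted.words_def[OF M(1)] by blast
    then have "M \<in> MM" using planted.words_sub[OF M(1) _ S(2)] ws M(1) by (auto simp: MM_def planted_def)
    then show "ws \<in> \<Union> (Wd ` MM)" using M(2) by (auto simp: Wd_def)
  qed
  have fin: "finite (\<Union> (Wd ` MM))" unfolding U using S finite_gmaps by (simp add: symm_def)
  have "(2 ^ n * fact n) * card (Wd ` MM) = card (\<Union> (Wd ` MM))"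
  proof (rule card_partition[OF finite_UnionD[OF fin] fin])
    show "card c = 2 ^ n * fact n" if "c \<in> Wd ` MM" for c using that card_Wd by blast
    show "c \<inter> c' = {}" if "c \<in> Wd ` MM" "c' \<in> Wd ` MM" "c \<noteq> c'" for c c'
    proof (rule ccontr)
      assume "c \<inter> c' \<noteq> {}"
      moreover obtain M M' where "M \<in> MM" "M' \<in> MM" "c = Wd M" "c' = Wd M'" using \<open>c \<in> _\<close> \<open>c' \<in> _\<close> by blast
      ultimately show False using conv eq \<open>c \<noteq> c'\<close> by metis
    qed
  qed
  then show ?thesis unfolding U 1 by (simp add: mult.commute)
qed

section \<open>Recursions and generating functions\<close>

text \<open>The number of labellings of n edges, which is the order of the hyperoctahedral
  group.\<close>

definition cnt :: "nat \<Rightarrow> nat" where "cnt n = 2 ^ n * fact n"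

lemma cnt_Suc: "cnt (Suc n) = (2 * n + 2) * cnt n"
  by (simp add: cnt_def algebra_simps)

lemma cnt_pos: "cnt n > 0" by (simp add: cnt_def)

text \<open>With this identity, division by \<open>cnt\<close> turns a labelled product into an
  ordinary Cauchy product.\<close>

lemma cnt_choose: "m \<le> n \<Longrightarrow> (n choose m) * (cnt m * cnt (n - m)) = cnt n"
  using binomial_fact_lemma[of m n] power_add[of "2::nat" m "n - m"] by (simp add: cnt_def algebra_simps)

lemma conn_single: "conn f [w]"
  by (auto simp: conn_def)

lemma conn_pair:
  assumes "cl (set A \<union> set B)" "set A \<inter> set B = {}"
  shows "conn uminus [A, B] \<longleftrightarrow> \<not> cl (set A)"
proof -
  have l: "{..<length [A, B]} = {0, 1}" by (auto simp: lessThan_Suc)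
  have p: "cl (set B) \<longleftrightarrow> cl (set A)" using cl_part[OF assms] by blast
  have "conn uminus [A, B] \<longleftrightarrow> (\<forall>I\<in>Pow {0, 1}. cl (\<Union>i\<in>I. set ([A, B] ! i)) \<longrightarrow> I = {} \<or> I = {0, 1})"
    unfolding conn_def l by blast
  also have "\<dots> \<longleftrightarrow> \<not> cl (set A)" unfolding Pow_insert using p by auto
  finally show ?thesis .
qed

text \<open>A pair of faces is closed exactly when the third face is, so the proper subsets reduce
  to single faces.\<close>

lemma conn_triple:
  assumes "cl (set A \<union> set B \<union> set C)" "set A \<inter> set B = {}" "set A \<inter> set C = {}" "set B \<inter> set C = {}"
  shows "conn uminus [A, B, C] \<longleftrightarrow> \<not> cl (set A) \<and> \<not> cl (set B) \<and> \<not> cl (set C)"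
proof -
  have l: "{..<length [A, B, C]} = {0, 1, 2}" by (auto simp: lessThan_Suc)
  have p: "cl (set A \<union> set B) \<longleftrightarrow> cl (set C)" "cl (set A \<union> set C) \<longleftrightarrow> cl (set B)" "cl (set B \<union> set C) \<longleftrightarrow> cl (set A)"
    by (rule cl_part; use assms in \<open>auto simp: Un_ac\<close>)+
  have "conn uminus [A, B, C] \<longleftrightarrow> (\<forall>I\<in>Pow {0, 1, 2}. cl (\<Union>i\<in>I. set ([A, B, C] ! i)) \<longrightarrow> I = {} \<or> I = {0, 1, 2})"
    unfolding conn_def l by blast
  also have "\<dots> \<longleftrightarrow> \<not> cl (set A) \<and> \<not> cl (set B) \<and> \<not> cl (set C)"
    unfolding Pow_insert using p by (auto simp: Un_commute)
  finally show ?thesis .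
qed

lemma card_gmaps:
  assumes S: "symm S"
  shows "card (gmaps 1 S g) = card (uni S g)" "card (gmaps 2 S g) = card (bi S g)" "card (gmaps 3 S g) = card (tri S g)"
proof -
  have cS: "cl S" using S by (simp add: symm_def)
  have "gmaps 1 S g = (\<lambda>w. [w]) ` uni S g"
    using conn_single by (auto simp: gmaps_def uni_def length_Suc_conv image_iff)
  then show "card (gmaps 1 S g) = card (uni S g)" by (simp add: card_image inj_on_def)
  have "gmaps 2 S g = (\<lambda>(A, B). [A, B]) ` bi S g"
  proof (intro set_eqI iffI)
    fix ws assume w: "ws \<in> gmaps 2 S g"
    have "length ws = 2" using w by (simp add: gmaps_def)
    then obtain A B where ws: "ws = [A, B]" by (auto simp: numeral_2_eq_2 length_Suc_conv)
    have "(A, B) \<in> bi S g" using w conn_pair[of A B] cS unfolding ws by (auto simp: gmaps_def bi_def)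
    then show "ws \<in> (\<lambda>(A, B). [A, B]) ` bi S g" unfolding ws by force
  next
    fix ws assume "ws \<in> (\<lambda>(A, B). [A, B]) ` bi S g"
    then obtain A B where "ws = [A, B]" "(A, B) \<in> bi S g" by auto
    then show "ws \<in> gmaps 2 S g" using conn_pair[of A B] cS by (auto simp: gmaps_def bi_def)
  qed
  moreover have "inj_on (\<lambda>(A, B). [A, B]) (bi S g)" by (auto simp: inj_on_def)
  ultimately show "card (gmaps 2 S g) = card (bi S g)" by (simp only: card_image)
  have "gmaps 3 S g = (\<lambda>(A, B, C). [A, B, C]) ` tri S g"
  proof (intro set_eqI iffI)
    fix ws assume w: "ws \<in> gmaps 3 S g"
    have "length ws = 3" using w by (simp add: gmaps_def)
    then obtain A B C where ws: "ws = [A, B, C]" by (auto simp: numeral_3_eq_3 length_Suc_conv)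
    have "(A, B, C) \<in> tri S g" using w conn_triple[of A B C] cS unfolding ws by (auto simp: gmaps_def tri_def Un_assoc)
    then show "ws \<in> (\<lambda>(A, B, C). [A, B, C]) ` tri S g" unfolding ws by force
  next
    fix ws assume "ws \<in> (\<lambda>(A, B, C). [A, B, C]) ` tri S g"
    then obtain A B C where "ws = [A, B, C]" "(A, B, C) \<in> tri S g" by auto
    then show "ws \<in> gmaps 3 S g" using conn_triple[of A B C] cS by (auto simp: gmaps_def tri_def Un_assoc)
  qed
  moreover have "inj_on (\<lambda>(A, B, C). [A, B, C]) (tri S g)" by (auto simp: inj_on_def)
  ultimately show "card (gmaps 3 S g) = card (tri S g)" by (simp only: card_image)
qed

lemma card_uni: "symm S \<Longrightarrow> card S = 2 * n \<Longrightarrow> card (uni S g) = u g n * cnt n"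
  using count_maps_eq[of S n 1 g] card_gmaps(1)[of S g] by (simp add: u_def cnt_def)

lemma card_bi: "symm S \<Longrightarrow> card S = 2 * n \<Longrightarrow> card (bi S g) = b g n * cnt n"
  using count_maps_eq[of S n 2 g] card_gmaps(2)[of S g] by (simp add: b_def cnt_def)

lemma card_tri: "symm S \<Longrightarrow> card S = 2 * n \<Longrightarrow> card (tri S g) = t g n * cnt n"
  using count_maps_eq[of S n 3 g] card_gmaps(3)[of S g] by (simp add: t_def cnt_def)

section \<open>From labelled to unlabelled recursions\<close>

lemma symm_split:
  assumes "symm T"
  shows "T = {x \<in> T. x > 0} \<union> uminus ` {x \<in> T. x > 0}" "card T = 2 * card {x \<in> T. x > 0}"
proof -
  let ?X = "{x \<in> T. x > 0}"
  have f: "finite ?X" using assms by (simp add: symm_def)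
  show T: "T = ?X \<union> uminus ` ?X"
  proof (intro set_eqI iffI)
    fix x assume x: "x \<in> T"
    then have "x \<noteq> 0" "- x \<in> T" using assms by (auto simp: symm_def closed_under_def)
    then show "x \<in> ?X \<union> uminus ` ?X" using x by (cases "x > 0") (auto simp: image_iff intro: bexI[of _ "- x"])
  next
    fix x assume "x \<in> ?X \<union> uminus ` ?X"
    then show "x \<in> T" using assms by (auto simp: symm_def closed_under_def)
  qed
  have "card (?X \<union> uminus ` ?X) = card ?X + card (uminus ` ?X)"
    by (rule card_Un_disjoint) (use f in auto)
  also have "card (uminus ` ?X) = card ?X" by (rule card_image) (simp add: inj_on_def)
  finally show "card T = 2 * card ?X" using T by simp
qed

text \<open>A symmetric set is determined by its positive elements, one for each edge, so symmetric
  subsets with m edges correspond to m-subsets of n edges.\<close>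

lemma sum_symsubs:
  fixes \<phi> :: "nat \<Rightarrow> nat"
  assumes T: "symm T" and n: "card T = 2 * n"
  shows "(\<Sum>R\<in>symsubs T. \<phi> (card R)) = (\<Sum>m\<le>n. (n choose m) * \<phi> (2 * m))"
proof -
  let ?X = "{x \<in> T. x > 0}"
  have f: "finite ?X" using T by (simp add: symm_def)
  have cX: "card ?X = n" using symm_split(2)[OF T] n by simp
  have "(\<Sum>R\<in>symsubs T. \<phi> (card R)) = (\<Sum>Y\<in>Pow ?X. \<phi> (2 * card Y))"
  proof (rule sum.reindex_bij_witness[where i = "\<lambda>Y. Y \<union> uminus ` Y" and j = "\<lambda>R. {x \<in> R. x > 0}"])
    fix R assume R: "R \<in> symsubs T"
    then have sR: "symm R" using symm_sub[OF T] by (auto simp: symsubs_def)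
    show "{x \<in> R. x > 0} \<union> uminus ` {x \<in> R. x > 0} = R" using symm_split(1)[OF sR] by simp
    show "{x \<in> R. x > 0} \<in> Pow ?X" using R by (auto simp: symsubs_def)
    show "\<phi> (2 * card {x \<in> R. x > 0}) = \<phi> (card R)" using symm_split(2)[OF sR] by simp
  next
    fix Y assume Y: "Y \<in> Pow ?X"
    then show "{x \<in> Y \<union> uminus ` Y. x > 0} = Y" by auto
    show "Y \<union> uminus ` Y \<in> symsubs T" using Y T by (auto simp: symsubs_def symm_def closed_under_def)
  qed
  also have "\<dots> = (\<Sum>m\<le>n. \<Sum>Y\<in>{Y \<in> Pow ?X. card Y = m}. \<phi> (2 * card Y))"
    by (rule sum.group[symmetric]) (use f cX card_mono in auto)
  also have "\<dots> = (\<Sum>m\<le>n. (n choose m) * \<phi> (2 * m))"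
  proof (rule sum.cong[OF refl])
    fix m
    have "{Y \<in> Pow ?X. card Y = m} = {Y. Y \<subseteq> ?X \<and> card Y = m}" by auto
    then have "card {Y \<in> Pow ?X. card Y = m} = n choose m" using n_subsets[OF f, of m] cX by simp
    then show "(\<Sum>Y\<in>{Y \<in> Pow ?X. card Y = m}. \<phi> (2 * card Y)) = (n choose m) * \<phi> (2 * m)" by simp
  qed
  finally show ?thesis .
qed

lemma sum_symsubs_prod:
  fixes F G :: "nat \<Rightarrow> nat \<Rightarrow> nat"
  assumes T: "symm T" and n: "card T = 2 * n"
    and X: "\<And>R m h. R \<in> symsubs T \<Longrightarrow> card R = 2 * m \<Longrightarrow> X R h = F h m * cnt m"
    and Y: "\<And>R m h. R \<in> symsubs T \<Longrightarrow> card (T - R) = 2 * m \<Longrightarrow> Y R h = G h m * cnt m"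
  shows "(\<Sum>R\<in>symsubs T. \<Sum>h\<le>K. X R h * Y R (K - h)) = (\<Sum>m\<le>n. \<Sum>h\<le>K. F h m * G (K - h) (n - m)) * cnt n"
proof -
  define \<phi> where "\<phi> c = (\<Sum>h\<le>K. F h (c div 2) * cnt (c div 2) * (G (K - h) (n - c div 2) * cnt (n - c div 2)))" for c
  have "(\<Sum>R\<in>symsubs T. \<Sum>h\<le>K. X R h * Y R (K - h)) = (\<Sum>R\<in>symsubs T. \<phi> (card R))"
    unfolding \<phi>_def
  proof (intro sum.cong refl arg_cong2[where f = "(*)"])
    fix R assume R: "R \<in> symsubs T"
    then have sR: "symm R" "R \<subseteq> T" using symm_sub[OF T] by (auto simp: symsubs_def)
    then have c: "card R = 2 * (card R div 2)" using symm_split(2)[OF sR(1)] by simp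
    have fT: "finite T" using T by (simp add: symm_def)
    have "card (T - R) = card T - card R" using sR(2) fT finite_subset by (intro card_Diff_subset) auto
    then have c': "card (T - R) = 2 * (n - card R div 2)" using c n by linarith
    show "X R h = F h (card R div 2) * cnt (card R div 2)" for h by (rule X[OF R c])
    show "Y R (K - h) = G (K - h) (n - card R div 2) * cnt (n - card R div 2)" for h by (rule Y[OF R c'])
  qed
  also have "\<dots> = (\<Sum>m\<le>n. (n choose m) * \<phi> (2 * m))" by (rule sum_symsubs[OF T n])
  also have "\<dots> = (\<Sum>m\<le>n. \<Sum>h\<le>K. F h m * G (K - h) (n - m) * cnt n)"
  proof (intro sum.cong refl)
    fix m assume "m \<in> {..n}"
    then have e: "(n choose m) * (cnt m * cnt (n - m)) = cnt n" using cnt_choose by simp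
    have "(n choose m) * \<phi> (2 * m) = (\<Sum>h\<le>K. F h m * G (K - h) (n - m) * ((n choose m) * (cnt m * cnt (n - m))))"
      unfolding \<phi>_def sum_distrib_left by (intro sum.cong refl) (simp add: ac_simps)
    then show "(n choose m) * \<phi> (2 * m) = (\<Sum>h\<le>K. F h m * G (K - h) (n - m) * cnt n)" unfolding e .
  qed
  finally show ?thesis by (simp add: sum_distrib_right)
qed

lemma pairs_uni_eq:
  assumes "symm T" "card T = 2 * n"
  shows "pairs_uni T K = (\<Sum>m\<le>n. \<Sum>h\<le>K. u h m * u (K - h) (n - m)) * cnt n"
  unfolding pairs_uni_def
proof (rule sum_symsubs_prod[OF assms])
  fix R m h assume R: "R \<in> symsubs T"
  show "card (uni R h) = u h m * cnt m" if "card R = 2 * m"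
    using R that symm_sub[OF assms(1)] by (intro card_uni) (auto simp: symsubs_def)
  show "card (uni (T - R) h) = u h m * cnt m" if "card (T - R) = 2 * m"
    using R that symm_diff[OF assms(1)] by (intro card_uni) (auto simp: symsubs_def)
qed

lemma pairs_bi_eq:
  assumes "symm T" "card T = 2 * n"
  shows "pairs_bi T K = (\<Sum>m\<le>n. \<Sum>h\<le>K. u h m * b (K - h) (n - m)) * cnt n"
  unfolding pairs_bi_def
proof (rule sum_symsubs_prod[OF assms])
  fix R m h assume R: "R \<in> symsubs T"
  show "card (uni R h) = u h m * cnt m" if "card R = 2 * m"
    using R that symm_sub[OF assms(1)] by (intro card_uni) (auto simp: symsubs_def)
  show "card (bi (T - R) h) = b h m * cnt m" if "card (T - R) = 2 * m"
    using R that symm_diff[OF assms(1)] by (intro card_bi) (auto simp: symsubs_def)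
qed

lemma symm_exists: "\<exists>S. symm S \<and> card S = 2 * n"
proof (intro exI conjI)
  let ?S = "{- int n..int n} - {0}"
  show "symm ?S" by (auto simp: symm_def closed_under_def)
  show "card ?S = 2 * n" by simp
qed

text \<open>Any symmetric \<open>S\<close> with n+1 edges will do. Each of its 2n+2 letters
  contributes equally as first letter, and 2n+2 is the quotient of \<open>cnt (Suc n)\<close> by
  \<open>cnt n\<close>.\<close>

lemma u_rec: "u G (Suc n) = (\<Sum>m\<le>n. \<Sum>h\<le>G. u h m * u (G - h) (n - m)) + (if G = 0 then 0 else b (G - 1) n)"
proof -
  obtain S where S: "symm S" "card S = 2 * Suc n" using symm_exists by blast
  let ?r = "(\<Sum>m\<le>n. \<Sum>h\<le>G. u h m * u (G - h) (n - m)) + (if G = 0 then 0 else b (G - 1) n)"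
  have "S \<noteq> {}" using S(2) by auto
  have sm: "(\<Sum>x\<in>S. r * cnt n) = r * cnt (Suc n)" for r using S(2) by (simp add: cnt_Suc algebra_simps)
  have "u G (Suc n) * cnt (Suc n) = card (uni S G)" using card_uni[OF S] by simp
  also have "\<dots> = (\<Sum>x\<in>S. ?r * cnt n)"
    unfolding card_uni_rec[OF S(1) \<open>S \<noteq> {}\<close>]
  proof (rule sum.cong[OF refl])
    fix x assume "x \<in> S"
    note T = symm_remove[OF S(1) this]
    have c: "card (S - {x, - x}) = 2 * n" using T(2) S(2) by simp
    show "pairs_uni (S - {x, - x}) G + (if G = 0 then 0 else card (bi (S - {x, - x}) (G - 1))) = ?r * cnt n"
      using pairs_uni_eq[OF T(1) c] card_bi[OF T(1) c] by (simp add: algebra_simps)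
  qed
  also have "\<dots> = ?r * cnt (Suc n)" by (rule sm)
  finally show ?thesis using cnt_pos[of "Suc n"] by simp
qed

lemma b_rec: "b (Suc g) (Suc n) = t g n + 2 * (\<Sum>m\<le>n. \<Sum>h\<le>Suc g. u h m * b (Suc g - h) (n - m)) + (n + 1) * (2 * n + 1) * u (Suc g) n"
proof -
  obtain S where S: "symm S" "card S = 2 * Suc n" using symm_exists by blast
  let ?r = "t g n + 2 * (\<Sum>m\<le>n. \<Sum>h\<le>Suc g. u h m * b (Suc g - h) (n - m)) + (n + 1) * (2 * n + 1) * u (Suc g) n"
  have S2: "card S = 2 * n + 2" using S(2) by simp
  have sm: "(\<Sum>x\<in>S. r * cnt n) = r * cnt (Suc n)" for r using S(2) by (simp add: cnt_Suc algebra_simps)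
  have "b (Suc g) (Suc n) * cnt (Suc n) = card (bi S (g + 1))" using card_bi[OF S] by simp
  also have "\<dots> = (\<Sum>x\<in>S. ?r * cnt n)"
    unfolding card_bi_rec[OF S(1) S2]
  proof (rule sum.cong[OF refl])
    fix x assume "x \<in> S"
    note T = symm_remove[OF S(1) this]
    have c: "card (S - {x, - x}) = 2 * n" using T(2) S(2) by simp
    show "card (tri (S - {x, - x}) g) + 2 * pairs_bi (S - {x, - x}) (g + 1) + (n + 1) * (2 * n + 1) * card (uni (S - {x, - x}) (g + 1)) = ?r * cnt n"
      unfolding pairs_bi_eq[OF T(1) c] card_uni[OF T(1) c] card_tri[OF T(1) c] Suc_eq_plus1
      by (simp only: distrib_right mult.assoc)
  qed
  also have "\<dots> = ?r * cnt (Suc n)" by (rule sm)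
  finally show ?thesis using cnt_pos[of "Suc n"] by simp
qed

lemma u_0: "u g 0 = (if g = 0 then 1 else 0)"
proof -
  have "symm {}" by (simp add: symm_def closed_under_def)
  then have "u g 0 * cnt 0 = card (uni {} g)" using card_uni[of "{}" 0 g] by simp
  also have "uni {} g = (if g = 0 then {[]} else {})" by (auto simp: uni_def nv_empty)
  finally show ?thesis by (simp add: cnt_def)
qed

section \<open>Generating functions and coefficient extraction\<close>

unbundle fps_syntax

text \<open>Nested series: the outer variable \<open>fps_X\<close> marks np-edges, and the inner
  one, written \<open>fps_const fps_X\<close>, marks the genus.\<close>

definition gf :: "(nat \<Rightarrow> nat \<Rightarrow> nat) \<Rightarrow> int fps fps" where
  "gf F = Abs_fps (\<lambda>n. Abs_fps (\<lambda>g. int (F g n)))"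

lemma gf_nth [simp]: "gf F $ n $ g = int (F g n)"
  by (simp add: gf_def)

lemma fps2_mult_nth: "((A :: int fps fps) * C) $ n $ g = (\<Sum>i\<le>n. \<Sum>j\<le>g. A $ i $ j * C $ (n - i) $ (g - j))"
  by (simp add: fps_mult_nth fps_sum_nth atLeast0AtMost)

lemma gf_u: "gf u = 1 + fps_X * (gf u * gf u + fps_const fps_X * gf b)"
proof -
  have "gf u $ n $ g = (1 + fps_X * (gf u * gf u + fps_const fps_X * gf b)) $ n $ g" for n g
  proof (cases n)
    case 0
    then show ?thesis by (simp add: u_0)
  next
    case (Suc m)
    then show ?thesis using u_rec[of g m]
      by (simp add: fps2_mult_nth)
  qed
  then show ?thesis by (simp add: fps_eq_iff)
qed

lemma gf_ustar: "gf ustar = gf u - 1"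
proof -
  have "gf ustar $ n $ g = (gf u - 1) $ n $ g" for n g
    by (cases n; cases g) (simp_all add: ustar_def u_0)
  then show ?thesis by (simp add: fps_eq_iff)
qed

lemma d2_gf: "d2 g n = 3 * (gf ustar * gf b) $ n $ (g + 1) + (gf ustar * (gf ustar * gf ustar)) $ n $ (g + 2)"
proof -
  have 1: "(\<Sum>g1\<le>g+1. \<Sum>m\<le>n. int (ustar g1 m) * int (b (g + 1 - g1) (n - m))) = (gf ustar * gf b) $ n $ (g + 1)"
    unfolding fps2_mult_nth gf_nth by (rule sum.swap)
  have "(\<Sum>g1\<le>g+2. \<Sum>g2\<le>g+2-g1. \<Sum>m1\<le>n. \<Sum>m2\<le>n-m1.
        int (ustar g1 m1) * int (ustar g2 m2) * int (ustar (g + 2 - g1 - g2) (n - m1 - m2)))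
    = (\<Sum>g1\<le>g+2. \<Sum>m1\<le>n. \<Sum>m2\<le>n-m1. \<Sum>g2\<le>g+2-g1.
        int (ustar g1 m1) * (int (ustar g2 m2) * int (ustar (g + 2 - g1 - g2) (n - m1 - m2))))"
    unfolding mult.assoc
    by (rule sum.cong[OF refl], subst sum.swap, rule sum.cong[OF refl], rule sum.swap)
  also have "\<dots> = (\<Sum>m1\<le>n. \<Sum>g1\<le>g+2. int (ustar g1 m1) * (gf ustar * gf ustar) $ (n - m1) $ (g + 2 - g1))"
    unfolding fps2_mult_nth gf_nth sum_distrib_left by (rule sum.swap)
  also have "\<dots> = (gf ustar * (gf ustar * gf ustar)) $ n $ (g + 2)"
    unfolding fps2_mult_nth[of "gf ustar" "gf ustar * gf ustar"] gf_nth ..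
  finally show ?thesis unfolding d2_def 1 by simp
qed

theorem theorem5p6:
  fixes g n :: nat
  shows "int (u (g+2) (n+2)) = int (t g n) + d2 g n + 4 * int (u (g+2) (n+1))
           - 3 * int (u (g+2) n) + int ((n+1) * (2*n+1)) * int (u (g+1) n)"
proof -
  define U where "U = gf u"
  define B where "B = gf b"
  define V where "V = gf ustar"
  \<comment> \<open>\<open>x\<close> is the genus variable, called y in the overview.\<close>
  define x where "x = (fps_const fps_X :: int fps fps)"
  define z where "z = (fps_X :: int fps fps)"
  have UV: "U = 1 + V" unfolding U_def V_def gf_ustar by simp
  have Urec: "U = 1 + z * (U * U + x * B)" using gf_u by (simp add: U_def B_def x_def z_def)
  then have Vrec: "V = z * (U * U + x * B)" unfolding UV by simp
  have "U * U = 1 + 2 * V + V * V" unfolding UV by (simp add: algebra_simps)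
  \<comment> \<open>\<open>d2\<close> consists of V^3 and V B, so these products are to be produced:
    one factor of V^2 is expanded by \<open>Vrec\<close>.\<close>
  also have "V * V = z * (V * (U * U) + x * (V * B))" by (subst (2) Vrec) (simp add: algebra_simps)
  \<comment> \<open>V U^2 is V + 2 V^2 + V^3, and 2 V^2 is traded for 2 U^2 - 2 - 4 V. The remaining
    U^2 has coefficients known from \<open>step\<close>.\<close>
  also have "V * (U * U) = V * (V * V) + 2 * (U * U) - 2 - 3 * V" unfolding UV by (simp add: algebra_simps)
  finally have sq: "U * U = 1 + 2 * V + z * (V * (V * V) + 2 * (U * U) - 2 - 3 * V + x * (V * B))" .
  have ev: "(z * A) $ Suc m $ k = A $ m $ k" "(x * A) $ m $ Suc k = A $ m $ k" for A m k
    by (simp_all add: z_def x_def)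
  have two: "(2 * A) $ m $ k = 2 * (A $ m $ k)" "(3 * A) $ m $ k = 3 * (A $ m $ k)" for A :: "int fps fps" and m k
    by (simp_all only: mult_2 fps_add_nth numeral_3_eq_3 mult_Suc) (simp_all add: numeral_fps_const)
  have Us: "U $ m $ k = int (u k m)" and Bs: "B $ m $ k = int (b k m)" for m k by (simp_all add: U_def B_def)
  \<comment> \<open>At positive genus \<open>ustar\<close> and \<open>u\<close> agree, and the
    constants 1 and -2 in \<open>sq\<close> have no coefficient there.\<close>
  have Vs: "V $ m $ Suc k = int (u (Suc k) m)" for m k by (simp add: V_def ustar_def)
  have step: "int (u (Suc k) (Suc m)) = (U * U) $ m $ Suc k + int (b k m)" for k m
    using arg_cong[OF Urec, of "\<lambda>A. A $ Suc m $ Suc k"] by (simp add: ev Us Bs)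
  have c: "(V * (V * V) + 2 * (U * U) - 2 - 3 * V + x * (V * B)) $ n $ Suc (Suc g)
      = (V * (V * V)) $ n $ Suc (Suc g) + 2 * (U * U) $ n $ Suc (Suc g) - 3 * int (u (Suc (Suc g)) n) + (V * B) $ n $ Suc g"
    using Vs[of n "Suc g"] by (simp add: two ev fps_numeral_nth)
  have "(U * U) $ Suc n $ Suc (Suc g) = 2 * int (u (Suc (Suc g)) (Suc n)) + ((V * (V * V)) $ n $ Suc (Suc g)
      + 2 * (U * U) $ n $ Suc (Suc g) - 3 * int (u (Suc (Suc g)) n) + (V * B) $ n $ Suc g)"
    using arg_cong[OF sq, of "\<lambda>A. A $ Suc n $ Suc (Suc g)"] Vs[of "Suc n" "Suc g"]
    unfolding c[symmetric] by (simp add: two ev)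
  moreover have "int (u (Suc (Suc g)) (Suc n)) = (U * U) $ n $ Suc (Suc g) + int (b (Suc g) n)" by (rule step)
  moreover have "int (u (Suc (Suc g)) (Suc (Suc n))) = (U * U) $ Suc n $ Suc (Suc g) + int (b (Suc g) (Suc n))" by (rule step)
  moreover have "int (b (Suc g) (Suc n)) = int (t g n) + 2 * (U * B) $ n $ Suc g + int ((n + 1) * (2 * n + 1)) * int (u (Suc g) n)"
    unfolding b_rec fps2_mult_nth Us Bs by (simp add: distrib_right)
  moreover have "(U * B) $ n $ Suc g = (V * B) $ n $ Suc g + int (b (Suc g) n)"
    unfolding UV by (simp add: distrib_right Bs)
  moreover have "d2 g n = 3 * (V * B) $ n $ Suc g + (V * (V * V)) $ n $ Suc (Suc g)"
    unfolding d2_gf V_def B_def by simp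
  \<comment> \<open>By \<open>step\<close>, the coefficient of 2 U^2 at n is 2 u(n+1) - 2 b(n). With
    the 2 u(n+1) from \<open>sq\<close> this makes the 4; the term -2 b(n) cancels against the b in
    2 U B = 2 V B + 2 B. The V B from \<open>sq\<close> and the two left here give the 3 in
    \<open>d2\<close>.\<close>
  ultimately show ?thesis by simp
qed

end
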